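(* There exist absolute positive constants $c_\star, C, c_a, c_b, c_c$ such that the following holds. Let $n\ge 2$, $\theta\in(0,1/2)$, $0<\mu< c_a\min\{\theta n^{-1}, n^{-5/4}\}$, and let $\mathbf X_0\in\mathbb R^{n\times p}$ satisfy $\mathbf X_0\sim_{i.i.d.}\mathrm{BG}(\theta)$ with $$p\ \ge\ \frac{C}{\mu^2\theta^2}\, n^3\log\frac{n}{\mu\theta}.$$ Then with probability at least $1-c_b p^{-6}$ the following hold simultaneously: $$\nabla^2 g(\mathbf w;\mathbf X_0)\succeq \frac{c_\star\theta}{\mu}\mathbf I\quad\text{for all }\mathbf w\text{ with }\|\mathbf w\|\le \frac{\mu}{4\sqrt2},$$ $$\frac{\mathbf w^*\nabla g(\mathbf w;\mathbf X_0)}{\|\mathbf w\|}\ge c_\star\theta\quad\text{for all }\mathbf w\text{ with }\frac{\mu}{4\sqrt2}\le\|\mathbf w\|\le\frac{1}{20\sqrt5},$$ $$\frac{\mathbf w^*\nabla^2 g(\mathbf w;\mathbf X_0)\mathbf w}{\|\mathbf w\|^2}\le -c_\star\theta\quad\text{for all }\mathbf w\text{ with }\frac{1}{20\sqrt5}\le\|\mathbf w\|\le\sqrt{\frac{4n-1}{4n}},$$ and the function $\mathbf w\mapsto g(\mathbf w;\mathbf X_0)$ has exactly one local minimizer $\mathbf w_\star$ over the open set $\Gamma$, which satisfies $$\|\mathbf w_\star\|\le \min\Big\{\frac{c_c\mu}{\theta}\sqrt{\frac{n\log p}{p}},\ \frac{\mu}{16}\Big\}.$$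
   Context: Bernoulli–Gaussian model: for $\theta\in(0,1)$, a random variable $Z\sim\mathrm{BG}(\theta)$ means $Z=BG$ with $B\sim\mathrm{Ber}(\theta)$, $G\sim\mathcal N(0,1)$ independent; $\mathbf X\sim_{i.i.d.}\mathrm{BG}(\theta)$ means all entries of $\mathbf X$ are independent $\mathrm{BG}(\theta)$ variables. For $\mu>0$ let $h_\mu(z)=\mu\log\cosh(z/\mu)$. For $\mathbf Y\in\mathbb R^{n\times p}$ with columns $\mathbf y_1,\dots,\mathbf y_p$ and $\mathbf q\in\mathbb S^{n-1}$, let $f(\mathbf q;\mathbf Y)=\frac1p\sum_{k=1}^p h_\mu(\mathbf q^*\mathbf y_k)$. For $\mathbf w$ in the open unit ball of $\mathbb R^{n-1}$ let $\mathbf q(\mathbf w)=(\mathbf w,\sqrt{1-\|\mathbf w\|^2})\in\mathbb S^{n-1}$ and $g(\mathbf w;\mathbf Y)=f(\mathbf q(\mathbf w);\mathbf Y)$. Gradients $\nabla$ and Hessians $\nabla^2$ are taken with respect to $\mathbf w$. $\Gamma=\{\mathbf w\in\mathbb R^{n-1}:\|\mathbf w\|<\sqrt{(4n-1)/(4n)}\}$. $\|\cdot\|$ is the Euclidean norm and $^*$ denotes transpose. *)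

theory Defs
  imports "HOL-Probability.Probability"
begin

definition BG :: "real \<Rightarrow> real measure" where
  "BG \<theta> = distr (measure_pmf (bernoulli_pmf \<theta>) \<Otimes>\<^sub>M density lborel std_normal_density) borel
            (\<lambda>(b, g). (if b then 1 else 0) * g)"

definition BG_matrix :: "nat \<Rightarrow> nat \<Rightarrow> real \<Rightarrow> (nat \<times> nat \<Rightarrow> real) measure" where
  "BG_matrix n p \<theta> = PiM ({..<n} \<times> {..<p}) (\<lambda>_. BG \<theta>)"

text \<open>Vectors of R^m are represented as functions nat => real vanishing at indices >= m.\<close>
definition vecs :: "nat \<Rightarrow> (nat \<Rightarrow> real) set" where
  "vecs m = {w. \<forall>i\<ge>m. w i = 0}"

definition vnorm :: "nat \<Rightarrow> (nat \<Rightarrow> real) \<Rightarrow> real" where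
  "vnorm m w = sqrt (\<Sum>i<m. (w i)\<^sup>2)"

definition hmu :: "real \<Rightarrow> real \<Rightarrow> real" where
  "hmu \<mu> z = \<mu> * ln (cosh (z / \<mu>))"

definition qmap :: "nat \<Rightarrow> (nat \<Rightarrow> real) \<Rightarrow> nat \<Rightarrow> real" where
  "qmap n w = (\<lambda>i. if i < n - 1 then w i
                   else if i = n - 1 then sqrt (1 - (vnorm (n - 1) w)\<^sup>2) else 0)"

definition fobj :: "nat \<Rightarrow> nat \<Rightarrow> real \<Rightarrow> (nat \<Rightarrow> real) \<Rightarrow> (nat \<times> nat \<Rightarrow> real) \<Rightarrow> real" where
  "fobj n p \<mu> q Y = (1 / real p) * (\<Sum>k<p. hmu \<mu> (\<Sum>i<n. q i * Y (i, k)))"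

definition gobj :: "nat \<Rightarrow> nat \<Rightarrow> real \<Rightarrow> (nat \<times> nat \<Rightarrow> real) \<Rightarrow> (nat \<Rightarrow> real) \<Rightarrow> real" where
  "gobj n p \<mu> Y w = fobj n p \<mu> (qmap n w) Y"

definition partial :: "nat \<Rightarrow> ((nat \<Rightarrow> real) \<Rightarrow> real) \<Rightarrow> (nat \<Rightarrow> real) \<Rightarrow> real" where
  "partial i F w = deriv (\<lambda>t. F (w(i := t))) (w i)"

definition grad :: "((nat \<Rightarrow> real) \<Rightarrow> real) \<Rightarrow> (nat \<Rightarrow> real) \<Rightarrow> nat \<Rightarrow> real" where
  "grad F w i = partial i F w"

definition hess :: "((nat \<Rightarrow> real) \<Rightarrow> real) \<Rightarrow> (nat \<Rightarrow> real) \<Rightarrow> nat \<Rightarrow> nat \<Rightarrow> real" where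
  "hess F w i j = partial i (\<lambda>v. partial j F v) w"

definition Gamma :: "nat \<Rightarrow> (nat \<Rightarrow> real) set" where
  "Gamma n = {w \<in> vecs (n - 1). vnorm (n - 1) w < sqrt ((4 * real n - 1) / (4 * real n))}"

definition local_min_on :: "nat \<Rightarrow> ((nat \<Rightarrow> real) \<Rightarrow> real) \<Rightarrow> (nat \<Rightarrow> real) set \<Rightarrow> (nat \<Rightarrow> real) \<Rightarrow> bool" where
  "local_min_on m F S w \<longleftrightarrow> w \<in> S \<and>
     (\<exists>\<epsilon>>0. \<forall>v\<in>S. vnorm m (\<lambda>i. v i - w i) < \<epsilon> \<longrightarrow> F w \<le> F v)"

end

theory Submission
  imports Defs
begin

text \<open>
A linear form in Bernoulli-Gaussian variables is a mixture of centred Gaussians whose variance is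
the squared norm of the coefficients on the random support. Near \<open>0\<close> the Hessian is therefore bounded
below by second and fourth moments, on the columns whose last entry vanishes; in the intermediate
shell, reflecting the first \<open>n - 1\<close> coordinates shows that \<open>tanh\<close> only helps and moments again suffice.
In the outer region a rotation of the plane splits \<open>(w \<cdot> x, x\<^sub>n)\<close> into \<open>s = q \<cdot> x\<close> and an independent
Gaussian; Gaussian integration by parts then leaves the expected curvature
\<open>- (1 - \<sigma>\<^sup>2) / \<sigma>\<^sup>2 \<cdot> E h''(s)\<close>, where \<open>\<sigma>\<^sup>2\<close> is the conditional variance of \<open>s\<close>, up to
\<open>O(\<mu>\<^sup>2 / \<sigma>\<^sup>5)\<close>, which is where \<open>\<mu> < c n\<^bsup>-5/4\<^esup>\<close> is needed. A Chernoff bound for functions of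
quadratic growth, a union bound over a grid of mesh \<open>p\<^bsup>-90\<^esup>\<close> and crude polynomial Lipschitz
bounds make the three estimates uniform. Strong convexity near \<open>0\<close> then bounds the minimizer by
\<open>\<parallel>\<nabla>g(0)\<parallel>\<close> over the modulus.
\<close>

section \<open>Derivatives along lines\<close>

text \<open>Every region asks for a one-sided bound, so only lower tails matter: a mean of at least
  \<open>2 * \<tau>\<close> drops to \<open>\<tau> / 2\<close> by the Chernoff bound and a little
  further by rounding. The n^3 in the sample size is the product of two costs. The tail exponent per
  column is the square of mean over growth constant; for the radial curvature the mean is of order
  \<theta>, while one column can contribute 1 / (\<mu> q_n^2) with q_n^2 as small as 1 / (4 n),
  which gives (\<mu> \<theta> / n)^2. The grid adds a factor n log p; its mesh enters only through
  the logarithm and can be extremely fine. The obstacle is the outer region: the rank-one term and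
  the term from the bending of the sphere can both have conditional means of order 1 / q_n^2, with
  opposite signs, and only their exact difference shows the sign. Hence an identity there, while
  estimates suffice further in. Columns with vanishing last entry have no negative term; they
  contribute at most 4 \<mu>, which \<mu> < c \<theta> / n makes small against \<theta>.\<close>

text \<open>
  The paper's \<open>n\<close> is \<open>Suc m\<close>: \<open>dotp m\<close> only sees the first \<open>n - 1\<close> coordinates, and \<open>x m\<close> is the last one.
  \<open>GF\<close> and \<open>HB\<close> are the contributions of one column \<open>x\<close> to \<open>v\<^sup>* \<nabla>g(w)\<close> and \<open>u\<^sup>* \<nabla>\<^sup>2g(w) v\<close>.
\<close>

definition dotp :: "nat \<Rightarrow> (nat \<Rightarrow> real) \<Rightarrow> (nat \<Rightarrow> real) \<Rightarrow> real" where
  "dotp m v x = (\<Sum>i<m. v i * x i)"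

definition lastq :: "nat \<Rightarrow> (nat \<Rightarrow> real) \<Rightarrow> real" where
  "lastq m w = sqrt (1 - dotp m w w)"

definition qarg :: "nat \<Rightarrow> (nat \<Rightarrow> real) \<Rightarrow> (nat \<Rightarrow> real) \<Rightarrow> real" where
  "qarg m w x = dotp m w x + lastq m w * x m"

definition GF :: "nat \<Rightarrow> real \<Rightarrow> (nat \<Rightarrow> real) \<Rightarrow> (nat \<Rightarrow> real) \<Rightarrow> (nat \<Rightarrow> real) \<Rightarrow> real" where
  "GF m \<mu> w v x = tanh (qarg m w x / \<mu>) * (dotp m v x - x m * dotp m w v / lastq m w)"

definition HB :: "nat \<Rightarrow> real \<Rightarrow> (nat \<Rightarrow> real) \<Rightarrow> (nat \<Rightarrow> real) \<Rightarrow> (nat \<Rightarrow> real) \<Rightarrow> (nat \<Rightarrow> real) \<Rightarrow> real" where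
  "HB m \<mu> w u v x =
     (1 - (tanh (qarg m w x / \<mu>))\<^sup>2) / \<mu> * (dotp m u x - x m * dotp m w u / lastq m w)
        * (dotp m v x - x m * dotp m w v / lastq m w)
     - x m * tanh (qarg m w x / \<mu>) * (dotp m u v / lastq m w + dotp m w u * dotp m w v / lastq m w ^ 3)"

lemma dotp_commute: "dotp m v x = dotp m x v"
  by (simp add: dotp_def mult.commute)

lemma dotp_add_scale_left: "dotp m (\<lambda>i. w i + t * u i) x = dotp m w x + t * dotp m u x"
  by (simp add: dotp_def algebra_simps sum.distrib sum_distrib_left)

lemma dotp_add_scale_right: "dotp m x (\<lambda>i. w i + t * u i) = dotp m x w + t * dotp m x u"
  by (simp add: dotp_def algebra_simps sum.distrib sum_distrib_left)

lemma dotp_scale_left: "dotp m (\<lambda>i. t * u i) x = t * dotp m u x"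
  by (simp add: dotp_def algebra_simps sum_distrib_left)

lemma dotp_scale_right: "dotp m x (\<lambda>i. t * u i) = t * dotp m x u"
  by (simp add: dotp_def algebra_simps sum_distrib_left)

lemma dotp_self_nonneg [simp]: "0 \<le> dotp m w w"
  by (simp add: dotp_def sum_nonneg)

lemma vnorm_eq: "vnorm m w = sqrt (dotp m w w)"
  by (simp add: vnorm_def dotp_def power2_eq_square)

lemma vnorm_nonneg [simp]: "0 \<le> vnorm m w"
  by (simp add: vnorm_eq)

lemma vnorm_sq: "(vnorm m w)\<^sup>2 = dotp m w w"
  by (simp add: vnorm_eq)

lemma dotp_unit:
  assumes "i < m"
  shows "dotp m (\<lambda>j. if j = i then 1 else 0) x = x i"
proof -
  have "dotp m (\<lambda>j. if j = i then 1 else 0) x = (\<Sum>j<m. if j = i then x j else 0)"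
    unfolding dotp_def by (intro sum.cong) auto
  also have "\<dots> = x i" using assms by (subst sum.delta) auto
  finally show ?thesis .
qed

lemma gobj_qarg:
  "gobj (Suc m) p \<mu> X w = (1 / real p) * (\<Sum>k<p. hmu \<mu> (qarg m w (\<lambda>i. X (i, k))))"
proof -
  have "(\<Sum>i<Suc m. qmap (Suc m) w i * X (i, k)) = qarg m w (\<lambda>i. X (i, k))" for k
    by (simp add: qmap_def qarg_def dotp_def[of m w "\<lambda>i. X (i, k)"] lastq_def vnorm_sq)
  then show ?thesis
    unfolding gobj_def fobj_def by simp
qed

text \<open>Along a line the squared norm is a quadratic polynomial in \<open>t\<close>, so this is
  a one-variable derivative of a square root; the strict inequality keeps its argument
  positive.\<close>

lemma lastq_line_DERIV:
  assumes "dotp m (\<lambda>i. w i + t * u i) (\<lambda>i. w i + t * u i) < 1"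
  shows "((\<lambda>t. lastq m (\<lambda>i. w i + t * u i)) has_real_derivative
           - dotp m (\<lambda>i. w i + t * u i) u / lastq m (\<lambda>i. w i + t * u i)) (at t)"
proof -
  have eq: "lastq m (\<lambda>i. w i + t * u i)
      = sqrt (1 - (dotp m w w + 2 * t * dotp m w u + t * t * dotp m u u))" for t
    unfolding lastq_def dotp_add_scale_left dotp_add_scale_right
    by (simp add: dotp_commute[of m u w] algebra_simps)
  have pos: "1 - (dotp m w w + 2 * t * dotp m w u + t * t * dotp m u u) > 0"
    using assms unfolding dotp_add_scale_left dotp_add_scale_right
    by (simp add: dotp_commute[of m u w] algebra_simps)
  have half: "inverse S / 2 * - (2 * X) = - X / S" for S X :: real
    by (cases "S = 0") (auto simp: field_simps)
  have "((\<lambda>t. 1 - (dotp m w w + 2 * t * dotp m w u + t * t * dotp m u u)) has_real_derivative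
      - (2 * (dotp m w u + t * dotp m u u))) (at t)"
    by (auto intro!: derivative_eq_intros)
  from DERIV_chain2[OF DERIV_real_sqrt[OF pos] this] show ?thesis
    unfolding eq dotp_add_scale_left by (rule DERIV_cong) (simp only: half)
qed

lemma qarg_line_DERIV:
  assumes "dotp m (\<lambda>i. w i + t * u i) (\<lambda>i. w i + t * u i) < 1"
  shows "((\<lambda>t. qarg m (\<lambda>i. w i + t * u i) x) has_real_derivative
           dotp m u x - x m * dotp m (\<lambda>i. w i + t * u i) u / lastq m (\<lambda>i. w i + t * u i)) (at t)"
proof -
  have "((\<lambda>t. dotp m w x + t * dotp m u x) has_real_derivative dotp m u x) (at t)"
    by (auto intro!: derivative_eq_intros)
  from DERIV_add[OF this DERIV_cmult_right[OF lastq_line_DERIV[OF assms], of "x m"]] show ?thesis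
    unfolding qarg_def dotp_add_scale_left[of m w _ u x]
    by (rule DERIV_cong) (simp add: algebra_simps)
qed

text \<open>Product rule: differentiating \<open>tanh\<close> gives the rank-one term of
  \<open>HB\<close>; differentiating the tangent factor gives the term with \<open>1 / q\<close> and
  \<open>1 / q ^ 3\<close>, which is due to the bending of the sphere.\<close>

lemma GF_line_DERIV:
  assumes "\<mu> > 0" and lt: "dotp m (\<lambda>i. w i + t * u i) (\<lambda>i. w i + t * u i) < 1"
  shows "((\<lambda>t. GF m \<mu> (\<lambda>i. w i + t * u i) v x) has_real_derivative
           HB m \<mu> (\<lambda>i. w i + t * u i) u v x) (at t)"
proof -
  let ?w = "\<lambda>i. w i + t * u i"
  have q: "lastq m ?w > 0" using lt by (simp add: lastq_def)
  have th: "((\<lambda>t. tanh (qarg m (\<lambda>i. w i + t * u i) x / \<mu>)) has_real_derivative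
      (1 - (tanh (qarg m ?w x / \<mu>))\<^sup>2) * ((dotp m u x - x m * dotp m ?w u / lastq m ?w) / \<mu>)) (at t)"
    by (rule DERIV_cong[OF DERIV_chain2[where f=tanh, OF _ DERIV_cdivide[OF qarg_line_DERIV[OF lt]]]])
       (auto intro!: derivative_eq_intros)
  have d: "((\<lambda>t. dotp m v x - x m * dotp m (\<lambda>i. w i + t * u i) v / lastq m (\<lambda>i. w i + t * u i))
      has_real_derivative - x m * (dotp m u v / lastq m ?w + dotp m ?w u * dotp m ?w v / lastq m ?w ^ 3)) (at t)"
  proof -
    have "((\<lambda>t. dotp m w v + t * dotp m u v) has_real_derivative dotp m u v) (at t)"
      by (auto intro!: derivative_eq_intros)
    have alg: "0 - ((c * N') * Q - c * N * (- M / Q)) / (Q * Q) = - c * (N' / Q + M * N / Q ^ 3)"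
      if "Q > 0" for c N N' M Q :: real
      using that by (simp add: field_simps power3_eq_cube)
    have ne: "lastq m ?w \<noteq> 0" using q by simp
    from \<open>((\<lambda>t. dotp m w v + t * dotp m u v) has_real_derivative dotp m u v) (at t)\<close>
    have "((\<lambda>t. dotp m v x - x m * (dotp m w v + t * dotp m u v) / lastq m (\<lambda>i. w i + t * u i))
      has_real_derivative 0 - ((x m * dotp m u v) * lastq m ?w
        - x m * (dotp m w v + t * dotp m u v) * (- dotp m ?w u / lastq m ?w)) / (lastq m ?w * lastq m ?w)) (at t)"
      by (intro DERIV_diff DERIV_const DERIV_divide DERIV_cmult lastq_line_DERIV lt ne)
    then show ?thesis
      unfolding alg[OF q] dotp_add_scale_left[of m w _ u v] .
  qed
  have alg: "A * (U / \<mu>) * V + - c * Z * T = A / \<mu> * U * V - c * T * Z" for A U V c Z T :: real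
    by simp
  show ?thesis
    unfolding GF_def HB_def
    by (rule DERIV_cong[OF DERIV_mult[OF th d]]) (rule alg)
qed

lemma hmu_DERIV:
  assumes "\<mu> > 0"
  shows "(hmu \<mu> has_real_derivative tanh (z / \<mu>)) (at z)"
proof -
  have "cosh (z / \<mu>) > 0" by simp
  then show ?thesis
    unfolding hmu_def
    by (auto intro!: derivative_eq_intros simp: tanh_def assms less_imp_neq[OF assms, symmetric])
qed

definition gavg :: "nat \<Rightarrow> nat \<Rightarrow> real \<Rightarrow> (nat \<times> nat \<Rightarrow> real) \<Rightarrow> (nat \<Rightarrow> real) \<Rightarrow> (nat \<Rightarrow> real) \<Rightarrow> real" where
  "gavg m p \<mu> X w v = (1 / real p) * (\<Sum>k<p. GF m \<mu> w v (\<lambda>i. X (i, k)))"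

definition havg :: "nat \<Rightarrow> nat \<Rightarrow> real \<Rightarrow> (nat \<times> nat \<Rightarrow> real) \<Rightarrow> (nat \<Rightarrow> real) \<Rightarrow> (nat \<Rightarrow> real) \<Rightarrow> (nat \<Rightarrow> real) \<Rightarrow> real" where
  "havg m p \<mu> X w u v = (1 / real p) * (\<Sum>k<p. HB m \<mu> w u v (\<lambda>i. X (i, k)))"

lemma average_DERIV:
  fixes f :: "nat \<Rightarrow> real \<Rightarrow> real"
  assumes "\<And>k. (f k has_real_derivative f' k) (at t)"
  shows "((\<lambda>t. c * (\<Sum>k<p. f k t)) has_real_derivative c * (\<Sum>k<p. f' k)) (at t)"
proof (rule DERIV_cmult)
  show "((\<lambda>t. \<Sum>k<p. f k t) has_real_derivative (\<Sum>k<p. f' k)) (at t)"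
  proof (induction p)
    case (Suc p)
    show ?case
      using DERIV_add[OF Suc assms[of p]] by simp
  qed simp
qed

lemma gobj_line_DERIV:
  assumes "\<mu> > 0" and lt: "dotp m (\<lambda>i. w i + t * u i) (\<lambda>i. w i + t * u i) < 1"
  shows "((\<lambda>t. gobj (Suc m) p \<mu> X (\<lambda>i. w i + t * u i)) has_real_derivative
           gavg m p \<mu> X (\<lambda>i. w i + t * u i) u) (at t)"
proof -
  have "((\<lambda>t. hmu \<mu> (qarg m (\<lambda>i. w i + t * u i) x)) has_real_derivative
      GF m \<mu> (\<lambda>i. w i + t * u i) u x) (at t)" for x
    unfolding GF_def by (rule DERIV_chain2[OF hmu_DERIV[OF assms(1)] qarg_line_DERIV[OF lt]])
  then show ?thesis
    unfolding gobj_qarg gavg_def by (rule average_DERIV)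
qed

lemma gavg_line_DERIV:
  assumes "\<mu> > 0" and lt: "dotp m (\<lambda>i. w i + t * u i) (\<lambda>i. w i + t * u i) < 1"
  shows "((\<lambda>t. gavg m p \<mu> X (\<lambda>i. w i + t * u i) v) has_real_derivative
           havg m p \<mu> X (\<lambda>i. w i + t * u i) u v) (at t)"
  unfolding gavg_def havg_def by (rule average_DERIV, rule GF_line_DERIV[OF assms])

section \<open>Gradient and Hessian entries as averages over the columns\<close>

lemma fun_upd_line: "w(i := t) = (\<lambda>j. w j + (t - w i) * (if j = i then 1 else 0 :: real))"
  by auto

text \<open>\<open>partial\<close> differentiates in the updated coordinate at \<open>w i\<close>,
  while the line formulas are centred at \<open>t = 0\<close>; the chain rule with the shift by
  \<open>w i\<close> connects the two.\<close>

lemma line_to_upd_DERIV: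
  fixes F :: "(nat \<Rightarrow> real) \<Rightarrow> real"
  assumes "((\<lambda>t. F (\<lambda>j. w j + t * (if j = i then 1 else 0))) has_real_derivative D) (at 0)"
  shows "((\<lambda>t. F (w(i := t))) has_real_derivative D) (at (w i))"
proof -
  have s: "((\<lambda>t. t - w i) has_real_derivative 1) (at (w i))"
    by (auto intro!: derivative_eq_intros)
  have "((\<lambda>t. F (\<lambda>j. w j + t * (if j = i then 1 else 0))) has_real_derivative D) (at (w i - w i))"
    using assms by simp
  from DERIV_chain2[OF this s] show ?thesis
    unfolding fun_upd_line by simp
qed

lemma partial_gobj:
  assumes "\<mu> > 0" and "dotp m w w < 1"
  shows "partial i (gobj (Suc m) p \<mu> X) w = gavg m p \<mu> X w (\<lambda>j. if j = i then 1 else 0)"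
  unfolding partial_def
  using gobj_line_DERIV[of \<mu> m w 0 "\<lambda>j. if j = i then 1 else 0" p X] assms
  by (intro DERIV_imp_deriv line_to_upd_DERIV) simp

lemma hess_gobj:
  assumes "\<mu> > 0" and lt: "dotp m w w < 1"
  shows "hess (gobj (Suc m) p \<mu> X) w i j
    = havg m p \<mu> X w (\<lambda>k. if k = i then 1 else 0) (\<lambda>k. if k = j then 1 else 0)"
proof -
  let ?e = "\<lambda>i k. if k = i then 1 else 0 :: real"
  have "isCont (\<lambda>t. dotp m (w(i := t)) (w(i := t))) (w i)"
    unfolding fun_upd_line dotp_add_scale_left dotp_add_scale_right by (intro continuous_intros)
  then have "((\<lambda>t. dotp m (w(i := t)) (w(i := t))) \<longlongrightarrow> dotp m w w) (at (w i))"
    by (simp add: isCont_def)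
  \<comment> \<open>The inner \<open>partial\<close> is known to equal \<open>gavg\<close> only
    inside the unit ball. Differentiating it once more needs this identity on a neighbourhood of
    \<open>w i\<close>, not only at the point.\<close>
  then have ev: "eventually (\<lambda>t. dotp m (w(i := t)) (w(i := t)) < 1) (nhds (w i))"
    using lt by (auto simp: eventually_nhds_conv_at dest: order_tendstoD)
  have D: "((\<lambda>t. gavg m p \<mu> X (w(i := t)) (?e j)) has_real_derivative havg m p \<mu> X w (?e i) (?e j)) (at (w i))"
    using gavg_line_DERIV[of \<mu> m w 0 "?e i" p X "?e j"] assms
    by (intro line_to_upd_DERIV) simp
  have "eventually (\<lambda>t. partial j (gobj (Suc m) p \<mu> X) (w(i := t)) = gavg m p \<mu> X (w(i := t)) (?e j)) (nhds (w i))"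
    using ev by eventually_elim (simp add: partial_gobj assms(1))
  from deriv_cong_ev[OF this refl] show ?thesis
    unfolding hess_def partial_def[of i] using DERIV_imp_deriv[OF D] by simp
qed

lemma sum_scale_swap:
  fixes c :: real and v :: "nat \<Rightarrow> real"
  shows "(\<Sum>i<m. v i * (c * (\<Sum>k<p. f i k))) = c * (\<Sum>k<p. \<Sum>i<m. v i * f i k)"
  unfolding sum_distrib_left
  by (subst sum.swap) (intro sum.cong refl, simp add: mult_ac)

lemma sum_scale_swap2:
  fixes c :: real and v :: "nat \<Rightarrow> real"
  shows "(\<Sum>i<m. \<Sum>j<l. v i * (c * (\<Sum>k<p. f i j k)) * u j)
       = c * (\<Sum>k<p. \<Sum>i<m. \<Sum>j<l. v i * f i j k * u j)"
proof -
  have "(\<Sum>j<l. v i * (c * (\<Sum>k<p. f i j k)) * u j) = c * (\<Sum>k<p. \<Sum>j<l. v i * f i j k * u j)" for i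
    unfolding sum_distrib_left sum_distrib_right
    by (subst sum.swap) (intro sum.cong refl, simp add: mult_ac)
  then show ?thesis
    by (simp add: sum.swap[of _ "{..<m}" "{..<p}"] flip: sum_distrib_left)
qed

text \<open>The matrix has the shape that \<open>HB\<close> takes on pairs of unit vectors: a
  rank-one part minus a combination of the identity and another rank-one part. Its quadratic form
  therefore collapses to scalar products.\<close>

lemma delta_quadratic_form:
  fixes K T q r :: real and m :: nat
  shows "(\<Sum>i<m. \<Sum>j<m. v i * (K * a i * a j - T * ((if j = i then 1 else 0) / q + w i * w j / r)) * v j)
    = K * (\<Sum>i<m. v i * a i) * (\<Sum>i<m. v i * a i)
      - T * ((\<Sum>i<m. v i * v i) / q + (\<Sum>i<m. v i * w i) * (\<Sum>i<m. v i * w i) / r)"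
proof -
  have "(\<Sum>j<m. v i * (K * a i * a j - T * ((if j = i then 1 else 0) / q + w i * w j / r)) * v j)
      = K * (v i * a i) * (\<Sum>j<m. v j * a j) - T / q * (v i * v i) - T / r * (v i * w i) * (\<Sum>j<m. v j * w j)"
    if "i < m" for i
  proof -
    have "(\<Sum>j<m. v i * (K * a i * a j - T * ((if j = i then 1 else 0) / q + w i * w j / r)) * v j)
      = (\<Sum>j<m. K * (v i * a i) * (v j * a j) - (if j = i then T / q * (v i * v i) else 0)
            - T / r * (v i * w i) * (v j * w j))"
      by (intro sum.cong) (auto simp: algebra_simps)
    also have "\<dots> = K * (v i * a i) * (\<Sum>j<m. v j * a j) - T / q * (v i * v i)
        - T / r * (v i * w i) * (\<Sum>j<m. v j * w j)"
      using that unfolding sum_subtractf sum_distrib_left by (subst sum.delta) auto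
    finally show ?thesis .
  qed
  then have "(\<Sum>i<m. \<Sum>j<m. v i * (K * a i * a j - T * ((if j = i then 1 else 0) / q + w i * w j / r)) * v j)
    = (\<Sum>i<m. K * (v i * a i) * (\<Sum>j<m. v j * a j) - T / q * (v i * v i) - T / r * (v i * w i) * (\<Sum>j<m. v j * w j))"
    by simp
  also have "\<dots> = K * (\<Sum>i<m. v i * a i) * (\<Sum>i<m. v i * a i) - T / q * (\<Sum>i<m. v i * v i)
      - T / r * (\<Sum>i<m. v i * w i) * (\<Sum>i<m. v i * w i)"
    unfolding sum_subtractf sum_distrib_left[symmetric] sum_distrib_right[symmetric] by simp
  finally show ?thesis by (simp add: algebra_simps)
qed

lemma sum_tangent:
  "(\<Sum>i<m. v i * (x i - c * w i / q)) = dotp m v x - c * dotp m w v / q"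
proof -
  have "(\<Sum>i<m. v i * (x i - c * w i / q)) = (\<Sum>i<m. v i * x i - c / q * (w i * v i))"
    by (intro sum.cong) (auto simp: algebra_simps)
  then show ?thesis
    unfolding sum_subtractf sum_distrib_left[symmetric] dotp_def by simp
qed

lemma grad_sum_gobj:
  assumes "\<mu> > 0" and "dotp m w w < 1"
  shows "(\<Sum>i<m. v i * grad (gobj (Suc m) p \<mu> X) w i) = gavg m p \<mu> X w v"
proof -
  have "(\<Sum>i<m. v i * GF m \<mu> w (\<lambda>j. if j = i then 1 else 0) x) = GF m \<mu> w v x" for x
  proof -
    have "(\<Sum>i<m. v i * GF m \<mu> w (\<lambda>j. if j = i then 1 else 0) x)
      = (\<Sum>i<m. tanh (qarg m w x / \<mu>) * (v i * (x i - x m * w i / lastq m w)))"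
      unfolding GF_def dotp_commute[of m w]
      by (intro sum.cong refl) (simp add: dotp_unit)
    also have "\<dots> = GF m \<mu> w v x"
      unfolding GF_def sum_tangent[symmetric] sum_distrib_left ..
    finally show ?thesis .
  qed
  then have "(\<Sum>i<m. v i * gavg m p \<mu> X w (\<lambda>j. if j = i then 1 else 0)) = gavg m p \<mu> X w v"
    unfolding gavg_def by (simp only: sum_scale_swap)
  then show ?thesis
    unfolding grad_def by (simp add: partial_gobj assms)
qed

lemma hess_sum_gobj:
  assumes "\<mu> > 0" and "dotp m w w < 1"
  shows "(\<Sum>i<m. \<Sum>j<m. v i * hess (gobj (Suc m) p \<mu> X) w i j * v j) = havg m p \<mu> X w v v"
proof -
  let ?e = "\<lambda>i k. if k = i then 1 else 0 :: real"
  have "(\<Sum>i<m. \<Sum>j<m. v i * HB m \<mu> w (?e i) (?e j) x * v j) = HB m \<mu> w v v x" for x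
  proof -
    let ?a = "\<lambda>i. x i - x m * w i / lastq m w"
    have "HB m \<mu> w (?e i) (?e j) x = (1 - (tanh (qarg m w x / \<mu>))\<^sup>2) / \<mu> * ?a i * ?a j
        - x m * tanh (qarg m w x / \<mu>) * ((if j = i then 1 else 0) / lastq m w + w i * w j / lastq m w ^ 3)"
      if "i < m" "j < m" for i j
      unfolding HB_def dotp_commute[of m w] using that by (auto simp: dotp_unit)
    then have "(\<Sum>i<m. \<Sum>j<m. v i * HB m \<mu> w (?e i) (?e j) x * v j)
      = (\<Sum>i<m. \<Sum>j<m. v i * ((1 - (tanh (qarg m w x / \<mu>))\<^sup>2) / \<mu> * ?a i * ?a j
        - x m * tanh (qarg m w x / \<mu>) * ((if j = i then 1 else 0) / lastq m w + w i * w j / lastq m w ^ 3)) * v j)"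
      by simp
    also have "\<dots> = HB m \<mu> w v v x"
      unfolding delta_quadratic_form sum_tangent unfolding HB_def
      by (simp add: dotp_def mult.commute[of "w _"])
    finally show ?thesis .
  qed
  then have "(\<Sum>i<m. \<Sum>j<m. v i * havg m p \<mu> X w (?e i) (?e j) * v j) = havg m p \<mu> X w v v"
    unfolding havg_def by (simp only: sum_scale_swap2)
  then show ?thesis
    by (simp add: hess_gobj assms)
qed

section \<open>From the three regions to a unique local minimizer\<close>

lemma dotp_cong: "(\<And>i. i < m \<Longrightarrow> v i = v' i) \<Longrightarrow> (\<And>i. i < m \<Longrightarrow> x i = x' i) \<Longrightarrow> dotp m v x = dotp m v' x'"
  by (simp add: dotp_def)

lemma dotp_Cauchy_Schwarz: "\<bar>dotp m v x\<bar> \<le> vnorm m v * vnorm m x"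
proof -
  have "\<bar>\<Sum>i<m. v i * x i\<bar> \<le> (\<Sum>i<m. \<bar>v i\<bar> * \<bar>x i\<bar>)"
    by (rule order_trans[OF sum_abs]) (simp add: abs_mult)
  also have "\<dots> \<le> L2_set v {..<m} * L2_set x {..<m}"
    by (rule L2_set_mult_ineq)
  finally show ?thesis
    by (simp add: dotp_def vnorm_def L2_set_def)
qed

lemma continuous_on_dotp [continuous_intros]:
  "continuous_on S (\<lambda>w. dotp m w x)" "continuous_on S (\<lambda>w. dotp m w w)"
  unfolding dotp_def
  by (intro continuous_intros continuous_on_subset[OF continuous_on_product_coordinates] subset_UNIV)+

lemma continuous_on_hmu: "\<mu> > 0 \<Longrightarrow> continuous_on UNIV (hmu \<mu>)"
  by (meson DERIV_isCont continuous_at_imp_continuous_on hmu_DERIV)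

lemma continuous_on_gobj:
  assumes "\<mu> > 0"
  shows "continuous_on S (gobj (Suc m) p \<mu> X)"
proof -
  have "continuous_on S (\<lambda>w. qarg m w x)" for x
    unfolding qarg_def lastq_def by (intro continuous_intros)
  then show ?thesis
    unfolding gobj_qarg
    by (intro continuous_intros continuous_on_compose2[OF continuous_on_hmu[OF assms]]) auto
qed

text \<open>Vectors live in the product topology on \<open>nat => real\<close>. By Tychonoff the
  product of m intervals with the singletons \<open>{0}\<close> is compact, and the ball is a closed
  subset of it.\<close>

lemma compact_vec_ball: "compact {w \<in> vecs m. vnorm m w \<le> r}"
proof -
  let ?K = "PiE UNIV (\<lambda>i. if i < m then {-\<bar>r\<bar>..\<bar>r\<bar>} else {0::real})"
  have "compactin (product_topology (\<lambda>i. euclidean) UNIV) ?K"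
    unfolding compactin_PiE by (auto simp: compactin_euclidean_iff)
  then have "compact ?K"
    by (simp add: euclidean_product_topology compactin_euclidean_iff)
  moreover have "closed {w. vnorm m w \<le> r}"
    unfolding vnorm_eq by (intro closed_Collect_le continuous_intros)
  moreover have "{w \<in> vecs m. vnorm m w \<le> r} = ?K \<inter> {w. vnorm m w \<le> r}"
  proof (intro equalityI subsetI)
    fix w assume w: "w \<in> {w \<in> vecs m. vnorm m w \<le> r}"
    have "\<bar>w i\<bar> \<le> \<bar>r\<bar>" if "i < m" for i
    proof -
      have "(w i)\<^sup>2 \<le> (\<Sum>i<m. (w i)\<^sup>2)"
        using that by (intro member_le_sum) auto
      then have "\<bar>w i\<bar> \<le> vnorm m w"
        unfolding vnorm_def using real_le_rsqrt by fastforce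
      then show ?thesis using w by auto
    qed
    then show "w \<in> ?K \<inter> {w. vnorm m w \<le> r}"
      using w by (fastforce simp: vecs_def PiE_iff abs_le_iff)
  next
    fix w assume w: "w \<in> ?K \<inter> {w. vnorm m w \<le> r}"
    then have "w i \<in> (if i < m then {-\<bar>r\<bar>..\<bar>r\<bar>} else {0::real})" for i
      by (auto simp: PiE_iff)
    then have "w i = 0" if "i \<ge> m" for i
      using that by (metis not_le singletonD)
    then show "w \<in> {w \<in> vecs m. vnorm m w \<le> r}"
      using w by (auto simp: vecs_def)
  qed
  ultimately show ?thesis
    by (simp add: compact_Int_closed)
qed

lemma vecs_line: "w \<in> vecs m \<Longrightarrow> u \<in> vecs m \<Longrightarrow> (\<lambda>i. w i + t * u i) \<in> vecs m"
  by (simp add: vecs_def)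

lemma eventually_line_in_ball:
  assumes "vnorm m w < \<rho>"
  shows "\<exists>d>0. \<forall>t. \<bar>t\<bar> < d \<longrightarrow> vnorm m (\<lambda>i. w i + t * u i) < \<rho>"
proof -
  have "((\<lambda>t. vnorm m (\<lambda>i. w i + t * u i)) \<longlongrightarrow> vnorm m (\<lambda>i. w i + 0 * u i)) (at 0)"
    unfolding vnorm_eq dotp_add_scale_left dotp_add_scale_right
    by (intro tendsto_intros)
  then have "eventually (\<lambda>t. vnorm m (\<lambda>i. w i + t * u i) < \<rho>) (at 0)"
    using assms by (simp add: order_tendstoD)
  then have "eventually (\<lambda>t. vnorm m (\<lambda>i. w i + t * u i) < \<rho>) (nhds 0)"
    using assms by (simp add: eventually_nhds_conv_at)
  then show ?thesis
    by (auto simp: eventually_nhds_metric dist_real_def)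
qed

lemma local_min_on_line:
  assumes "local_min_on m F {w \<in> vecs m. vnorm m w < \<rho>} w" and "u \<in> vecs m"
  shows "\<exists>d>0. \<forall>t. \<bar>t\<bar> < d \<longrightarrow>
    vnorm m (\<lambda>i. w i + t * u i) < \<rho> \<and> F w \<le> F (\<lambda>i. w i + t * u i)"
proof -
  have w: "w \<in> vecs m" "vnorm m w < \<rho>" using assms(1) by (simp_all add: local_min_on_def)
  have "\<exists>\<epsilon>>0. \<forall>v\<in>{w \<in> vecs m. vnorm m w < \<rho>}. vnorm m (\<lambda>i. v i - w i) < \<epsilon> \<longrightarrow> F w \<le> F v"
    using assms(1) by (simp only: local_min_on_def)
  then obtain \<epsilon> where e: "\<epsilon> > 0"
    and mn': "\<forall>v\<in>{w \<in> vecs m. vnorm m w < \<rho>}. vnorm m (\<lambda>i. v i - w i) < \<epsilon> \<longrightarrow> F w \<le> F v"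
    by (elim exE conjE)
  have mn: "F w \<le> F v" if "v \<in> vecs m" "vnorm m v < \<rho>" "vnorm m (\<lambda>i. v i - w i) < \<epsilon>" for v
    using mn' that by simp
  obtain d1 where d1: "d1 > 0" "\<And>t. \<bar>t\<bar> < d1 \<Longrightarrow> vnorm m (\<lambda>i. w i + t * u i) < \<rho>"
    using eventually_line_in_ball[OF w(2)] by blast
  \<comment> \<open>The same lemma, centred at 0 with radius \<open>\<epsilon>\<close>, keeps the
    displacement \<open>t * u\<close> shorter than \<open>\<epsilon>\<close>.\<close>
  obtain d2 where d2: "d2 > 0" "\<And>t. \<bar>t\<bar> < d2 \<Longrightarrow> vnorm m (\<lambda>i. (\<lambda>_. 0) i + t * u i) < \<epsilon>"
    using eventually_line_in_ball[of m "\<lambda>_. 0" \<epsilon> u] e by (auto simp: vnorm_def)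
  show ?thesis
  proof (intro exI[of _ "min d1 d2"] conjI[of "_ > 0"] allI impI)
    show "min d1 d2 > 0" using d1 d2 by simp
    fix t :: real assume t: "\<bar>t\<bar> < min d1 d2"
    then show "vnorm m (\<lambda>i. w i + t * u i) < \<rho> \<and> F w \<le> F (\<lambda>i. w i + t * u i)"
      using d1(2)[of t] d2(2)[of t] mn[OF vecs_line[OF w(1) assms(2), of t]] by simp
  qed
qed

lemma vnorm_less_one_iff: "vnorm m w < 1 \<longleftrightarrow> dotp m w w < 1"
  by (simp add: vnorm_eq)

lemma local_min_gavg_eq_0:
  assumes mu: "\<mu> > 0" and "\<rho> \<le> 1" and u: "u \<in> vecs m"
    and lm: "local_min_on m (gobj (Suc m) p \<mu> X) {w \<in> vecs m. vnorm m w < \<rho>} w"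
  shows "gavg m p \<mu> X w u = 0"
proof -
  obtain d where d: "d > 0"
    "\<And>t. \<bar>t\<bar> < d \<Longrightarrow> vnorm m (\<lambda>i. w i + t * u i) < \<rho>
        \<and> gobj (Suc m) p \<mu> X w \<le> gobj (Suc m) p \<mu> X (\<lambda>i. w i + t * u i)"
    using local_min_on_line[OF lm u] by meson
  have "vnorm m w < 1" using lm \<open>\<rho> \<le> 1\<close> by (auto simp: local_min_on_def)
  then have "((\<lambda>t. gobj (Suc m) p \<mu> X (\<lambda>i. w i + t * u i)) has_real_derivative gavg m p \<mu> X w u) (at 0)"
    using gobj_line_DERIV[OF mu, of m w 0 u p X] by (simp add: vnorm_less_one_iff)
  from DERIV_local_min[OF this d(1)] d(2) show ?thesis by auto
qed

text \<open>The first derivative vanishes at \<open>w\<close>. If the second were negative, the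
  first would be negative just to the right, and the objective would fall strictly below its value
  at \<open>w\<close>.\<close>

lemma local_min_havg_nonneg:
  assumes mu: "\<mu> > 0" and rho: "\<rho> \<le> 1" and u: "u \<in> vecs m"
    and lm: "local_min_on m (gobj (Suc m) p \<mu> X) {w \<in> vecs m. vnorm m w < \<rho>} w"
  shows "havg m p \<mu> X w u u \<ge> 0"
proof (rule ccontr)
  assume neg: "\<not> ?thesis"
  let ?l = "\<lambda>t i. w i + t * u i" and ?g = "gobj (Suc m) p \<mu> X"
  obtain d where d: "d > 0"
    "\<And>t. \<bar>t\<bar> < d \<Longrightarrow> vnorm m (?l t) < \<rho> \<and> ?g w \<le> ?g (?l t)"
    using local_min_on_line[OF lm u] by meson
  have lt: "dotp m (?l t) (?l t) < 1" if "\<bar>t\<bar> < d" for t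
    using d(2)[OF that] rho by (simp flip: vnorm_less_one_iff)
  have "((\<lambda>t. gavg m p \<mu> X (?l t) u) has_real_derivative havg m p \<mu> X w u u) (at 0)"
    using gavg_line_DERIV[OF mu lt, of 0 p X u] d(1) by simp
  from DERIV_neg_dec_right[OF this] neg obtain d' where d': "d' > 0"
    "\<And>h. h > 0 \<Longrightarrow> h < d' \<Longrightarrow> gavg m p \<mu> X (?l h) u < gavg m p \<mu> X w u"
    by auto
  define h where "h = min d d' / 2"
  have h: "0 < h" "h < d" "h < d'" using d(1) d'(1) by (auto simp: h_def min_def)
  have D: "((\<lambda>t. ?g (?l t)) has_real_derivative gavg m p \<mu> X (?l t) u) (at t)" if "\<bar>t\<bar> < d" for t
    by (rule gobj_line_DERIV[OF mu lt[OF that]])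
  have "?g (?l 0) > ?g (?l h)"
  proof (rule DERIV_neg_imp_decreasing_open[OF h(1)])
    fix t assume "0 < t" "t < h"
    then show "\<exists>y. ((\<lambda>t. ?g (?l t)) has_real_derivative y) (at t) \<and> y < 0"
      using D[of t] d'(2)[of t] h local_min_gavg_eq_0[OF mu rho u lm] by auto
  next
    show "continuous_on {0..h} (\<lambda>t. ?g (?l t))"
    proof (intro continuous_at_imp_continuous_on ballI)
      fix t assume "t \<in> {0..h}"
      then show "isCont (\<lambda>t. ?g (?l t)) t"
        using D[of t] h by (intro DERIV_isCont) auto
    qed
  qed
  then show False using d(2)[of h] h by auto
qed

text \<open>Mean value theorem for the directional derivative along the segment. It gives strong
  monotonicity of the gradient, which serves both uniqueness and the bound on the minimizer.\<close>

lemma gavg_increase: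
  assumes mu: "\<mu> > 0" and lt: "\<And>t. 0 \<le> t \<Longrightarrow> t \<le> 1 \<Longrightarrow> dotp m (\<lambda>i. w i + t * u i) (\<lambda>i. w i + t * u i) < 1"
    and cvx: "\<And>t. 0 \<le> t \<Longrightarrow> t \<le> 1 \<Longrightarrow> havg m p \<mu> X (\<lambda>i. w i + t * u i) u u \<ge> c"
  shows "gavg m p \<mu> X (\<lambda>i. w i + u i) u - gavg m p \<mu> X w u \<ge> c"
proof -
  have "\<exists>z>0. z < 1 \<and> gavg m p \<mu> X (\<lambda>i. w i + 1 * u i) u - gavg m p \<mu> X (\<lambda>i. w i + 0 * u i) u
      = (1 - 0) * havg m p \<mu> X (\<lambda>i. w i + z * u i) u u"
    by (rule MVT2) (auto intro!: gavg_line_DERIV mu lt)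
  then obtain z where "z > 0" "z < 1"
     "gavg m p \<mu> X (\<lambda>i. w i + u i) u - gavg m p \<mu> X w u = havg m p \<mu> X (\<lambda>i. w i + z * u i) u u"
    by auto
  then show ?thesis using cvx[of z] by simp
qed

lemma vnorm_convex:
  assumes "vnorm m w \<le> r" "vnorm m v \<le> r" "0 \<le> t" "t \<le> 1"
  shows "vnorm m (\<lambda>i. w i + t * (v i - w i)) \<le> r"
proof -
  have eq: "(\<lambda>i. w i + t * (v i - w i)) = (\<lambda>i. (1 - t) * w i + t * v i)"
    by (auto simp: algebra_simps)
  have "L2_set (\<lambda>i. (1 - t) * w i + t * v i) {..<m}
      \<le> L2_set (\<lambda>i. (1 - t) * w i) {..<m} + L2_set (\<lambda>i. t * v i) {..<m}"
    by (rule L2_set_triangle_ineq)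
  also have "\<dots> = (1 - t) * L2_set w {..<m} + t * L2_set v {..<m}"
    using assms by (simp add: L2_set_right_distrib)
  also have "\<dots> \<le> (1 - t) * r + t * r"
    using assms by (intro add_mono mult_left_mono) (auto simp: L2_set_def vnorm_def)
  finally show ?thesis
    unfolding eq by (simp add: L2_set_def vnorm_def algebra_simps)
qed

lemma vnorm_eq_0_vecs: "w \<in> vecs m \<Longrightarrow> dotp m w w \<le> 0 \<Longrightarrow> w = (\<lambda>_. 0)"
proof -
  assume w: "w \<in> vecs m" "dotp m w w \<le> 0"
  then have "(\<Sum>i<m. w i * w i) = 0" using dotp_self_nonneg[of m w] by (simp add: dotp_def)
  then have "\<forall>i<m. w i = 0" by (subst (asm) sum_nonneg_eq_0_iff) auto
  then show ?thesis using w(1) by (auto simp: vecs_def not_less[symmetric])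
qed

text \<open>A positive radial derivative excludes local minimizers from the middle shell, and
  negative radial curvature excludes them from the outer one, so all lie in the open ball of radius
  \<open>r1\<close>. Strong convexity allows at most one there; existence comes from compactness of
  the closed ball.\<close>

theorem unique_local_min:
  assumes mu: "\<mu> > 0" and r: "0 < r1" "r1 \<le> r2" "r2 < \<rho>" "\<rho> \<le> 1" and \<kappa>: "\<kappa> > 0"
    and cvx: "\<And>w v. w \<in> vecs m \<Longrightarrow> vnorm m w \<le> r1 \<Longrightarrow> havg m p \<mu> X w v v \<ge> \<kappa> * dotp m v v"
    and mid: "\<And>w. w \<in> vecs m \<Longrightarrow> r1 \<le> vnorm m w \<Longrightarrow> vnorm m w \<le> r2 \<Longrightarrow> gavg m p \<mu> X w w > 0"
    and neg: "\<And>w. w \<in> vecs m \<Longrightarrow> r2 \<le> vnorm m w \<Longrightarrow> vnorm m w < \<rho> \<Longrightarrow> havg m p \<mu> X w w w < 0"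
    and "G \<ge> 0" and grad0: "\<And>v. gavg m p \<mu> X (\<lambda>_. 0) v \<ge> - G * vnorm m v"
  shows "\<exists>!w. local_min_on m (gobj (Suc m) p \<mu> X) {w \<in> vecs m. vnorm m w < \<rho>} w"
    and "local_min_on m (gobj (Suc m) p \<mu> X) {w \<in> vecs m. vnorm m w < \<rho>} w \<Longrightarrow> vnorm m w \<le> G / \<kappa>"
proof -
  let ?g = "gobj (Suc m) p \<mu> X"
  let ?lm = "local_min_on m ?g {w \<in> vecs m. vnorm m w < \<rho>}"
  have small: "dotp m w w < 1" if "vnorm m w \<le> r1" for w
    using that r by (simp flip: vnorm_less_one_iff)
  have inner: "w \<in> vecs m \<and> vnorm m w < r1" if "?lm w" for w
  proof -
    have w: "w \<in> vecs m" "vnorm m w < \<rho>" using that by (auto simp: local_min_on_def)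
    have "\<not> (r1 \<le> vnorm m w \<and> vnorm m w \<le> r2)"
      using mid[OF w(1)] local_min_gavg_eq_0[OF mu r(4) w(1) that] by auto
    moreover have "\<not> r2 \<le> vnorm m w"
      using neg[OF w(1) _ w(2)] local_min_havg_nonneg[OF mu r(4) w(1) that] by force
    ultimately show ?thesis using w by auto
  qed
  have unique: "w = v" if "?lm w" "?lm v" for w v
  proof -
    let ?u = "\<lambda>i. v i - w i"
    have u: "?u \<in> vecs m" using inner[OF that(1)] inner[OF that(2)] by (auto simp: vecs_def)
    have le: "vnorm m (\<lambda>i. w i + t * ?u i) \<le> r1" if "0 \<le> t" "t \<le> 1" for t
      using inner[OF \<open>?lm w\<close>] inner[OF \<open>?lm v\<close>] that by (intro vnorm_convex) auto
    have "gavg m p \<mu> X (\<lambda>i. w i + ?u i) ?u - gavg m p \<mu> X w ?u \<ge> \<kappa> * dotp m ?u ?u"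
      using inner[OF that(1)] u by (intro gavg_increase mu small le cvx vecs_line) auto
    then have "\<kappa> * dotp m ?u ?u \<le> 0"
      using local_min_gavg_eq_0[OF mu r(4) u that(1)] local_min_gavg_eq_0[OF mu r(4) u that(2)] by simp
    then have "dotp m ?u ?u \<le> 0" using \<kappa> by (simp add: mult_le_0_iff)
    then have "?u = (\<lambda>_. 0)" using vnorm_eq_0_vecs[OF u] by simp
    then have "?u i = 0" for i by meson
    then show ?thesis by (intro ext) simp
  qed
  have "\<exists>w. ?lm w"
  proof -
    let ?B = "{w \<in> vecs m. vnorm m w \<le> r1}"
    have "(\<lambda>_. 0) \<in> ?B" using r by (auto simp: vecs_def vnorm_def)
    then obtain w where w: "w \<in> ?B" and mn: "\<And>v. v \<in> ?B \<Longrightarrow> ?g w \<le> ?g v"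
      using continuous_attains_inf[OF compact_vec_ball _ continuous_on_gobj[OF mu], of m r1 m p X] by blast
    \<comment> \<open>On the sphere of radius \<open>r1\<close> the radial derivative is positive,
      so a short step towards 0 would decrease the objective below its minimum over the
      ball.\<close>
    have "vnorm m w < r1"
    proof (rule ccontr)
      assume "\<not> vnorm m w < r1"
      with w have eq: "vnorm m w = r1" by simp
      have "gavg m p \<mu> X w w > 0" using mid[of w] w eq r by simp
      moreover have "((\<lambda>t. ?g (\<lambda>i. w i + t * w i)) has_real_derivative gavg m p \<mu> X w w) (at 0)"
        using gobj_line_DERIV[OF mu, of m w 0 w p X] small[of w] eq by simp
      ultimately obtain d where d: "d > 0" "\<And>h. h > 0 \<Longrightarrow> h < d \<Longrightarrow> ?g (\<lambda>i. w i + - h * w i) < ?g w"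
        using DERIV_pos_inc_left[of "\<lambda>t. ?g (\<lambda>i. w i + t * w i)"] by fastforce
      define h where "h = min d 1 / 2"
      have h: "h > 0" "h < d" "h < 1" using d(1) by (auto simp: h_def min_def)
      have "vnorm m (\<lambda>i. w i + - h * w i) \<le> r1"
        using vnorm_convex[of m w r1 "\<lambda>_. 0" h] eq h r by (simp add: vnorm_def[of m "\<lambda>_. 0"])
      then show False
        using mn[of "\<lambda>i. w i + - h * w i"] d(2)[OF h(1,2)] w vecs_line[of w m w "-h"] by auto
    qed
    have "?g w \<le> ?g v" if "v \<in> vecs m" "vnorm m (\<lambda>i. v i - w i) < r1 - vnorm m w" for v
    proof -
      have "L2_set (\<lambda>i. w i + (v i - w i)) {..<m} \<le> L2_set w {..<m} + L2_set (\<lambda>i. v i - w i) {..<m}"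
        by (rule L2_set_triangle_ineq)
      then have "vnorm m v \<le> r1" using that(2) by (simp add: vnorm_def L2_set_def)
      then show ?thesis using mn that by auto
    qed
    then have "?lm w"
      using w r \<open>vnorm m w < r1\<close> unfolding local_min_on_def
      by (auto intro!: exI[of _ "r1 - vnorm m w"])
    then show ?thesis by (intro exI[of _ w])
  qed
  with unique show "\<exists>!w. ?lm w" by blast
  assume lm: "?lm w"
  have w: "w \<in> vecs m" "vnorm m w < r1" using inner[OF lm] by auto
  \<comment> \<open>From 0 to \<open>w\<close> the derivative in direction \<open>w\<close> grows by
    at least \<kappa> times the squared norm. It ends at 0 and starts no lower than
    \<open>- G * vnorm m w\<close>, which bounds the norm.\<close>
  have "gavg m p \<mu> X (\<lambda>i. 0 + w i) w - gavg m p \<mu> X (\<lambda>_. 0) w \<ge> \<kappa> * dotp m w w"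
  proof (rule gavg_increase[OF mu])
    fix t :: real assume t: "0 \<le> t" "t \<le> 1"
    have le: "vnorm m (\<lambda>i. 0 + t * w i) \<le> r1"
      using vnorm_convex[of m "\<lambda>_. 0" r1 w t] w t r by (simp add: vnorm_def[of m "\<lambda>_. 0"])
    show "dotp m (\<lambda>i. 0 + t * w i) (\<lambda>i. 0 + t * w i) < 1" by (rule small[OF le])
    show "havg m p \<mu> X (\<lambda>i. 0 + t * w i) w w \<ge> \<kappa> * dotp m w w"
      by (rule cvx[OF vecs_line le]) (use w in \<open>auto simp: vecs_def\<close>)
  qed
  then have "\<kappa> * (vnorm m w)\<^sup>2 \<le> G * vnorm m w"
    using grad0[of w] local_min_gavg_eq_0[OF mu r(4) w(1) lm] by (simp add: vnorm_sq)
  then have "\<kappa> * vnorm m w * vnorm m w \<le> G * vnorm m w" by (simp add: power2_eq_square)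
  then have "vnorm m w = 0 \<or> \<kappa> * vnorm m w \<le> G"
    using vnorm_nonneg[of m w] by (cases "vnorm m w = 0") (simp_all add: mult_le_cancel_right)
  then show "vnorm m w \<le> G / \<kappa>"
    using \<kappa> \<open>G \<ge> 0\<close> by (auto simp: field_simps)
qed

section \<open>Bernoulli-Gaussian linear forms as Gaussian mixtures\<close>

abbreviation stdN :: "real measure" where
  "stdN \<equiv> density lborel std_normal_density"

interpretation stdN: prob_space stdN
  by (rule prob_space_normal_density) simp

interpretation NN: pair_prob_space stdN stdN ..

lemma emeasure_stdN_UNIV [simp]: "emeasure stdN UNIV = 1"
  using stdN.emeasure_space_1 by simp

lemma nn_integral_BG:
  assumes [measurable]: "f \<in> borel_measurable borel" and "0 \<le> \<theta>" "\<theta> \<le> 1"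
  shows "(\<integral>\<^sup>+x. f x \<partial>BG \<theta>) = ennreal (1 - \<theta>) * f 0 + ennreal \<theta> * (\<integral>\<^sup>+x. f x \<partial>stdN)"
proof -
  interpret B: pair_prob_space "measure_pmf (bernoulli_pmf \<theta>)" stdN
    by unfold_locales
  have [measurable]: "(\<lambda>(b, g). (if b then 1 else 0) * g)
      \<in> borel_measurable (measure_pmf (bernoulli_pmf \<theta>) \<Otimes>\<^sub>M stdN)"
    by (simp add: case_prod_beta)
  have "(\<integral>\<^sup>+x. f x \<partial>BG \<theta>)
     = (\<integral>\<^sup>+b. \<integral>\<^sup>+g. f ((if b then 1 else 0) * g) \<partial>stdN \<partial>measure_pmf (bernoulli_pmf \<theta>))"
    unfolding BG_def
    by (subst nn_integral_distr, simp, simp, subst stdN.nn_integral_fst[symmetric]) simp_all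
  also have "\<dots> = ennreal (1 - \<theta>) * f 0 + ennreal \<theta> * (\<integral>\<^sup>+x. f x \<partial>stdN)"
    using assms
    by (simp add: nn_integral_bernoulli_pmf mult.commute add.commute)
  finally show ?thesis .
qed

lemma prob_space_BG: "prob_space (BG \<theta>)"
proof -
  interpret B: pair_prob_space "measure_pmf (bernoulli_pmf \<theta>)" stdN
    by unfold_locales
  show ?thesis
    unfolding BG_def by (rule B.prob_space_distr) (simp add: case_prod_beta)
qed

lemma sets_BG [simp, measurable_cong]: "sets (BG \<theta>) = sets borel"
  by (simp add: BG_def)

lemma space_BG [simp]: "space (BG \<theta>) = UNIV"
  by (simp add: BG_def)

section \<open>Rotation invariance of the planar Gaussian\<close>

lemma std_normal_rotate:
  assumes "c\<^sup>2 + d\<^sup>2 = 1"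
  shows "std_normal_density (c * x - d * y) * std_normal_density (d * x + c * y)
    = std_normal_density x * std_normal_density y"
proof -
  have "(c * x - d * y)\<^sup>2 + (d * x + c * y)\<^sup>2 = (c\<^sup>2 + d\<^sup>2) * (x\<^sup>2 + y\<^sup>2)"
    by (simp add: power2_eq_square algebra_simps)
  then have "exp (- (c * x - d * y)\<^sup>2 / 2) * exp (- (d * x + c * y)\<^sup>2 / 2) = exp (- x\<^sup>2 / 2) * exp (- y\<^sup>2 / 2)"
    unfolding exp_add[symmetric] assms by (simp add: field_simps)
  then show ?thesis
    unfolding std_normal_density_def by (simp add: mult_ac)
qed

text \<open>The planar change of variables is split into two one-variable affine substitutions with
  Fubini in between. Their Jacobian factors \<open>1 / c\<close> and \<open>c\<close> cancel in
  absolute value; \<open>c\<close> must be nonzero for the first of them.\<close>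

lemma nn_integral_stdN_rotate:
  assumes [measurable]: "\<Phi> \<in> borel_measurable (borel \<Otimes>\<^sub>M borel)" and c: "c \<noteq> 0" and cd: "c\<^sup>2 + d\<^sup>2 = 1"
  shows "(\<integral>\<^sup>+v. \<integral>\<^sup>+z. \<Phi> (c * z + d * v, c * v - d * z) \<partial>stdN \<partial>stdN)
       = (\<integral>\<^sup>+x. \<integral>\<^sup>+y. \<Phi> (x, y) \<partial>stdN \<partial>stdN)"
proof -
  let ?n = "std_normal_density"
  have \<Phi>2: "\<Phi> \<in> borel_measurable borel" using assms(1) by (simp add: borel_prod)
  have m [measurable]: "(\<lambda>x. \<Phi> (f x, g x)) \<in> borel_measurable M"
    if [measurable]: "f \<in> borel_measurable M" "g \<in> borel_measurable M" for f g and M :: "'a measure"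
    by measurable
  have "(\<integral>\<^sup>+v. \<integral>\<^sup>+z. \<Phi> (c * z + d * v, c * v - d * z) \<partial>stdN \<partial>stdN)
     = (\<integral>\<^sup>+v. \<integral>\<^sup>+z. ennreal (?n z * ?n v) * \<Phi> (c * z + d * v, c * v - d * z) \<partial>lborel \<partial>lborel)"
    by (simp add: nn_integral_density nn_integral_cmult[symmetric] ennreal_mult mult_ac)
  also have "\<dots> = (\<integral>\<^sup>+v. ennreal \<bar>1 / c\<bar> * (\<integral>\<^sup>+x. ennreal (?n ((x - d * v) / c) * ?n v) * \<Phi> (x, (v - d * x) / c) \<partial>lborel) \<partial>lborel)"
  proof (rule nn_integral_cong)
    fix v :: real
    have e1: "- (d * v / c) + 1 / c * x = (x - d * v) / c" for x
      using c by (simp add: field_simps)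
    have e2: "c * ((x - d * v) / c) + d * v = x" for x
      using c by simp
    have e3: "c * v - d * ((x - d * v) / c) = (v - d * x) / c" for x
    proof -
      have "c * v - d * ((x - d * v) / c) = ((c\<^sup>2 + d\<^sup>2) * v - d * x) / c"
        using c by (simp add: field_simps power2_eq_square)
      then show ?thesis using cd by simp
    qed
    show "(\<integral>\<^sup>+z. ennreal (?n z * ?n v) * \<Phi> (c * z + d * v, c * v - d * z) \<partial>lborel)
      = ennreal \<bar>1 / c\<bar> * (\<integral>\<^sup>+x. ennreal (?n ((x - d * v) / c) * ?n v) * \<Phi> (x, (v - d * x) / c) \<partial>lborel)"
      by (subst nn_integral_real_affine[where c="1/c" and t="-(d * v / c)"])
         (use c in \<open>simp_all only: e1 e2 e3, auto\<close>)
  qed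
  also have "\<dots> = ennreal \<bar>1 / c\<bar> * (\<integral>\<^sup>+x. \<integral>\<^sup>+v. ennreal (?n ((x - d * v) / c) * ?n v) * \<Phi> (x, (v - d * x) / c) \<partial>lborel \<partial>lborel)"
    by (subst nn_integral_cmult, simp, subst lborel_pair.Fubini') simp_all
  also have "(\<integral>\<^sup>+x. \<integral>\<^sup>+v. ennreal (?n ((x - d * v) / c) * ?n v) * \<Phi> (x, (v - d * x) / c) \<partial>lborel \<partial>lborel)
     = (\<integral>\<^sup>+x. ennreal \<bar>c\<bar> * (\<integral>\<^sup>+y. ennreal (?n x * ?n y) * \<Phi> (x, y) \<partial>lborel) \<partial>lborel)"
  proof (rule nn_integral_cong)
    fix x :: real
    have e1: "(x - d * (d * x + c * y)) / c = c * x - d * y" for y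
    proof -
      have "x - d * (d * x + c * y) = (1 - d\<^sup>2) * x - c * d * y" by (simp add: power2_eq_square algebra_simps)
      also have "1 - d\<^sup>2 = c\<^sup>2" using cd by simp
      finally show ?thesis using c by (simp add: field_simps power2_eq_square)
    qed
    have e2: "(d * x + c * y - d * x) / c = y" for y using c by simp
    show "(\<integral>\<^sup>+v. ennreal (?n ((x - d * v) / c) * ?n v) * \<Phi> (x, (v - d * x) / c) \<partial>lborel)
      = ennreal \<bar>c\<bar> * (\<integral>\<^sup>+y. ennreal (?n x * ?n y) * \<Phi> (x, y) \<partial>lborel)"
      by (subst nn_integral_real_affine[where c="c" and t="d * x"])
         (use c in \<open>simp_all only: e1 e2 std_normal_rotate[OF cd], auto\<close>)
  qed
  also have "ennreal \<bar>1 / c\<bar> * (\<integral>\<^sup>+x. ennreal \<bar>c\<bar> * (\<integral>\<^sup>+y. ennreal (?n x * ?n y) * \<Phi> (x, y) \<partial>lborel) \<partial>lborel)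
     = (\<integral>\<^sup>+x. \<integral>\<^sup>+y. ennreal (?n x * ?n y) * \<Phi> (x, y) \<partial>lborel \<partial>lborel)"
  proof -
    have "ennreal \<bar>1 / c\<bar> * ennreal \<bar>c\<bar> = 1" using c by (simp flip: ennreal_mult' abs_mult)
    then show ?thesis by (simp add: nn_integral_cmult mult.assoc[symmetric])
  qed
  also have "\<dots> = (\<integral>\<^sup>+x. \<integral>\<^sup>+y. \<Phi> (x, y) \<partial>stdN \<partial>stdN)"
    by (simp add: nn_integral_density nn_integral_cmult[symmetric] ennreal_mult mult_ac)
  finally show ?thesis .
qed

text \<open>Scaled by \<sigma>, the coefficients form a unit vector; rotating it to a coordinate
  axis leaves one Gaussian of variance \<open>s + a^2\<close>, and the other integrates out. The
  case \<open>a = 0\<close> is separate because the rotation divides by \<open>a\<close>.\<close>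

lemma nn_integral_stdN_sum:
  assumes [measurable]: "\<Phi> \<in> borel_measurable borel" and s: "s \<ge> 0"
  shows "(\<integral>\<^sup>+z. \<integral>\<^sup>+v. \<Phi> (sqrt s * z + a * v) \<partial>stdN \<partial>stdN) = (\<integral>\<^sup>+z. \<Phi> (sqrt (s + a\<^sup>2) * z) \<partial>stdN)"
proof (cases "a = 0")
  case True
  then show ?thesis by (simp)
next
  case False
  define \<sigma> where "\<sigma> = sqrt (s + a\<^sup>2)"
  have sg: "\<sigma> > 0" "\<sigma>\<^sup>2 = s + a\<^sup>2"
    using s False by (auto simp: \<sigma>_def add_nonneg_pos)
  have "(a / \<sigma>)\<^sup>2 + (sqrt s / \<sigma>)\<^sup>2 = 1"
    using sg s False by (simp add: power_divide add_divide_distrib[symmetric] add.commute add_nonneg_eq_0_iff)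
  from nn_integral_stdN_rotate[of "\<lambda>(x, y). \<Phi> (\<sigma> * x)", OF _ _ this]
  have "(\<integral>\<^sup>+z. \<integral>\<^sup>+v. \<Phi> (\<sigma> * (a / \<sigma> * v + sqrt s / \<sigma> * z)) \<partial>stdN \<partial>stdN) = (\<integral>\<^sup>+x. \<integral>\<^sup>+y. \<Phi> (\<sigma> * x) \<partial>stdN \<partial>stdN)"
    using False sg by simp
  moreover have "\<sigma> * (a / \<sigma> * v + sqrt s / \<sigma> * z) = sqrt s * z + a * v" for v z
    using sg by (simp add: field_simps)
  ultimately show ?thesis
    by (simp add: \<sigma>_def)
qed

lemma product_sigma_finite_BG: "product_sigma_finite (\<lambda>_. BG \<theta>)"
  by (intro product_sigma_finite.intro prob_space_imp_sigma_finite prob_space_BG)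

text \<open>\<open>Q\<close> is the law of the sum of \<open>(a i)^2\<close> over the random
  support. Induction on \<open>S\<close>: a new index leaves \<open>s\<close> unchanged with
  probability \<open>1 - \<theta>\<close> and adds \<open>(a i)^2\<close> with probability \<theta>,
  where two independent Gaussians merge into one.\<close>

lemma BG_linear_mixture:
  fixes a :: "'i \<Rightarrow> real"
  assumes "finite S" and \<theta>: "0 \<le> \<theta>" "\<theta> \<le> 1"
  shows "\<exists>Q :: real pmf. set_pmf Q \<subseteq> {0..(\<Sum>i\<in>S. (a i)\<^sup>2)} \<and> (\<integral>\<^sup>+s. ennreal s \<partial>Q) = ennreal (\<theta> * (\<Sum>i\<in>S. (a i)\<^sup>2)) \<and>
    (\<forall>\<Phi>\<in>borel_measurable borel. (\<integral>\<^sup>+x. \<Phi> (\<Sum>i\<in>S. a i * x i) \<partial>PiM S (\<lambda>_. BG \<theta>))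
        = (\<integral>\<^sup>+s. \<integral>\<^sup>+z. \<Phi> (sqrt s * z) \<partial>stdN \<partial>Q))"
  using assms(1)
proof induction
  case empty
  show ?case
    by (intro exI[of _ "return_pmf 0"])
       (simp add: PiM_empty)
next
  case (insert i S)
  interpret product_sigma_finite "\<lambda>_::'i. BG \<theta>" by (rule product_sigma_finite_BG)
  from insert.IH obtain Q :: "real pmf" where Q: "set_pmf Q \<subseteq> {0..(\<Sum>i\<in>S. (a i)\<^sup>2)}"
    "(\<integral>\<^sup>+s. ennreal s \<partial>Q) = ennreal (\<theta> * (\<Sum>i\<in>S. (a i)\<^sup>2))"
    "\<And>\<Phi>. \<Phi> \<in> borel_measurable borel \<Longrightarrow> (\<integral>\<^sup>+x. \<Phi> (\<Sum>i\<in>S. a i * x i) \<partial>PiM S (\<lambda>_. BG \<theta>))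
        = (\<integral>\<^sup>+s. \<integral>\<^sup>+z. \<Phi> (sqrt s * z) \<partial>stdN \<partial>Q)"
    by auto
  define Q' where "Q' = bind_pmf Q (\<lambda>s. map_pmf (\<lambda>b. if b then s + (a i)\<^sup>2 else s) (bernoulli_pmf \<theta>))"
  have nnQ': "(\<integral>\<^sup>+s. f s \<partial>Q') = (\<integral>\<^sup>+s. ennreal (1 - \<theta>) * f s + ennreal \<theta> * f (s + (a i)\<^sup>2) \<partial>Q)"
    for f :: "real \<Rightarrow> ennreal"
    unfolding Q'_def nn_integral_bind_pmf nn_integral_map_pmf
    using \<theta> by (simp add: nn_integral_bernoulli_pmf mult.commute add.commute)
  have S0: "(\<Sum>i\<in>S. (a i)\<^sup>2) \<ge> 0" by (simp add: sum_nonneg)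
  have ae: "AE s in Q. 0 \<le> s" using Q(1) by (auto simp: AE_measure_pmf_iff)
  have "set_pmf Q' \<subseteq> {0..(\<Sum>i\<in>insert i S. (a i)\<^sup>2)}"
  proof
    fix t assume "t \<in> set_pmf Q'"
    then obtain s where "s \<in> set_pmf Q" "t = s \<or> t = s + (a i)\<^sup>2"
      by (auto simp: Q'_def split: if_splits)
    then show "t \<in> {0..(\<Sum>i\<in>insert i S. (a i)\<^sup>2)}"
      using Q(1) insert.hyps by (auto simp: subset_iff add_increasing)
  qed
  moreover have "(\<integral>\<^sup>+s. ennreal s \<partial>Q') = ennreal (\<theta> * (\<Sum>i\<in>insert i S. (a i)\<^sup>2))"
  proof -
    have "(\<integral>\<^sup>+s. ennreal s \<partial>Q') = (\<integral>\<^sup>+s. ennreal s + ennreal (\<theta> * (a i)\<^sup>2) \<partial>Q)"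
      unfolding nnQ'
    proof (rule nn_integral_cong_AE, use ae in eventually_elim)
      case (elim s)
      have "ennreal (1 - \<theta>) * ennreal s + ennreal \<theta> * ennreal (s + (a i)\<^sup>2) = ennreal ((1 - \<theta>) * s + \<theta> * (s + (a i)\<^sup>2))"
        using elim \<theta> by (simp add: ennreal_mult ennreal_plus)
      also have "(1 - \<theta>) * s + \<theta> * (s + (a i)\<^sup>2) = s + \<theta> * (a i)\<^sup>2" by (simp add: algebra_simps)
      finally show ?case using elim \<theta> by (simp add: ennreal_plus)
    qed
    also have "\<dots> = ennreal (\<theta> * (\<Sum>i\<in>S. (a i)\<^sup>2)) + ennreal (\<theta> * (a i)\<^sup>2)"
      by (subst nn_integral_add) (simp_all add: Q(2))
    also have "\<dots> = ennreal (\<theta> * (\<Sum>i\<in>insert i S. (a i)\<^sup>2))"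
      using insert.hyps \<theta> S0 by (simp add: algebra_simps ennreal_plus[symmetric] del: ennreal_plus)
    finally show ?thesis .
  qed
  moreover have "(\<integral>\<^sup>+x. \<Phi> (\<Sum>i\<in>insert i S. a i * x i) \<partial>PiM (insert i S) (\<lambda>_. BG \<theta>))
        = (\<integral>\<^sup>+s. \<integral>\<^sup>+z. \<Phi> (sqrt s * z) \<partial>stdN \<partial>Q')" if [measurable]: "\<Phi> \<in> borel_measurable borel" for \<Phi>
  proof -
    \<comment> \<open>\<open>\<Psi>\<close> integrates out the new coordinate. The induction
      hypothesis covers all test functions, hence can be applied to \<open>\<Psi>\<close> in place
      of \<open>\<Phi>\<close>.\<close>
    define \<Psi> where "\<Psi> t = ennreal (1 - \<theta>) * \<Phi> t + ennreal \<theta> * (\<integral>\<^sup>+v. \<Phi> (t + a i * v) \<partial>stdN)" for t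
    have [measurable]: "\<Psi> \<in> borel_measurable borel" unfolding \<Psi>_def by measurable
    have "(\<integral>\<^sup>+x. \<Phi> (\<Sum>i\<in>insert i S. a i * x i) \<partial>PiM (insert i S) (\<lambda>_. BG \<theta>))
      = (\<integral>\<^sup>+x. \<integral>\<^sup>+y. \<Phi> (\<Sum>j\<in>insert i S. a j * (x(i := y)) j) \<partial>BG \<theta> \<partial>PiM S (\<lambda>_. BG \<theta>))"
      using insert.hyps by (intro product_nn_integral_insert) auto
    also have "\<dots> = (\<integral>\<^sup>+x. \<integral>\<^sup>+y. \<Phi> ((\<Sum>j\<in>S. a j * x j) + a i * y) \<partial>BG \<theta> \<partial>PiM S (\<lambda>_. BG \<theta>))"
    proof -
      have "(\<Sum>j\<in>insert i S. a j * (x(i := y)) j) = (\<Sum>j\<in>S. a j * x j) + a i * y" for x y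
        using insert.hyps by (auto simp: add.commute intro!: sum.cong)
      then show ?thesis by simp
    qed
    also have "\<dots> = (\<integral>\<^sup>+x. \<Psi> (\<Sum>j\<in>S. a j * x j) \<partial>PiM S (\<lambda>_. BG \<theta>))"
      unfolding \<Psi>_def using \<theta> by (subst nn_integral_BG) simp_all
    also have "\<dots> = (\<integral>\<^sup>+s. \<integral>\<^sup>+z. \<Psi> (sqrt s * z) \<partial>stdN \<partial>Q)"
      by (rule Q(3)) simp
    also have "\<dots> = (\<integral>\<^sup>+s. ennreal (1 - \<theta>) * (\<integral>\<^sup>+z. \<Phi> (sqrt s * z) \<partial>stdN)
        + ennreal \<theta> * (\<integral>\<^sup>+z. \<Phi> (sqrt (s + (a i)\<^sup>2) * z) \<partial>stdN) \<partial>Q)"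
    proof (rule nn_integral_cong_AE, use ae in eventually_elim)
      case (elim s)
      have "(\<integral>\<^sup>+z. \<Psi> (sqrt s * z) \<partial>stdN) = ennreal (1 - \<theta>) * (\<integral>\<^sup>+z. \<Phi> (sqrt s * z) \<partial>stdN)
        + ennreal \<theta> * (\<integral>\<^sup>+z. \<integral>\<^sup>+v. \<Phi> (sqrt s * z + a i * v) \<partial>stdN \<partial>stdN)"
        unfolding \<Psi>_def by (subst nn_integral_add) (simp_all add: nn_integral_cmult)
      then show ?case by (simp add: nn_integral_stdN_sum elim)
    qed
    finally show ?thesis by (simp add: nnQ')
  qed
  ultimately show ?case by (intro exI[of _ Q']) auto
qed

section \<open>A single column\<close>

definition colM :: "nat \<Rightarrow> real \<Rightarrow> (nat \<Rightarrow> real) measure" where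
  "colM m \<theta> = PiM {..<Suc m} (\<lambda>_. BG \<theta>)"

lemma prob_space_colM: "prob_space (colM m \<theta>)"
  unfolding colM_def by (intro prob_space_PiM prob_space_BG)

lemma measurable_colM_component [measurable]: "i \<le> m \<Longrightarrow> (\<lambda>x. x i) \<in> borel_measurable (colM m \<theta>)"
  using measurable_component_singleton[of i "{..<Suc m}" "\<lambda>_. BG \<theta>"]
  by (simp add: colM_def cong: measurable_cong_sets)

lemma measurable_dotp [measurable]: "dotp m a \<in> borel_measurable (colM m \<theta>)"
  unfolding dotp_def by (intro borel_measurable_sum borel_measurable_times) auto

lemma measurable_colM_last [measurable]: "(\<lambda>x. x m) \<in> borel_measurable (colM m \<theta>)"
  by simp

text \<open>The last entry stays outside the mixture because the parametrization of the sphere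
  treats it differently: it enters \<open>qarg\<close> with weight \<open>lastq\<close> and
  multiplies every correction to the tangent vector.\<close>

lemma colM_joint_law:
  assumes \<theta>: "0 \<le> \<theta>" "\<theta> \<le> 1"
  shows "\<exists>Q :: real pmf. set_pmf Q \<subseteq> {0..dotp m a a} \<and> (\<integral>\<^sup>+s. ennreal s \<partial>Q) = ennreal (\<theta> * dotp m a a) \<and>
    (\<forall>\<Phi>\<in>borel_measurable (borel \<Otimes>\<^sub>M borel). (\<integral>\<^sup>+x. \<Phi> (dotp m a x, x m) \<partial>colM m \<theta>)
        = (\<integral>\<^sup>+s. \<integral>\<^sup>+z. \<integral>\<^sup>+y. \<Phi> (sqrt s * z, y) \<partial>BG \<theta> \<partial>stdN \<partial>Q))"
proof -
  interpret product_sigma_finite "\<lambda>_::nat. BG \<theta>" by (rule product_sigma_finite_BG)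
  interpret BG: prob_space "BG \<theta>" by (rule prob_space_BG)
  have eq: "(\<Sum>i<m. (a i)\<^sup>2) = dotp m a a" by (simp add: dotp_def power2_eq_square)
  from BG_linear_mixture[OF finite_lessThan[of m] \<theta>, of a] obtain Q :: "real pmf"
    where Q: "set_pmf Q \<subseteq> {0..dotp m a a}" "(\<integral>\<^sup>+s. ennreal s \<partial>Q) = ennreal (\<theta> * dotp m a a)"
    "\<And>\<Phi>. \<Phi> \<in> borel_measurable borel \<Longrightarrow> (\<integral>\<^sup>+x. \<Phi> (dotp m a x) \<partial>PiM {..<m} (\<lambda>_. BG \<theta>))
        = (\<integral>\<^sup>+s. \<integral>\<^sup>+z. \<Phi> (sqrt s * z) \<partial>stdN \<partial>Q)"
    unfolding eq dotp_def[symmetric] by auto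
  have "(\<integral>\<^sup>+x. \<Phi> (dotp m a x, x m) \<partial>colM m \<theta>)
        = (\<integral>\<^sup>+s. \<integral>\<^sup>+z. \<integral>\<^sup>+y. \<Phi> (sqrt s * z, y) \<partial>BG \<theta> \<partial>stdN \<partial>Q)"
    if [measurable]: "\<Phi> \<in> borel_measurable (borel \<Otimes>\<^sub>M borel)" for \<Phi>
  proof -
    have m1 [measurable]: "(\<lambda>x. \<Phi> (dotp m a x, x m)) \<in> borel_measurable (colM m \<theta>)" by measurable
    have "(\<integral>\<^sup>+x. \<Phi> (dotp m a x, x m) \<partial>colM m \<theta>)
      = (\<integral>\<^sup>+x. \<integral>\<^sup>+y. \<Phi> (dotp m a (x(m := y)), (x(m := y)) m) \<partial>BG \<theta> \<partial>PiM {..<m} (\<lambda>_. BG \<theta>))"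
      using m1 unfolding colM_def lessThan_Suc by (intro product_nn_integral_insert) simp_all
    also have "\<dots> = (\<integral>\<^sup>+x. \<integral>\<^sup>+y. \<Phi> (dotp m a x, y) \<partial>BG \<theta> \<partial>PiM {..<m} (\<lambda>_. BG \<theta>))"
    proof -
      have "dotp m a (x(m := y)) = dotp m a x" for x y by (rule dotp_cong) auto
      then show ?thesis by simp
    qed
    also have "\<dots> = (\<integral>\<^sup>+s. \<integral>\<^sup>+z. \<integral>\<^sup>+y. \<Phi> (sqrt s * z, y) \<partial>BG \<theta> \<partial>stdN \<partial>Q)"
      by (rule Q(3)) measurable
    finally show ?thesis .
  qed
  with Q show ?thesis by blast
qed

section \<open>Moments and exponential moments of linear forms\<close>

lemma nn_integral_stdN_moment_even:
  "(\<integral>\<^sup>+z. ennreal (z ^ (2 * k)) \<partial>stdN) = ennreal (fact (2 * k) / (2^k * fact k))"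
proof -
  have "(\<integral>\<^sup>+z. ennreal (z ^ (2 * k)) \<partial>stdN) = (\<integral>\<^sup>+z. ennreal (std_normal_density z * z ^ (2 * k)) \<partial>lborel)"
    by (simp add: nn_integral_density ennreal_mult)
  also have "\<dots> = ennreal (fact (2 * k) / (2^k * fact k))"
    using has_bochner_integral_iff[THEN iffD1, OF std_normal_moment_even[of k]]
    by (subst nn_integral_eq_integral) auto
  finally show ?thesis .
qed

lemma nn_integral_stdN_sq: "(\<integral>\<^sup>+z. ennreal (z\<^sup>2) \<partial>stdN) = 1"
  using nn_integral_stdN_moment_even[of 1] by simp

lemma nn_integral_stdN_pow4: "(\<integral>\<^sup>+z. ennreal (z ^ 4) \<partial>stdN) = 3"
  using nn_integral_stdN_moment_even[of 2] by (simp add: fact_numeral)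

lemma nn_integral_stdN_abs: "(\<integral>\<^sup>+z. ennreal \<bar>z\<bar> \<partial>stdN) \<le> 1"
proof -
  have "(\<integral>\<^sup>+z. ennreal \<bar>z\<bar> \<partial>stdN) \<le> (\<integral>\<^sup>+z. ennreal (1 / 2) + ennreal (1 / 2) * ennreal (z\<^sup>2) \<partial>stdN)"
  proof (rule nn_integral_mono)
    fix z :: real
    have m: "ennreal (1 / 2) * ennreal (z\<^sup>2) = ennreal (1 / 2 * z\<^sup>2)"
      by (rule ennreal_mult'[symmetric]) simp
    have "\<bar>z\<bar> \<le> 1 / 2 + 1 / 2 * z\<^sup>2"
      using zero_le_power2[of "\<bar>z\<bar> - 1"] by (simp add: power2_diff)
    then have "ennreal \<bar>z\<bar> \<le> ennreal (1 / 2 + 1 / 2 * z\<^sup>2)" by (rule ennreal_leI)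
    also have "\<dots> = ennreal (1 / 2) + ennreal (1 / 2) * ennreal (z\<^sup>2)"
      unfolding m by (rule ennreal_plus) simp_all
    finally show "ennreal \<bar>z\<bar> \<le> ennreal (1 / 2) + ennreal (1 / 2) * ennreal (z\<^sup>2)" .
  qed
  also have "\<dots> = ennreal (1 / 2) + ennreal (1 / 2)"
    by (subst nn_integral_add) (simp_all add: nn_integral_cmult nn_integral_stdN_sq)
  also have "\<dots> = 1" by (simp flip: ennreal_plus del: ennreal_half)
  finally show ?thesis .
qed

text \<open>The weight turns the standard normal density into \<open>sqrt 2\<close> times the
  density of variance 2.\<close>

lemma nn_integral_stdN_exp: "(\<integral>\<^sup>+z. ennreal (exp (z\<^sup>2 / 4)) \<partial>stdN) = ennreal (sqrt 2)"
proof -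
  have eq: "std_normal_density z * exp (z\<^sup>2 / 4) = sqrt 2 * normal_density 0 (sqrt 2) z" for z
  proof -
    have "exp (- z\<^sup>2 / 2) * exp (z\<^sup>2 / 4) = exp (- z\<^sup>2 / 4)"
      unfolding exp_add[symmetric] by (simp add: field_simps)
    then show ?thesis
      by (simp add: normal_density_def real_sqrt_mult field_simps)
  qed
  have "(\<integral>\<^sup>+z. ennreal (exp (z\<^sup>2 / 4)) \<partial>stdN) = (\<integral>\<^sup>+z. ennreal (std_normal_density z * exp (z\<^sup>2 / 4)) \<partial>lborel)"
    by (simp add: nn_integral_density ennreal_mult)
  also have "\<dots> = ennreal (sqrt 2) * (\<integral>\<^sup>+z. ennreal (normal_density 0 (sqrt 2) z) \<partial>lborel)"
    unfolding eq by (simp add: ennreal_mult nn_integral_cmult)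
  also have "(\<integral>\<^sup>+z. ennreal (normal_density 0 (sqrt 2) z) \<partial>lborel) = 1"
    by (subst nn_integral_eq_integral) simp_all
  finally show ?thesis by simp
qed

lemma nn_integral_colM_dotp:
  assumes \<theta>: "0 \<le> \<theta>" "\<theta> \<le> 1"
  shows "\<exists>Q :: real pmf. set_pmf Q \<subseteq> {0..dotp m a a} \<and> (\<integral>\<^sup>+s. ennreal s \<partial>Q) = ennreal (\<theta> * dotp m a a) \<and>
    (\<forall>\<Psi>\<in>borel_measurable borel. (\<integral>\<^sup>+x. \<Psi> (dotp m a x) \<partial>colM m \<theta>)
        = (\<integral>\<^sup>+s. \<integral>\<^sup>+z. \<Psi> (sqrt s * z) \<partial>stdN \<partial>Q))"
proof -
  interpret BG: prob_space "BG \<theta>" by (rule prob_space_BG)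
  from colM_joint_law[OF \<theta>, of m a] obtain Q :: "real pmf" where
    Q: "set_pmf Q \<subseteq> {0..dotp m a a}" "(\<integral>\<^sup>+s. ennreal s \<partial>Q) = ennreal (\<theta> * dotp m a a)"
    "\<And>\<Phi>. \<Phi> \<in> borel_measurable (borel \<Otimes>\<^sub>M borel) \<Longrightarrow> (\<integral>\<^sup>+x. \<Phi> (dotp m a x, x m) \<partial>colM m \<theta>)
        = (\<integral>\<^sup>+s. \<integral>\<^sup>+z. \<integral>\<^sup>+y. \<Phi> (sqrt s * z, y) \<partial>BG \<theta> \<partial>stdN \<partial>Q)"
    by auto
  have "(\<integral>\<^sup>+x. \<Psi> (dotp m a x) \<partial>colM m \<theta>) = (\<integral>\<^sup>+s. \<integral>\<^sup>+z. \<Psi> (sqrt s * z) \<partial>stdN \<partial>Q)"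
    if [measurable]: "\<Psi> \<in> borel_measurable borel" for \<Psi>
    using Q(3)[of "\<lambda>(t, y). \<Psi> t"] BG.emeasure_space_1 by simp
  with Q show ?thesis by blast
qed

text \<open>Every variance in the mixture is at most 1, so the standard Gaussian dominates. This is
  the subgaussian input of the Chernoff bound.\<close>

lemma nn_integral_colM_exp_dotp:
  assumes \<theta>: "0 \<le> \<theta>" "\<theta> \<le> 1" and a: "dotp m a a \<le> 1"
  shows "(\<integral>\<^sup>+x. ennreal (exp ((dotp m a x)\<^sup>2 / 4)) \<partial>colM m \<theta>) \<le> ennreal (sqrt 2)"
proof -
  from nn_integral_colM_dotp[OF \<theta>, of m a] obtain Q :: "real pmf" where
    Q: "set_pmf Q \<subseteq> {0..dotp m a a}"
    "\<And>\<Psi>. \<Psi> \<in> borel_measurable borel \<Longrightarrow> (\<integral>\<^sup>+x. \<Psi> (dotp m a x) \<partial>colM m \<theta>) = (\<integral>\<^sup>+s. \<integral>\<^sup>+z. \<Psi> (sqrt s * z) \<partial>stdN \<partial>Q)"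
    by blast
  have "(\<integral>\<^sup>+x. ennreal (exp ((dotp m a x)\<^sup>2 / 4)) \<partial>colM m \<theta>)
      = (\<integral>\<^sup>+s. \<integral>\<^sup>+z. ennreal (exp ((sqrt s * z)\<^sup>2 / 4)) \<partial>stdN \<partial>Q)"
    by (rule Q(2)) measurable
  also have "\<dots> \<le> (\<integral>\<^sup>+s. ennreal (sqrt 2) \<partial>Q)"
  proof (rule nn_integral_mono_AE, unfold AE_measure_pmf_iff, intro ballI)
    fix s assume "s \<in> set_pmf Q"
    then have s: "0 \<le> s" "s \<le> 1" using Q(1) a by auto
    have "(sqrt s * z)\<^sup>2 \<le> z\<^sup>2" for z
      using s by (simp add: power_mult_distrib mult_left_le_one_le)
    then have "(\<integral>\<^sup>+z. ennreal (exp ((sqrt s * z)\<^sup>2 / 4)) \<partial>stdN) \<le> (\<integral>\<^sup>+z. ennreal (exp (z\<^sup>2 / 4)) \<partial>stdN)"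
      by (intro nn_integral_mono ennreal_leI) simp
    then show "(\<integral>\<^sup>+z. ennreal (exp ((sqrt s * z)\<^sup>2 / 4)) \<partial>stdN) \<le> ennreal (sqrt 2)"
      by (simp add: nn_integral_stdN_exp)
  qed
  also have "\<dots> = ennreal (sqrt 2)" by (simp add: measure_pmf.emeasure_space_1)
  finally show ?thesis .
qed

lemma nn_integral_BG_exp:
  assumes "0 \<le> \<theta>" "\<theta> \<le> 1"
  shows "(\<integral>\<^sup>+x. ennreal (exp (x\<^sup>2 / 4)) \<partial>BG \<theta>) \<le> ennreal (sqrt 2)"
proof -
  have "(1 - \<theta>) + \<theta> * sqrt 2 \<le> sqrt 2"
    using assms mult_left_mono[of 1 "sqrt 2" "1 - \<theta>"] by (simp add: algebra_simps)
  then show ?thesis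
    using assms
    by (simp add: nn_integral_BG nn_integral_stdN_exp ennreal_mult[symmetric] ennreal_plus[symmetric] ennreal_leI
          del: ennreal_plus)
qed

lemma nn_integral_colM_component:
  assumes [measurable]: "f \<in> borel_measurable borel" and "i \<le> m"
  shows "(\<integral>\<^sup>+x. f (x i) \<partial>colM m \<theta>) = (\<integral>\<^sup>+y. f y \<partial>BG \<theta>)"
proof -
  interpret product_prob_space "\<lambda>_. BG \<theta>" "{..<Suc m}"
    by (intro product_prob_spaceI prob_space_BG)
  have "(\<integral>\<^sup>+y. f y \<partial>BG \<theta>) = (\<integral>\<^sup>+y. f y \<partial>distr (colM m \<theta>) (BG \<theta>) (\<lambda>x. x i))"
    unfolding colM_def using assms by (subst PiM_component) auto
  also have "\<dots> = (\<integral>\<^sup>+x. f (x i) \<partial>colM m \<theta>)"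
    using assms by (subst nn_integral_distr) (auto cong: measurable_cong_sets)
  finally show ?thesis ..
qed

text \<open>The last entry is independent of the others and has an atom of mass
  \<open>1 - \<theta>\<close> at 0. Restricting to columns with vanishing last entry therefore costs
  only this factor.\<close>

lemma nn_integral_colM_last_zero:
  assumes \<theta>: "0 \<le> \<theta>" "\<theta> \<le> 1" and [measurable]: "\<Psi> \<in> borel_measurable borel"
  shows "(\<integral>\<^sup>+x. \<Psi> (dotp m a x) * indicator {0} (x m) \<partial>colM m \<theta>)
      = ennreal (1 - \<theta>) * (\<integral>\<^sup>+x. \<Psi> (dotp m a x) \<partial>colM m \<theta>)"
proof -
  interpret BG: prob_space "BG \<theta>" by (rule prob_space_BG)
  from colM_joint_law[OF \<theta>, of m a] obtain Q :: "real pmf" where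
    Q: "\<And>\<Phi>. \<Phi> \<in> borel_measurable (borel \<Otimes>\<^sub>M borel) \<Longrightarrow> (\<integral>\<^sup>+x. \<Phi> (dotp m a x, x m) \<partial>colM m \<theta>)
        = (\<integral>\<^sup>+s. \<integral>\<^sup>+z. \<integral>\<^sup>+y. \<Phi> (sqrt s * z, y) \<partial>BG \<theta> \<partial>stdN \<partial>Q)"
    by auto
  have N0: "emeasure stdN {0} = 0"
    by (simp add: emeasure_density nn_integral_indicator_singleton)
  have "(\<integral>\<^sup>+y. indicator {0} y \<partial>BG \<theta>) = ennreal (1 - \<theta>)"
    using \<theta> by (subst nn_integral_BG) (simp_all add: N0)
  then have eq: "emeasure (BG \<theta>) {0} = ennreal (1 - \<theta>)" by simp
  have "(\<integral>\<^sup>+x. \<Psi> (dotp m a x) * indicator {0} (x m) \<partial>colM m \<theta>)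
     = (\<integral>\<^sup>+s. \<integral>\<^sup>+z. \<integral>\<^sup>+y. \<Psi> (sqrt s * z) * indicator {0} y \<partial>BG \<theta> \<partial>stdN \<partial>Q)"
    using Q[of "\<lambda>(t, y). \<Psi> t * indicator {0} y"] by simp
  also have "\<dots> = (\<integral>\<^sup>+s. \<integral>\<^sup>+z. \<Psi> (sqrt s * z) \<partial>stdN \<partial>Q) * ennreal (1 - \<theta>)"
    by (simp add: nn_integral_cmult eq nn_integral_multc)
  also have "\<dots> = ennreal (1 - \<theta>) * (\<integral>\<^sup>+s. \<integral>\<^sup>+z. \<Psi> (sqrt s * z) \<partial>stdN \<partial>Q)"
    by (rule mult.commute)
  also have "(\<integral>\<^sup>+s. \<integral>\<^sup>+z. \<Psi> (sqrt s * z) \<partial>stdN \<partial>Q) = (\<integral>\<^sup>+x. \<Psi> (dotp m a x) \<partial>colM m \<theta>)"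
    using Q[of "\<lambda>(t, y). \<Psi> t"] BG.emeasure_space_1 by simp
  finally show ?thesis .
qed

lemma nn_integral_colM_sq:
  assumes \<theta>: "0 \<le> \<theta>" "\<theta> \<le> 1"
  shows "(\<integral>\<^sup>+x. ennreal ((dotp m a x)\<^sup>2) \<partial>colM m \<theta>) = ennreal (\<theta> * dotp m a a)"
proof -
  from nn_integral_colM_dotp[OF \<theta>, of m a] obtain Q :: "real pmf" where
    Q: "set_pmf Q \<subseteq> {0..dotp m a a}" "(\<integral>\<^sup>+s. ennreal s \<partial>Q) = ennreal (\<theta> * dotp m a a)"
    "\<And>\<Psi>. \<Psi> \<in> borel_measurable borel \<Longrightarrow> (\<integral>\<^sup>+x. \<Psi> (dotp m a x) \<partial>colM m \<theta>) = (\<integral>\<^sup>+s. \<integral>\<^sup>+z. \<Psi> (sqrt s * z) \<partial>stdN \<partial>Q)"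
    by blast
  have "(\<integral>\<^sup>+x. ennreal ((dotp m a x)\<^sup>2) \<partial>colM m \<theta>) = (\<integral>\<^sup>+s. \<integral>\<^sup>+z. ennreal ((sqrt s * z)\<^sup>2) \<partial>stdN \<partial>Q)"
    by (rule Q(3)) measurable
  also have "\<dots> = (\<integral>\<^sup>+s. ennreal s \<partial>Q)"
  proof (rule nn_integral_cong_AE, unfold AE_measure_pmf_iff, intro ballI)
    fix s assume "s \<in> set_pmf Q"
    then have "0 \<le> s" using Q(1) by auto
    then show "(\<integral>\<^sup>+z. ennreal ((sqrt s * z)\<^sup>2) \<partial>stdN) = ennreal s"
      by (simp add: power_mult_distrib ennreal_mult nn_integral_cmult nn_integral_stdN_sq)
  qed
  finally show ?thesis by (simp add: Q(2))
qed

text \<open>Conditionally the fourth moment is \<open>3 * s^2\<close>, and \<open>s^2\<close> is at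
  most \<open>s\<close> times the squared norm of \<open>a\<close>. This keeps the bound linear in
  \<theta>, comparable with the second moment.\<close>

lemma nn_integral_colM_pow4:
  assumes \<theta>: "0 \<le> \<theta>" "\<theta> \<le> 1"
  shows "(\<integral>\<^sup>+x. ennreal ((dotp m a x) ^ 4) \<partial>colM m \<theta>) \<le> ennreal (3 * \<theta> * (dotp m a a)\<^sup>2)"
proof -
  from nn_integral_colM_dotp[OF \<theta>, of m a] obtain Q :: "real pmf" where
    Q: "set_pmf Q \<subseteq> {0..dotp m a a}" "(\<integral>\<^sup>+s. ennreal s \<partial>Q) = ennreal (\<theta> * dotp m a a)"
    "\<And>\<Psi>. \<Psi> \<in> borel_measurable borel \<Longrightarrow> (\<integral>\<^sup>+x. \<Psi> (dotp m a x) \<partial>colM m \<theta>) = (\<integral>\<^sup>+s. \<integral>\<^sup>+z. \<Psi> (sqrt s * z) \<partial>stdN \<partial>Q)"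
    by blast
  have "(\<integral>\<^sup>+x. ennreal ((dotp m a x) ^ 4) \<partial>colM m \<theta>) = (\<integral>\<^sup>+s. \<integral>\<^sup>+z. ennreal ((sqrt s * z) ^ 4) \<partial>stdN \<partial>Q)"
    by (rule Q(3)) measurable
  also have "\<dots> \<le> (\<integral>\<^sup>+s. ennreal (3 * dotp m a a) * ennreal s \<partial>Q)"
  proof (rule nn_integral_mono_AE, unfold AE_measure_pmf_iff, intro ballI)
    fix s assume "s \<in> set_pmf Q"
    then have s: "0 \<le> s" "s \<le> dotp m a a" using Q(1) by auto
    have "(sqrt s) ^ 4 = s\<^sup>2" using s power_mult[of "sqrt s" 2 2] by simp
    then have "(\<integral>\<^sup>+z. ennreal ((sqrt s * z) ^ 4) \<partial>stdN) = ennreal (s\<^sup>2) * 3"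
      by (simp add: power_mult_distrib ennreal_mult nn_integral_cmult nn_integral_stdN_pow4)
    also have "\<dots> = ennreal (s\<^sup>2 * 3)" by (simp add: ennreal_mult)
    also have "\<dots> \<le> ennreal (3 * dotp m a a * s)"
      using mult_left_mono[OF s(2) s(1)] by (intro ennreal_leI) (simp add: power2_eq_square)
    finally show "(\<integral>\<^sup>+z. ennreal ((sqrt s * z) ^ 4) \<partial>stdN) \<le> ennreal (3 * dotp m a a) * ennreal s"
      using s by (simp add: ennreal_mult)
  qed
  also have "\<dots> = ennreal (3 * dotp m a a) * ennreal (\<theta> * dotp m a a)"
    by (subst nn_integral_cmult) (simp_all add: Q(2))
  also have "\<dots> = ennreal (3 * dotp m a a * (\<theta> * dotp m a a))"
    using \<theta> by (intro ennreal_mult[symmetric]) simp_all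
  also have "\<dots> = ennreal (3 * \<theta> * (dotp m a a)\<^sup>2)"
    by (simp add: power2_eq_square mult_ac)
  finally show ?thesis .
qed

text \<open>Each mixture component is a centred Gaussian independent of the last entry, so flipping
  the sign of the linear form preserves the joint law. Equality of laws carries over to Bochner
  integrals without any integrability condition.\<close>

lemma colM_reflect:
  fixes F :: "real \<times> real \<Rightarrow> real"
  assumes \<theta>: "0 \<le> \<theta>" "\<theta> \<le> 1" and [measurable]: "F \<in> borel_measurable (borel \<Otimes>\<^sub>M borel)"
  shows "(\<integral>x. F (dotp m a x, x m) \<partial>colM m \<theta>) = (\<integral>x. F (- dotp m a x, x m) \<partial>colM m \<theta>)"
proof -
  interpret BG: prob_space "BG \<theta>" by (rule prob_space_BG)
  from colM_joint_law[OF \<theta>, of m a] obtain Q :: "real pmf" where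
    Q: "\<And>\<Phi>. \<Phi> \<in> borel_measurable (borel \<Otimes>\<^sub>M borel) \<Longrightarrow> (\<integral>\<^sup>+x. \<Phi> (dotp m a x, x m) \<partial>colM m \<theta>)
        = (\<integral>\<^sup>+s. \<integral>\<^sup>+z. \<integral>\<^sup>+y. \<Phi> (sqrt s * z, y) \<partial>BG \<theta> \<partial>stdN \<partial>Q)"
    by auto
  have nn: "(\<integral>\<^sup>+x. \<Phi> (dotp m a x, x m) \<partial>colM m \<theta>) = (\<integral>\<^sup>+x. \<Phi> (- dotp m a x, x m) \<partial>colM m \<theta>)"
    if [measurable]: "\<Phi> \<in> borel_measurable (borel \<Otimes>\<^sub>M borel)" for \<Phi> :: "real \<times> real \<Rightarrow> ennreal"
  proof -
    have ref: "(\<integral>\<^sup>+z. h z \<partial>stdN) = (\<integral>\<^sup>+z. h (- z) \<partial>stdN)" if [measurable]: "h \<in> borel_measurable borel" for h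
    proof -
      have "(\<integral>\<^sup>+z. h z \<partial>stdN) = (\<integral>\<^sup>+z. ennreal (std_normal_density z) * h z \<partial>lborel)"
        by (simp add: nn_integral_density)
      also have "\<dots> = (\<integral>\<^sup>+z. ennreal (std_normal_density z) * h (- z) \<partial>lborel)"
        by (subst nn_integral_real_affine[where c="-1" and t=0]) (simp_all add: normal_density_def)
      also have "\<dots> = (\<integral>\<^sup>+z. h (- z) \<partial>stdN)"
        by (simp add: nn_integral_density)
      finally show ?thesis .
    qed
    have "(\<integral>\<^sup>+x. \<Phi> (- dotp m a x, x m) \<partial>colM m \<theta>)
       = (\<integral>\<^sup>+s. \<integral>\<^sup>+z. \<integral>\<^sup>+y. \<Phi> (- (sqrt s * z), y) \<partial>BG \<theta> \<partial>stdN \<partial>Q)"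
      using Q[of "\<lambda>(t, y). \<Phi> (- t, y)"] by simp
    also have "\<dots> = (\<integral>\<^sup>+s. \<integral>\<^sup>+z. \<integral>\<^sup>+y. \<Phi> (sqrt s * z, y) \<partial>BG \<theta> \<partial>stdN \<partial>Q)"
      by (subst ref) (simp_all, measurable)
    finally show ?thesis by (simp add: Q)
  qed
  have "distr (colM m \<theta>) (borel \<Otimes>\<^sub>M borel) (\<lambda>x. (dotp m a x, x m))
      = distr (colM m \<theta>) (borel \<Otimes>\<^sub>M borel) (\<lambda>x. (- dotp m a x, x m))"
  proof (rule measure_eqI)
    fix A assume "A \<in> sets (distr (colM m \<theta>) (borel \<Otimes>\<^sub>M borel) (\<lambda>x. (dotp m a x, x m)))"
    then have A [measurable]: "A \<in> sets (borel \<Otimes>\<^sub>M borel)" by simp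
    have "emeasure (distr (colM m \<theta>) (borel \<Otimes>\<^sub>M borel) f) A = (\<integral>\<^sup>+x. indicator A (f x) \<partial>colM m \<theta>)"
      if [measurable]: "f \<in> measurable (colM m \<theta>) (borel \<Otimes>\<^sub>M borel)" for f
    proof -
      have "(\<integral>\<^sup>+x. indicator A (f x) \<partial>colM m \<theta>) = (\<integral>\<^sup>+y. indicator A y \<partial>distr (colM m \<theta>) (borel \<Otimes>\<^sub>M borel) f)"
        by (subst nn_integral_distr) simp_all
      also have "\<dots> = emeasure (distr (colM m \<theta>) (borel \<Otimes>\<^sub>M borel) f) A"
        using A by (intro nn_integral_indicator) simp
      finally show ?thesis ..
    qed
    then show "emeasure (distr (colM m \<theta>) (borel \<Otimes>\<^sub>M borel) (\<lambda>x. (dotp m a x, x m))) A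
        = emeasure (distr (colM m \<theta>) (borel \<Otimes>\<^sub>M borel) (\<lambda>x. (- dotp m a x, x m))) A"
      using nn[of "indicator A"] by simp
  qed simp
  then have "integral\<^sup>L (distr (colM m \<theta>) (borel \<Otimes>\<^sub>M borel) (\<lambda>x. (dotp m a x, x m))) F
      = integral\<^sup>L (distr (colM m \<theta>) (borel \<Otimes>\<^sub>M borel) (\<lambda>x. (- dotp m a x, x m))) F"
    by simp
  then show ?thesis by (simp add: integral_distr)
qed

section \<open>Exponential concentration\<close>

lemma exp_minus_quadratic_bound:
  fixes u :: real
  shows "exp (- u) \<le> 1 - u + u\<^sup>2 / 2 * exp \<bar>u\<bar>"
proof -
  obtain t where t: "\<bar>t\<bar> \<le> \<bar>- u\<bar>" "exp (- u) = (\<Sum>k<2. (- u) ^ k / fact k) + exp t / fact 2 * (- u)\<^sup>2"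
    using Maclaurin_exp_le[of "- u" 2] by auto
  have "exp t * u\<^sup>2 \<le> exp \<bar>u\<bar> * u\<^sup>2"
    using t(1) by (intro mult_right_mono) auto
  then show ?thesis
    using t(2) by (simp add: numeral_2_eq_2 mult.commute)
qed

text \<open>The quadratic Taylor term of the exponential at \<open>y / 8\<close>; the constant is
  128 = 2 * 8^2.\<close>

lemma sq_le_exp_eighth:
  fixes y :: real
  assumes "y \<ge> 0"
  shows "y\<^sup>2 \<le> 128 * exp (y / 8)"
  using exp_lower_Taylor_quadratic[of "y / 8"] assms by (simp add: power2_eq_square field_simps)

text \<open>Second-order expansion of the exponential at rate \<open>\<tau> / (256 * L^2)\<close>.
  The first-order term gains \<open>2 * \<tau>\<close> times the rate, and 256 is chosen so that the
  remainder consumes at most a quarter of this gain.\<close>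

lemma (in prob_space) quadratic_growth_mgf:
  fixes F A B :: "'a \<Rightarrow> real"
  assumes [measurable]: "F \<in> borel_measurable M" "A \<in> borel_measurable M" "B \<in> borel_measurable M"
    and bound: "\<And>x. \<bar>F x\<bar> \<le> L * (1 + ((A x)\<^sup>2 + (B x)\<^sup>2) / 2)"
    and expA: "(\<integral>\<^sup>+x. ennreal (exp ((A x)\<^sup>2 / 4)) \<partial>M) \<le> ennreal (sqrt 2)"
    and expB: "(\<integral>\<^sup>+x. ennreal (exp ((B x)\<^sup>2 / 4)) \<partial>M) \<le> ennreal (sqrt 2)"
    and \<tau>: "0 < \<tau>" "\<tau> \<le> L" and mean: "expectation F \<ge> 2 * \<tau>"
  shows "(\<integral>\<^sup>+x. ennreal (exp (- (\<tau> / (256 * L\<^sup>2)) * F x)) \<partial>M) \<le> ennreal (exp (- (\<tau> / (256 * L\<^sup>2)) * \<tau>))"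
proof -
  have L: "L > 0" using \<tau> by simp
  define ell where "ell = \<tau> / (256 * L\<^sup>2)"
  have l0: "ell > 0" using \<tau> L by (simp add: ell_def)
  have lL: "ell * L\<^sup>2 = \<tau> / 256" using L by (simp add: ell_def)
  have "ell * L = \<tau> / L / 256" using L by (simp add: ell_def power2_eq_square)
  moreover have "\<tau> / L \<le> 1" using \<tau> L by simp
  ultimately have lL8: "ell * L \<le> 1 / 8" by simp
  define Y where "Y x = 1 + ((A x)\<^sup>2 + (B x)\<^sup>2) / 2" for x
  \<comment> \<open>\<open>W\<close> dominates everything in the expansion: one factor
    \<open>exp (Y / 8)\<close> absorbs the square of \<open>Y\<close>, the other absorbs the
    exponential of the remainder.\<close>
  define W where "W x = exp (Y x / 4)" for x
  have Y1: "Y x \<ge> 1" for x by (simp add: Y_def)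
  have [measurable]: "W \<in> borel_measurable M" unfolding W_def Y_def by measurable
  have "integrable M (\<lambda>x. exp ((A x)\<^sup>2 / 4))" "integrable M (\<lambda>x. exp ((B x)\<^sup>2 / 4))"
    using expA expB by (auto intro!: integrableI_nonneg elim: order.strict_trans1)
  note int = this
  have e: "expectation (\<lambda>x. exp ((A x)\<^sup>2 / 4)) \<le> sqrt 2" "expectation (\<lambda>x. exp ((B x)\<^sup>2 / 4)) \<le> sqrt 2"
    using expA expB by (auto simp: nn_integral_eq_integral int)
  define V where "V x = exp (1 / 4) / 2 * (exp ((A x)\<^sup>2 / 4) + exp ((B x)\<^sup>2 / 4))" for x
  have intV: "integrable M V" unfolding V_def using int by auto
  have WV: "W x \<le> V x" for x
  proof -
    let ?a = "exp ((A x)\<^sup>2 / 8)" and ?b = "exp ((B x)\<^sup>2 / 8)"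
    \<comment> \<open>\<open>A\<close> and \<open>B\<close> may be dependent; the
      arithmetic-geometric inequality decouples them, so two separate exponential moments
      suffice.\<close>
    have "2 * ?a * ?b \<le> ?a\<^sup>2 + ?b\<^sup>2" by (rule sum_squares_bound)
    moreover have "?a\<^sup>2 = exp ((A x)\<^sup>2 / 4)" "?b\<^sup>2 = exp ((B x)\<^sup>2 / 4)"
      by (simp_all add: power2_eq_square exp_add[symmetric])
    moreover have "W x = exp (1 / 4) * (?a * ?b)"
      unfolding W_def Y_def exp_add[symmetric] by (simp add: field_simps)
    ultimately show ?thesis
      using mult_left_mono[of "2 * ?a * ?b" "?a\<^sup>2 + ?b\<^sup>2" "exp (1 / 4)"] unfolding V_def
      by (simp add: algebra_simps)
  qed
  have intW: "integrable M W"
  proof (rule Bochner_Integration.integrable_bound[OF intV])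
    have "\<bar>W x\<bar> \<le> \<bar>V x\<bar>" for x
      using WV[of x] by (simp add: W_def)
    then show "AE x in M. norm (W x) \<le> norm (V x)"
      unfolding real_norm_def by (rule AE_I2)
  qed simp
  have EW: "expectation W \<le> 2"
  proof -
    have "expectation W \<le> expectation V" by (rule integral_mono[OF intW intV WV])
    also have "\<dots> = exp (1 / 4) / 2 * (expectation (\<lambda>x. exp ((A x)\<^sup>2 / 4)) + expectation (\<lambda>x. exp ((B x)\<^sup>2 / 4)))"
      unfolding V_def using int by simp
    also have "\<dots> \<le> exp (1 / 4) / 2 * (sqrt 2 + sqrt 2)"
      using e by (intro mult_left_mono add_mono) auto
    also have "\<dots> \<le> (1 + 1 / 4 + (1 / 4)\<^sup>2) * sqrt 2"
      using exp_bound[of "1 / 4 :: real"] by simp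
    \<comment> \<open>Numerically 21 / 16 * 3 / 2 = 63 / 32 < 2.\<close>
    also have "\<dots> \<le> (1 + 1 / 4 + (1 / 4)\<^sup>2) * (3 / 2)"
      by (intro mult_left_mono real_le_lsqrt) (auto simp: power2_eq_square)
    also have "\<dots> \<le> 2" by (simp add: power2_eq_square)
    finally show ?thesis .
  qed
  have FY: "\<bar>F x\<bar> \<le> L * Y x" for x using bound[of x] by (simp add: Y_def)
  have YW: "Y x \<le> 4 * W x" for x
    using exp_ge_add_one_self[of "Y x / 4"] unfolding W_def by linarith
  have FW: "\<bar>F x\<bar> \<le> \<bar>L * 4 * W x\<bar>" for x
  proof -
    have "L * Y x \<le> L * (4 * W x)" using YW[of x] L by (intro mult_left_mono) auto
    then have "\<bar>F x\<bar> \<le> L * 4 * W x" using FY[of x] by (simp only: mult.assoc)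
    then show ?thesis by linarith
  qed
  have intF: "integrable M F"
  proof (rule Bochner_Integration.integrable_bound)
    show "integrable M (\<lambda>x. L * 4 * W x)" using intW by simp
    show "AE x in M. norm (F x) \<le> norm (L * 4 * W x)"
      unfolding real_norm_def using FW by (rule AE_I2)
  qed simp
  have pt: "exp (- ell * F x) \<le> 1 - ell * F x + 64 * ell\<^sup>2 * L\<^sup>2 * W x" for x
  proof -
    let ?u = "ell * F x"
    have u: "\<bar>?u\<bar> \<le> ell * L * Y x"
      using mult_left_mono[OF FY[of x], of ell] l0 by (simp add: abs_mult mult.assoc)
    also have "\<dots> \<le> 1 / 8 * Y x" using lL8 Y1[of x] by (intro mult_right_mono) auto
    finally have u8: "\<bar>?u\<bar> \<le> Y x / 8" by simp
    have "?u\<^sup>2 \<le> (ell * L * Y x)\<^sup>2" using u by (simp add: abs_le_square_iff[symmetric])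
    also have "\<dots> = ell\<^sup>2 * L\<^sup>2 * (Y x)\<^sup>2" by (simp add: power_mult_distrib)
    also have "\<dots> \<le> ell\<^sup>2 * L\<^sup>2 * (128 * exp (Y x / 8))"
      using sq_le_exp_eighth[of "Y x"] Y1[of x] by (intro mult_left_mono) auto
    finally have "?u\<^sup>2 / 2 * exp \<bar>?u\<bar> \<le> (ell\<^sup>2 * L\<^sup>2 * (128 * exp (Y x / 8))) / 2 * exp (Y x / 8)"
      using u8 by (intro mult_mono divide_right_mono) auto
    also have "\<dots> = 64 * ell\<^sup>2 * L\<^sup>2 * (exp (Y x / 8) * exp (Y x / 8))" by simp
    also have "exp (Y x / 8) * exp (Y x / 8) = W x" by (simp add: W_def exp_add[symmetric])
    finally show ?thesis using exp_minus_quadratic_bound[of ?u] by simp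
  qed
  have intexp: "integrable M (\<lambda>x. exp (- ell * F x))"
  proof (rule Bochner_Integration.integrable_bound)
    show "integrable M (\<lambda>x. 1 - ell * F x + 64 * ell\<^sup>2 * L\<^sup>2 * W x)" using intF intW by simp
    have "\<bar>exp (- ell * F x)\<bar> \<le> \<bar>1 - ell * F x + 64 * ell\<^sup>2 * L\<^sup>2 * W x\<bar>" for x
      using pt[of x] exp_gt_zero[of "- ell * F x"] by linarith
    then show "AE x in M. norm (exp (- ell * F x)) \<le> norm (1 - ell * F x + 64 * ell\<^sup>2 * L\<^sup>2 * W x)"
      unfolding real_norm_def by (rule AE_I2)
  qed simp
  have "expectation (\<lambda>x. exp (- ell * F x)) \<le> expectation (\<lambda>x. 1 - ell * F x + 64 * ell\<^sup>2 * L\<^sup>2 * W x)"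
    by (rule integral_mono[OF intexp _ pt]) (use intF intW in auto)
  also have "\<dots> = 1 - ell * expectation F + 64 * ell\<^sup>2 * L\<^sup>2 * expectation W"
    using intF intW by (simp add: prob_space)
  also have "\<dots> \<le> 1 - ell * (2 * \<tau>) + 64 * ell\<^sup>2 * L\<^sup>2 * 2"
    using mean EW l0 by (intro add_mono diff_mono mult_left_mono) auto
  \<comment> \<open>By the choice of \<open>ell\<close>, \<open>ell * L^2 = \<tau> / 256\<close>, so
    this term equals \<open>ell * \<tau> / 2\<close>.\<close>
  also have "64 * ell\<^sup>2 * L\<^sup>2 * 2 = 128 * ell * (ell * L\<^sup>2)" by (simp add: power2_eq_square)
  also have "1 - ell * (2 * \<tau>) + 128 * ell * (ell * L\<^sup>2) \<le> 1 + - ell * \<tau>"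
    unfolding lL using l0 \<tau> by (simp add: algebra_simps)
  also have "\<dots> \<le> exp (- ell * \<tau>)" by (rule exp_ge_add_one_self)
  finally show ?thesis
    unfolding ell_def[symmetric]
    by (subst nn_integral_eq_integral[OF intexp]) (auto intro: ennreal_leI)
qed

section \<open>Independent columns and the union bound\<close>

definition col :: "nat \<Rightarrow> (nat \<times> nat \<Rightarrow> real) \<Rightarrow> nat \<Rightarrow> nat \<Rightarrow> real" where
  "col m X k = (\<lambda>i\<in>{..<Suc m}. X (i, k))"

lemma measurable_col:
  assumes "k < p"
  shows "(\<lambda>X. col m X k) \<in> measurable (BG_matrix (Suc m) p \<theta>) (colM m \<theta>)"
  unfolding BG_matrix_def colM_def col_def
  using assms by (intro measurable_restrict measurable_component_singleton) auto

lemma prob_space_BG_matrix: "prob_space (BG_matrix n p \<theta>)"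
  unfolding BG_matrix_def by (intro prob_space_PiM prob_space_BG)

text \<open>Independence of the columns in product form. Induction on \<open>p\<close> splits the
  index set into the first columns and the last one; \<open>col\<close> restricts to
  \<open>{..<Suc m}\<close> so that its values are points of the product space of
  \<open>colM\<close>.\<close>

lemma nn_integral_prod_col:
  assumes G: "G \<in> borel_measurable (colM m \<theta>)"
  shows "(\<integral>\<^sup>+X. (\<Prod>k<p. G (col m X k)) \<partial>BG_matrix (Suc m) p \<theta>) = (\<integral>\<^sup>+x. G x \<partial>colM m \<theta>) ^ p"
proof (induction p)
  case 0
  show ?case by (simp add: BG_matrix_def PiM_empty)
next
  case (Suc p)
  interpret product_sigma_finite "\<lambda>_::nat \<times> nat. BG \<theta>" by (rule product_sigma_finite_BG)
  let ?I = "{..<Suc m} \<times> {..<p}" and ?J = "{..<Suc m} \<times> {p}" and ?M = "\<lambda>_::nat \<times> nat. BG \<theta>"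
  have IJ: "{..<Suc m} \<times> {..<Suc p} = ?I \<union> ?J" by auto
  have mJ: "(\<lambda>Y. col m Y p) \<in> measurable (PiM ?J ?M) (colM m \<theta>)"
    unfolding colM_def col_def by (intro measurable_restrict measurable_component_singleton) auto
  have dJ: "distr (PiM ?J ?M) (colM m \<theta>) (\<lambda>Y. col m Y p) = colM m \<theta>"
    unfolding colM_def col_def
    by (intro distr_PiM_reindex[where f="\<lambda>i. (i, p)"] prob_space_BG) (auto simp: inj_on_def)
  have mI: "(\<lambda>X. \<Prod>k<p. G (col m X k)) \<in> borel_measurable (PiM ?I ?M)"
    using measurable_col[of _ p m \<theta>] G unfolding BG_matrix_def
    by (intro borel_measurable_prod_ennreal) (auto intro: measurable_compose)
  have f: "(\<lambda>X. \<Prod>k<Suc p. G (col m X k)) \<in> borel_measurable (PiM (?I \<union> ?J) ?M)"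
    using measurable_col[of _ "Suc p" m \<theta>] G unfolding BG_matrix_def IJ[symmetric]
    by (intro borel_measurable_prod_ennreal) (auto intro: measurable_compose)
  have "(\<integral>\<^sup>+X. (\<Prod>k<Suc p. G (col m X k)) \<partial>BG_matrix (Suc m) (Suc p) \<theta>)
      = (\<integral>\<^sup>+x. \<integral>\<^sup>+y. (\<Prod>k<Suc p. G (col m (merge ?I ?J (x, y)) k)) \<partial>PiM ?J ?M \<partial>PiM ?I ?M)"
    unfolding BG_matrix_def IJ using f by (intro product_nn_integral_fold) auto
  also have "\<dots> = (\<integral>\<^sup>+x. \<integral>\<^sup>+y. (\<Prod>k<p. G (col m x k)) * G (col m y p) \<partial>PiM ?J ?M \<partial>PiM ?I ?M)"
  proof -
    have "col m (merge ?I ?J (x, y)) k = col m x k" if "k < p" for x y k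
      using that unfolding col_def by (intro restrict_ext) (auto simp: merge_def)
    moreover have "col m (merge ?I ?J (x, y)) p = col m y p" for x y
      unfolding col_def by (intro restrict_ext) (auto simp: merge_def)
    ultimately show ?thesis by simp
  qed
  also have "\<dots> = (\<integral>\<^sup>+x. (\<Prod>k<p. G (col m x k)) * (\<integral>\<^sup>+y. G (col m y p) \<partial>PiM ?J ?M) \<partial>PiM ?I ?M)"
    using measurable_compose[OF mJ G] by (simp add: nn_integral_cmult)
  also have "(\<integral>\<^sup>+y. G (col m y p) \<partial>PiM ?J ?M) = (\<integral>\<^sup>+x. G x \<partial>colM m \<theta>)"
    using nn_integral_distr[OF mJ, of G] G unfolding dJ by (simp only: dJ)
  also have "(\<integral>\<^sup>+x. (\<Prod>k<p. G (col m x k)) * (\<integral>\<^sup>+x. G x \<partial>colM m \<theta>) \<partial>PiM ?I ?M)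
     = (\<integral>\<^sup>+x. G x \<partial>colM m \<theta>) ^ p * (\<integral>\<^sup>+x. G x \<partial>colM m \<theta>)"
    using Suc.IH unfolding nn_integral_multc[OF mI] BG_matrix_def by (simp only:)
  finally show ?case by (simp add: mult.commute)
qed

text \<open>Markov's inequality for the exponential of \<open>- ell\<close> times the sum. Asking
  only for \<open>\<tau> / 2\<close> per column leaves \<open>ell * \<tau> / 2\<close> per column in
  the exponent.\<close>

lemma column_sum_tail:
  fixes F :: "(nat \<Rightarrow> real) \<Rightarrow> real"
  assumes F: "F \<in> borel_measurable (colM m \<theta>)" and ell: "ell > 0"
    and mgf: "(\<integral>\<^sup>+x. ennreal (exp (- ell * F x)) \<partial>colM m \<theta>) \<le> ennreal (exp (- ell * \<tau>))"
  shows "{X \<in> space (BG_matrix (Suc m) p \<theta>). (\<Sum>k<p. F (col m X k)) < real p * \<tau> / 2} \<in> sets (BG_matrix (Suc m) p \<theta>)" (is "?S \<in> _")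
    and "emeasure (BG_matrix (Suc m) p \<theta>) {X \<in> space (BG_matrix (Suc m) p \<theta>). (\<Sum>k<p. F (col m X k)) < real p * \<tau> / 2}
      \<le> ennreal (exp (- (real p * (ell * \<tau> / 2))))"
proof -
  let ?M = "BG_matrix (Suc m) p \<theta>"
  have [measurable]: "(\<lambda>X. F (col m X k)) \<in> borel_measurable ?M" if "k < p" for k
    using measurable_col[OF that] F by (rule measurable_compose)
  have [measurable]: "(\<lambda>X. \<Sum>k<p. F (col m X k)) \<in> borel_measurable ?M"
    by (intro borel_measurable_sum) auto
  show S: "?S \<in> sets ?M" by measurable
  let ?c = "exp (ell * (real p * \<tau> / 2))"
  have "emeasure ?M ?S = (\<integral>\<^sup>+X. indicator ?S X \<partial>?M)" using S by simp
  also have "\<dots> \<le> (\<integral>\<^sup>+X. ennreal ?c * (\<Prod>k<p. ennreal (exp (- ell * F (col m X k)))) \<partial>?M)"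
  proof (rule nn_integral_mono)
    fix X
    show "indicator ?S X \<le> ennreal ?c * (\<Prod>k<p. ennreal (exp (- ell * F (col m X k))))"
    proof (cases "X \<in> ?S")
      case True
      have "ennreal ?c * (\<Prod>k<p. ennreal (exp (- ell * F (col m X k)))) = ennreal (?c * (\<Prod>k<p. exp (- ell * F (col m X k))))"
        by (simp add: prod_ennreal ennreal_mult prod_nonneg)
      also have "?c * (\<Prod>k<p. exp (- ell * F (col m X k))) = exp (ell * (real p * \<tau> / 2 - (\<Sum>k<p. F (col m X k))))"
        by (simp add: exp_sum[symmetric] exp_add[symmetric] sum_distrib_left sum_negf algebra_simps)
      finally have eq: "ennreal ?c * (\<Prod>k<p. ennreal (exp (- ell * F (col m X k))))
          = ennreal (exp (ell * (real p * \<tau> / 2 - (\<Sum>k<p. F (col m X k)))))" .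
      have "exp (ell * (real p * \<tau> / 2 - (\<Sum>k<p. F (col m X k)))) \<ge> 1" using True ell by simp
      then show ?thesis using True unfolding eq by simp
    qed simp
  qed
  also have "\<dots> = ennreal ?c * (\<integral>\<^sup>+X. (\<Prod>k<p. ennreal (exp (- ell * F (col m X k)))) \<partial>?M)"
    by (rule nn_integral_cmult) simp
  also have "\<dots> = ennreal ?c * (\<integral>\<^sup>+x. ennreal (exp (- ell * F x)) \<partial>colM m \<theta>) ^ p"
    using F by (subst nn_integral_prod_col[of "\<lambda>x. ennreal (exp (- ell * F x))"]) auto
  also have "\<dots> \<le> ennreal ?c * ennreal (exp (- ell * \<tau>)) ^ p"
    using mgf by (intro mult_left_mono power_mono) auto
  also have "\<dots> = ennreal (exp (- (real p * (ell * \<tau> / 2))))"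
    by (simp add: ennreal_power ennreal_mult[symmetric] exp_of_nat_mult[symmetric] exp_add[symmetric] algebra_simps)
  finally show "emeasure ?M ?S \<le> ennreal (exp (- (real p * (ell * \<tau> / 2))))" .
qed

text \<open>
  The concentration exponent depends on \<open>F\<close> only through \<open>\<tau> / L\<close>, so the growth constant \<open>L\<close> is hidden
  and \<open>\<rho>\<close> records a lower bound of this ratio.
\<close>

definition good_family :: "nat \<Rightarrow> real \<Rightarrow> real \<Rightarrow> ((nat \<Rightarrow> real) \<Rightarrow> real) \<Rightarrow> real \<Rightarrow> bool" where
  "good_family m \<theta> \<rho> F \<tau> \<longleftrightarrow> F \<in> borel_measurable (colM m \<theta>) \<and> \<tau> > 0 \<and>
     (\<exists>L A B. A \<in> borel_measurable (colM m \<theta>) \<and> B \<in> borel_measurable (colM m \<theta>) \<and>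
       (\<forall>x. \<bar>F x\<bar> \<le> L * (1 + ((A x)\<^sup>2 + (B x)\<^sup>2) / 2)) \<and>
       (\<integral>\<^sup>+x. ennreal (exp ((A x)\<^sup>2 / 4)) \<partial>colM m \<theta>) \<le> ennreal (sqrt 2) \<and>
       (\<integral>\<^sup>+x. ennreal (exp ((B x)\<^sup>2 / 4)) \<partial>colM m \<theta>) \<le> ennreal (sqrt 2) \<and>
       \<tau> \<le> L \<and> \<rho> * L \<le> \<tau> \<and> (\<integral>x. F x \<partial>colM m \<theta>) \<ge> 2 * \<tau>)"

text \<open>With the rate \<open>\<tau> / (256 * L^2)\<close> the exponent per column is
  \<open>\<tau>^2 / (512 * L^2)\<close>, hence at least \<open>\<rho>^2 / 512\<close>. Members may
  have different \<open>L\<close> and \<tau> as long as their ratio is bounded below.\<close>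

lemma good_family_union_tail:
  assumes "finite I" and \<rho>: "\<rho> > 0" and good: "\<And>\<iota>. \<iota> \<in> I \<Longrightarrow> good_family m \<theta> \<rho> (F \<iota>) (\<tau> \<iota>)"
  shows "{X \<in> space (BG_matrix (Suc m) p \<theta>). \<exists>\<iota>\<in>I. (\<Sum>k<p. F \<iota> (col m X k)) < real p * \<tau> \<iota> / 2} \<in> sets (BG_matrix (Suc m) p \<theta>)"
      (is "?S \<in> _")
    and "measure (BG_matrix (Suc m) p \<theta>)
       {X \<in> space (BG_matrix (Suc m) p \<theta>). \<exists>\<iota>\<in>I. (\<Sum>k<p. F \<iota> (col m X k)) < real p * \<tau> \<iota> / 2}
      \<le> real (card I) * exp (- (real p * (\<rho>\<^sup>2 / 512)))"
proof -
  let ?M = "BG_matrix (Suc m) p \<theta>"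
  interpret M: prob_space ?M by (rule prob_space_BG_matrix)
  interpret C: prob_space "colM m \<theta>" by (rule prob_space_colM)
  define E where "E \<iota> = {X \<in> space ?M. (\<Sum>k<p. F \<iota> (col m X k)) < real p * \<tau> \<iota> / 2}" for \<iota>
  have one: "E \<iota> \<in> sets ?M \<and> measure ?M (E \<iota>) \<le> exp (- (real p * (\<rho>\<^sup>2 / 512)))" if i: "\<iota> \<in> I" for \<iota>
  proof -
    from good[OF i] obtain L A B where
      g: "F \<iota> \<in> borel_measurable (colM m \<theta>)" "\<tau> \<iota> > 0"
       "A \<in> borel_measurable (colM m \<theta>)" "B \<in> borel_measurable (colM m \<theta>)"
       "\<And>x. \<bar>F \<iota> x\<bar> \<le> L * (1 + ((A x)\<^sup>2 + (B x)\<^sup>2) / 2)"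
       "(\<integral>\<^sup>+x. ennreal (exp ((A x)\<^sup>2 / 4)) \<partial>colM m \<theta>) \<le> ennreal (sqrt 2)"
       "(\<integral>\<^sup>+x. ennreal (exp ((B x)\<^sup>2 / 4)) \<partial>colM m \<theta>) \<le> ennreal (sqrt 2)"
       "\<tau> \<iota> \<le> L" "\<rho> * L \<le> \<tau> \<iota>" "(\<integral>x. F \<iota> x \<partial>colM m \<theta>) \<ge> 2 * \<tau> \<iota>"
      unfolding good_family_def by blast
    define ell where "ell = \<tau> \<iota> / (256 * L\<^sup>2)"
    have L: "L > 0" using g by simp
    then have l: "ell > 0" using g by (simp add: ell_def)
    have mgf: "(\<integral>\<^sup>+x. ennreal (exp (- ell * F \<iota> x)) \<partial>colM m \<theta>) \<le> ennreal (exp (- ell * \<tau> \<iota>))"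
      unfolding ell_def by (rule C.quadratic_growth_mgf[OF g(1) g(3-7) g(2) g(8) g(10)])
    have "(\<rho> * L)\<^sup>2 \<le> (\<tau> \<iota>)\<^sup>2" using g(9) \<rho> L by (intro power_mono) auto
    then have "\<rho>\<^sup>2 \<le> (\<tau> \<iota>)\<^sup>2 / L\<^sup>2" using L by (simp add: field_simps power_mult_distrib)
    also have "\<dots> = 256 * (ell * \<tau> \<iota>)" using L by (simp add: ell_def power2_eq_square)
    finally have "\<rho>\<^sup>2 / 512 \<le> ell * \<tau> \<iota> / 2" by simp
    then have "exp (- (real p * (ell * \<tau> \<iota> / 2))) \<le> exp (- (real p * (\<rho>\<^sup>2 / 512)))"
      using mult_left_mono[of "\<rho>\<^sup>2 / 512" "ell * \<tau> \<iota> / 2" "real p"] by simp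
    moreover have "emeasure ?M (E \<iota>) \<le> ennreal (exp (- (real p * (ell * \<tau> \<iota> / 2))))"
      unfolding E_def by (rule column_sum_tail(2)[OF g(1) l mgf])
    then have "measure ?M (E \<iota>) \<le> exp (- (real p * (ell * \<tau> \<iota> / 2)))"
      by (simp add: M.emeasure_eq_measure)
    moreover have "E \<iota> \<in> sets ?M"
      unfolding E_def by (rule column_sum_tail(1)[OF g(1) l mgf])
    ultimately show ?thesis
      by (meson order_trans)
  qed
  have S: "?S = (\<Union>\<iota>\<in>I. E \<iota>)" by (auto simp: E_def)
  show "?S \<in> sets ?M" unfolding S using one assms(1) by (intro sets.finite_UN) auto
  have "measure ?M ?S \<le> (\<Sum>\<iota>\<in>I. measure ?M (E \<iota>))"
    unfolding S using one assms(1) by (intro M.finite_measure_subadditive_finite) auto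
  also have "\<dots> \<le> (\<Sum>\<iota>\<in>I. exp (- (real p * (\<rho>\<^sup>2 / 512))))" using one by (intro sum_mono) auto
  finally show "measure ?M ?S \<le> real (card I) * exp (- (real p * (\<rho>\<^sup>2 / 512)))" by simp
qed

section \<open>The convex and the gradient region in expectation\<close>

lemma abs_tanh_less_1: "\<bar>tanh x\<bar> < 1" for x :: real
  using tanh_real_lt_1[of x] tanh_real_gt_neg1[of x] by linarith

lemma tanh_diff_le:
  fixes a b :: real
  shows "\<bar>tanh a - tanh b\<bar> \<le> \<bar>a - b\<bar>"
proof -
  have *: "\<bar>tanh a - tanh b\<bar> \<le> \<bar>a - b\<bar>" if "a < b" for a b :: real
  proof -
    have "\<exists>z>a. z < b \<and> tanh b - tanh a = (b - a) * (1 - (tanh z)\<^sup>2)"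
      by (rule MVT2[OF that]) (auto intro!: derivative_eq_intros)
    then obtain z where z: "tanh b - tanh a = (b - a) * (1 - (tanh z)\<^sup>2)" by blast
    have "(tanh z)\<^sup>2 \<le> 1" using abs_tanh_less_1[of z] by (simp add: abs_square_le_1)
    then have "\<bar>1 - (tanh z)\<^sup>2\<bar> \<le> 1" by simp
    then have "\<bar>(b - a) * (1 - (tanh z)\<^sup>2)\<bar> \<le> \<bar>b - a\<bar>"
      unfolding abs_mult by (rule mult_left_le) simp
    then show ?thesis using z by linarith
  qed
  show ?thesis
    using *[of a b] *[of b a] by (cases a b rule: linorder_cases) auto
qed

lemma abs_tanh_le: "\<bar>tanh x\<bar> \<le> \<bar>x\<bar>" for x :: real
  using tanh_diff_le[of x 0] by simp

lemma tanh_sq_le: "(tanh x)\<^sup>2 \<le> x\<^sup>2" for x :: real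
  using abs_tanh_le[of x] by (simp add: abs_le_square_iff)

lemma tanh_sq_le_1: "(tanh x)\<^sup>2 \<le> 1" for x :: real
  using abs_tanh_less_1[of x] by (simp add: abs_square_le_1)

lemma abs_tanh_mult_le: "\<bar>tanh x * y\<bar> \<le> \<bar>y\<bar>" for x y :: real
  using mult_right_mono[of "\<bar>tanh x\<bar>" 1 "\<bar>y\<bar>"] abs_tanh_less_1[of x] by (simp add: abs_mult)

text \<open>With \<open>E = exp (- (2 * t))\<close> and tanh t = (1 - E) / (1 + E), the claim is
  \<open>E * (1 + 2 * t) \<le> 1\<close> after clearing denominators.\<close>

lemma tanh_ge_hyperbola:
  fixes t :: real
  assumes "t \<ge> 0"
  shows "tanh t \<ge> t / (1 + t)"
proof -
  have "1 + 2 * t \<le> exp (2 * t)" by (rule exp_ge_add_one_self)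
  then have "exp (- (2 * t)) * (1 + 2 * t) \<le> exp (- (2 * t)) * exp (2 * t)"
    by (intro mult_left_mono) auto
  then have e: "exp (- (2 * t)) * (1 + 2 * t) \<le> 1" by (simp add: exp_add[symmetric])
  define E where "E = exp (- (2 * t))"
  have E0: "E > 0" by (simp add: E_def)
  have "t * (1 + E) \<le> (1 - E) * (1 + t)"
    using e unfolding E_def[symmetric] by (simp add: algebra_simps)
  then have "t / (1 + t) \<le> (1 - E) / (1 + E)"
    using assms E0 by (simp add: divide_le_eq pos_le_divide_eq)
  then show ?thesis by (simp add: tanh_real_altdef E_def)
qed

text \<open>A polynomial minorant, so that second and fourth moments bound the expectation.
  \<open>D\<close> is a truncation level: below it the hyperbola bound applies, above it the
  right-hand side is not positive.\<close>

lemma mult_tanh_ge: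
  fixes s \<mu> D :: real
  assumes "\<mu> > 0" "D > 0"
  shows "s * tanh (s / \<mu>) \<ge> (s\<^sup>2 - s ^ 4 / D\<^sup>2) / (\<mu> + D)"
proof (cases "\<bar>s\<bar> \<le> D")
  case True
  have sym: "s * tanh (s / \<mu>) = \<bar>s\<bar> * tanh (\<bar>s\<bar> / \<mu>)"
    by (cases "s \<ge> 0") auto
  have "(\<bar>s\<bar> / \<mu>) / (1 + \<bar>s\<bar> / \<mu>) \<le> tanh (\<bar>s\<bar> / \<mu>)"
    using assms by (intro tanh_ge_hyperbola) simp
  also have "(\<bar>s\<bar> / \<mu>) / (1 + \<bar>s\<bar> / \<mu>) = \<bar>s\<bar> / (\<mu> + \<bar>s\<bar>)"
    using assms by (simp add: divide_simps add_pos_nonneg)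
  finally have "\<bar>s\<bar> * (\<bar>s\<bar> / (\<mu> + \<bar>s\<bar>)) \<le> s * tanh (s / \<mu>)"
    unfolding sym by (intro mult_left_mono) auto
  moreover have "s\<^sup>2 / (\<mu> + D) \<le> \<bar>s\<bar> * (\<bar>s\<bar> / (\<mu> + \<bar>s\<bar>))"
    using True assms by (simp add: power2_eq_square) (intro divide_left_mono mult_pos_pos; simp add: add_pos_nonneg)
  moreover have "(s\<^sup>2 - s ^ 4 / D\<^sup>2) / (\<mu> + D) \<le> s\<^sup>2 / (\<mu> + D)"
    using assms by (intro divide_right_mono) auto
  ultimately show ?thesis by linarith
next
  case False
  then have "D\<^sup>2 \<le> s\<^sup>2" using assms by (simp add: abs_le_square_iff[symmetric])
  then have "s\<^sup>2 * D\<^sup>2 \<le> s\<^sup>2 * s\<^sup>2" by (intro mult_left_mono) auto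
  then have "s\<^sup>2 \<le> s ^ 4 / D\<^sup>2"
    using assms by (simp add: pos_le_divide_eq power2_eq_square power4_eq_xxxx mult.assoc)
  then have "(s\<^sup>2 - s ^ 4 / D\<^sup>2) / (\<mu> + D) \<le> 0"
    using assms by (intro divide_nonpos_pos) auto
  moreover have "s * tanh (s / \<mu>) \<ge> 0"
    using assms by (cases "s \<ge> 0") (auto simp: zero_le_mult_iff zero_le_divide_iff divide_le_0_iff)
  ultimately show ?thesis by linarith
qed

text \<open>On these columns \<open>qarg\<close> is just \<open>dotp m w x\<close>, a pure linear
  form, so expectations reduce to moments.\<close>

definition last0 :: "nat \<Rightarrow> (nat \<Rightarrow> real) \<Rightarrow> real" where
  "last0 m x = indicator {0} (x m)"

lemma measurable_last0 [measurable]: "last0 m \<in> borel_measurable (colM m \<theta>)"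
  unfolding last0_def by measurable

lemma colM_last0_moments:
  assumes \<theta>: "0 \<le> \<theta>" "\<theta> \<le> 1"
  shows "integrable (colM m \<theta>) (\<lambda>x. last0 m x * (dotp m a x)\<^sup>2)"
    and "(\<integral>x. last0 m x * (dotp m a x)\<^sup>2 \<partial>colM m \<theta>) = (1 - \<theta>) * (\<theta> * dotp m a a)"
    and "integrable (colM m \<theta>) (\<lambda>x. last0 m x * (dotp m a x) ^ 4)"
    and "(\<integral>x. last0 m x * (dotp m a x) ^ 4 \<partial>colM m \<theta>) \<le> (1 - \<theta>) * (3 * \<theta> * (dotp m a a)\<^sup>2)"
proof -
  have conv: "(\<integral>\<^sup>+x. ennreal (last0 m x * \<psi> (dotp m a x)) \<partial>colM m \<theta>)
      = ennreal (1 - \<theta>) * (\<integral>\<^sup>+x. ennreal (\<psi> (dotp m a x)) \<partial>colM m \<theta>)"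
    if [measurable]: "\<psi> \<in> borel_measurable borel" for \<psi> :: "real \<Rightarrow> real"
  proof -
    have "(\<integral>\<^sup>+x. ennreal (last0 m x * \<psi> (dotp m a x)) \<partial>colM m \<theta>)
      = (\<integral>\<^sup>+x. ennreal (\<psi> (dotp m a x)) * indicator {0} (x m) \<partial>colM m \<theta>)"
      by (intro nn_integral_cong) (auto simp: last0_def indicator_def)
    also have "\<dots> = ennreal (1 - \<theta>) * (\<integral>\<^sup>+x. ennreal (\<psi> (dotp m a x)) \<partial>colM m \<theta>)"
      by (rule nn_integral_colM_last_zero[OF \<theta>]) measurable
    finally show ?thesis .
  qed
  have 2: "(\<integral>\<^sup>+x. ennreal (last0 m x * (dotp m a x)\<^sup>2) \<partial>colM m \<theta>) = ennreal ((1 - \<theta>) * (\<theta> * dotp m a a))"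
    using conv[of "\<lambda>t. t\<^sup>2"] \<theta> by (simp add: nn_integral_colM_sq ennreal_mult)
  have 4: "(\<integral>\<^sup>+x. ennreal (last0 m x * (dotp m a x) ^ 4) \<partial>colM m \<theta>) \<le> ennreal ((1 - \<theta>) * (3 * \<theta> * (dotp m a a)\<^sup>2))"
  proof -
    have "(\<integral>\<^sup>+x. ennreal (last0 m x * (dotp m a x) ^ 4) \<partial>colM m \<theta>) \<le> ennreal (1 - \<theta>) * ennreal (3 * \<theta> * (dotp m a a)\<^sup>2)"
      using conv[of "\<lambda>t. t ^ 4"] nn_integral_colM_pow4[OF \<theta>, of m a] by (simp add: mult_left_mono)
    then show ?thesis using \<theta> by (simp add: ennreal_mult)
  qed
  have nn: "0 \<le> last0 m x * (dotp m a x)\<^sup>2" "0 \<le> last0 m x * (dotp m a x) ^ 4" for x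
    by (auto simp: last0_def indicator_def)
  have hb: "has_bochner_integral (colM m \<theta>) (\<lambda>x. last0 m x * (dotp m a x)\<^sup>2) ((1 - \<theta>) * (\<theta> * dotp m a a))"
    by (rule has_bochner_integral_nn_integral) (use nn \<theta> 2 in auto)
  then show "integrable (colM m \<theta>) (\<lambda>x. last0 m x * (dotp m a x)\<^sup>2)"
    "(\<integral>x. last0 m x * (dotp m a x)\<^sup>2 \<partial>colM m \<theta>) = (1 - \<theta>) * (\<theta> * dotp m a a)"
    by (auto simp: has_bochner_integral_iff)
  show int4: "integrable (colM m \<theta>) (\<lambda>x. last0 m x * (dotp m a x) ^ 4)"
    by (rule integrableI_nonneg) (use nn 4 in \<open>auto elim: order.strict_trans1\<close>)
  show "(\<integral>x. last0 m x * (dotp m a x) ^ 4 \<partial>colM m \<theta>) \<le> (1 - \<theta>) * (3 * \<theta> * (dotp m a a)\<^sup>2)"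
    using 4 \<theta> nn by (subst (asm) nn_integral_eq_integral[OF int4]) auto
qed

lemma colM_last_abs:
  assumes \<theta>: "0 \<le> \<theta>" "\<theta> \<le> 1"
  shows "integrable (colM m \<theta>) (\<lambda>x. \<bar>x m\<bar>)" "(\<integral>x. \<bar>x m\<bar> \<partial>colM m \<theta>) \<le> \<theta>"
proof -
  have "(\<integral>\<^sup>+x. ennreal \<bar>x m\<bar> \<partial>colM m \<theta>) = ennreal \<theta> * (\<integral>\<^sup>+x. ennreal \<bar>x\<bar> \<partial>stdN)"
    using \<theta> by (simp add: nn_integral_colM_component[of "\<lambda>t. ennreal \<bar>t\<bar>" m m] nn_integral_BG)
  also have "\<dots> \<le> ennreal \<theta> * 1" by (intro mult_left_mono nn_integral_stdN_abs) auto
  finally have le: "(\<integral>\<^sup>+x. ennreal \<bar>x m\<bar> \<partial>colM m \<theta>) \<le> ennreal \<theta>" by simp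
  show int: "integrable (colM m \<theta>) (\<lambda>x. \<bar>x m\<bar>)"
    by (rule integrableI_nonneg) (use le in \<open>auto elim: order.strict_trans1\<close>)
  show "(\<integral>x. \<bar>x m\<bar> \<partial>colM m \<theta>) \<le> \<theta>"
    using le \<theta> by (subst (asm) nn_integral_eq_integral[OF int]) auto
qed

lemma colM_dotp_abs_integrable:
  assumes \<theta>: "0 \<le> \<theta>" "\<theta> \<le> 1"
  shows "integrable (colM m \<theta>) (\<lambda>x. (dotp m a x)\<^sup>2)" "integrable (colM m \<theta>) (\<lambda>x. \<bar>dotp m a x\<bar>)"
proof -
  interpret C: prob_space "colM m \<theta>" by (rule prob_space_colM)
  show int: "integrable (colM m \<theta>) (\<lambda>x. (dotp m a x)\<^sup>2)"
    by (rule integrableI_nonneg) (auto simp: nn_integral_colM_sq[OF \<theta>])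
  show "integrable (colM m \<theta>) (\<lambda>x. \<bar>dotp m a x\<bar>)"
  proof (rule Bochner_Integration.integrable_bound)
    show "integrable (colM m \<theta>) (\<lambda>x. 1 + (dotp m a x)\<^sup>2)" using int by simp
    have "\<bar>t\<bar> \<le> \<bar>1 + t\<^sup>2\<bar>" for t :: real
      using zero_le_power2[of "\<bar>t\<bar> - 1"] by (simp add: power2_diff)
    then show "AE x in colM m \<theta>. norm \<bar>dotp m a x\<bar> \<le> norm (1 + (dotp m a x)\<^sup>2)"
      unfolding real_norm_def by (simp del: abs_idempotent add: AE_I2)
  qed simp
qed

lemma nn_integral_colM_exp_last:
  assumes "0 \<le> \<theta>" "\<theta> \<le> 1" "i \<le> m"
  shows "(\<integral>\<^sup>+x. ennreal (exp ((x i)\<^sup>2 / 4)) \<partial>colM m \<theta>) \<le> ennreal (sqrt 2)"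
  using nn_integral_colM_component[of "\<lambda>t. ennreal (exp (t\<^sup>2 / 4))" i m \<theta>] nn_integral_BG_exp[of \<theta>] assms
  by simp

lemma measurable_qarg [measurable]: "qarg m w \<in> borel_measurable (colM m \<theta>)"
  unfolding qarg_def by measurable

lemma measurable_GF [measurable]: "GF m \<mu> w v \<in> borel_measurable (colM m \<theta>)"
  unfolding GF_def tanh_real_altdef by measurable

lemma measurable_HB [measurable]: "HB m \<mu> w u v \<in> borel_measurable (colM m \<theta>)"
  unfolding HB_def tanh_real_altdef by measurable

lemma abs_le_half_sq: "\<bar>t\<bar> \<le> (1 + t\<^sup>2) / 2" for t :: real
  using zero_le_power2[of "\<bar>t\<bar> - 1"] by (simp add: power2_diff)

lemma dotp_sq_le: "(dotp m w v)\<^sup>2 \<le> dotp m w w * dotp m v v"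
proof -
  have "(dotp m w v)\<^sup>2 \<le> (vnorm m w * vnorm m v)\<^sup>2"
    using dotp_Cauchy_Schwarz[of m w v] power_mono[of "\<bar>dotp m w v\<bar>" _ 2] by fastforce
  then show ?thesis by (simp add: power_mult_distrib vnorm_sq)
qed

lemma colM_integrable_quadratic_growth:
  fixes F :: "(nat \<Rightarrow> real) \<Rightarrow> real"
  assumes \<theta>: "0 \<le> \<theta>" "\<theta> \<le> 1" and [measurable]: "F \<in> borel_measurable (colM m \<theta>)"
    and bound: "\<And>x. \<bar>F x\<bar> \<le> L * (1 + ((dotp m a x)\<^sup>2 + (x m)\<^sup>2) / 2)"
  shows "integrable (colM m \<theta>) F"
proof (rule Bochner_Integration.integrable_bound)
  interpret C: prob_space "colM m \<theta>" by (rule prob_space_colM)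
  have "(\<integral>\<^sup>+x. ennreal ((x m)\<^sup>2) \<partial>colM m \<theta>) = ennreal \<theta>"
    using \<theta> by (simp add: nn_integral_colM_component[where f="\<lambda>t. ennreal (t\<^sup>2)"] nn_integral_BG nn_integral_stdN_sq)
  then have "integrable (colM m \<theta>) (\<lambda>x. (x m)\<^sup>2)" by (intro integrableI_nonneg) auto
  then show "integrable (colM m \<theta>) (\<lambda>x. L * (1 + ((dotp m a x)\<^sup>2 + (x m)\<^sup>2) / 2))"
    using colM_dotp_abs_integrable(1)[OF \<theta>, of m a] by simp
  have "\<bar>F x\<bar> \<le> \<bar>L * (1 + ((dotp m a x)\<^sup>2 + (x m)\<^sup>2) / 2)\<bar>" for x
    using bound[of x] by linarith
  then show "AE x in colM m \<theta>. norm (F x) \<le> norm (L * (1 + ((dotp m a x)\<^sup>2 + (x m)\<^sup>2) / 2))"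
    unfolding real_norm_def by (rule AE_I2)
qed simp

text \<open>The factor \<mu> makes the growth constant absolute, namely 6, whence \<rho> is at most
  (\<theta> / 64) / 6. Columns with nonzero last entry contribute a nonnegative square, up to an
  error \<open>2 * \<mu> * \<bar>x m\<bar>\<close>. The lower bound 1/4 on the squared norm of
  \<open>v\<close> leaves room for rounding unit vectors.\<close>

lemma good_family_hessian_near_0:
  assumes \<theta>: "0 < \<theta>" "\<theta> < 1 / 2" and \<mu>: "0 < \<mu>" "\<mu> \<le> 1 / 64"
    and w: "dotp m w w \<le> \<mu>\<^sup>2 / 32" and v: "1 / 4 \<le> dotp m v v" "dotp m v v \<le> 1" and \<rho>: "\<rho> \<le> \<theta> / 384"
  shows "good_family m \<theta> \<rho> (\<lambda>x. \<mu> * HB m \<mu> w v v x) (\<theta> / 64)"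
proof -
  define q where "q = lastq m w"
  define \<beta> where "\<beta> = dotp m w v"
  define s where "s x = qarg m w x" for x
  define A where "A x = dotp m v x" for x
  have [measurable]: "A \<in> borel_measurable (colM m \<theta>)" unfolding A_def by measurable
  have mu2: "\<mu>\<^sup>2 \<le> 1" using \<mu> by (simp add: power_le_one)
  have q2: "q\<^sup>2 = 1 - dotp m w w" "q \<ge> 0" using w mu2 by (auto simp: q_def lastq_def)
  then have q2': "q\<^sup>2 \<ge> 31 / 32" using w mu2 by simp
  have qpos: "q > 0" using q2' q2(2) by (cases "q = 0") auto
  have qlow: "q \<ge> 15 / 16"
  proof (rule ccontr)
    assume "\<not> q \<ge> 15 / 16"
    then have "q\<^sup>2 < (15 / 16)\<^sup>2" using qpos by (intro power_strict_mono) auto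
    then show False using q2' by (simp add: power2_eq_square)
  qed
  have b2: "\<beta>\<^sup>2 \<le> 1 / 32"
  proof -
    have "\<beta>\<^sup>2 \<le> dotp m w w * dotp m v v" unfolding \<beta>_def by (rule dotp_sq_le)
    also have "\<dots> \<le> (\<mu>\<^sup>2 / 32) * 1" using w v by (intro mult_mono) auto
    finally show ?thesis using mu2 by simp
  qed
  have bq: "(\<beta> / q)\<^sup>2 \<le> 1"
    using b2 q2' by (simp add: power_divide divide_le_eq)
  have cf: "0 \<le> dotp m v v / q + \<beta>\<^sup>2 / q ^ 3" "dotp m v v / q + \<beta>\<^sup>2 / q ^ 3 \<le> 2"
  proof -
    show "0 \<le> dotp m v v / q + \<beta>\<^sup>2 / q ^ 3" using qpos by simp
    have "1 / q \<le> 16 / 15" using qlow qpos by (simp add: divide_le_eq)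
    moreover have "1 / q ^ 3 \<le> 2"
    proof -
      have "(15 / 16) ^ 3 \<le> q ^ 3" using qlow by (intro power_mono) auto
      then have "1 / 2 \<le> q ^ 3" by (simp add: power3_eq_cube)
      then show ?thesis using qpos by (simp add: divide_le_eq)
    qed
    moreover have "dotp m v v / q \<le> 1 / q" using v qpos by (simp add: divide_right_mono)
    moreover have "\<beta>\<^sup>2 * (1 / q ^ 3) \<le> (1 / 32) * 2"
      using b2 \<open>1 / q ^ 3 \<le> 2\<close> qpos by (intro mult_mono) auto
    ultimately show "dotp m v v / q + \<beta>\<^sup>2 / q ^ 3 \<le> 2" by simp
  qed
  define K where "K x = 1 - (tanh (s x / \<mu>))\<^sup>2" for x
  have K: "0 \<le> K x" "K x \<le> 1" for x using tanh_sq_le_1[of "s x / \<mu>"] by (auto simp: K_def)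
  define T where "T x = \<mu> * (x m * tanh (s x / \<mu>) * (dotp m v v / q + \<beta>\<^sup>2 / q ^ 3))" for x
  have F: "\<mu> * HB m \<mu> w v v x = K x * (A x - x m * \<beta> / q)\<^sup>2 - T x" for x
  proof -
    have alg: "\<mu> * (k / \<mu> * a * a - t) = k * a\<^sup>2 - \<mu> * t" for k a t
      using \<mu> by (simp add: power2_eq_square right_diff_distrib)
    show ?thesis
      unfolding HB_def K_def T_def A_def[symmetric] \<beta>_def[symmetric] q_def[symmetric] s_def[symmetric]
      by (simp only: alg power2_eq_square[of \<beta>])
  qed
  have T: "\<bar>T x\<bar> \<le> 2 * \<mu> * \<bar>x m\<bar>" for x
  proof -
    have "\<bar>x m * tanh (s x / \<mu>)\<bar> \<le> \<bar>x m\<bar>"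
      using abs_tanh_mult_le[of "s x / \<mu>" "x m"] by (simp add: mult.commute)
    then have "\<bar>x m * tanh (s x / \<mu>)\<bar> * \<bar>dotp m v v / q + \<beta>\<^sup>2 / q ^ 3\<bar> \<le> \<bar>x m\<bar> * 2"
      using cf by (intro mult_mono) auto
    then have "\<mu> * (\<bar>x m * tanh (s x / \<mu>)\<bar> * \<bar>dotp m v v / q + \<beta>\<^sup>2 / q ^ 3\<bar>) \<le> \<mu> * (\<bar>x m\<bar> * 2)"
      using \<mu> by (intro mult_left_mono) auto
    then show ?thesis using \<mu> unfolding T_def by (simp only: abs_mult abs_of_pos mult_ac)
  qed
  have bound: "\<bar>\<mu> * HB m \<mu> w v v x\<bar> \<le> 6 * (1 + ((A x)\<^sup>2 + (x m)\<^sup>2) / 2)" for x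
  proof -
    have "(A x - x m * \<beta> / q)\<^sup>2 \<le> 2 * (A x)\<^sup>2 + 2 * (x m * (\<beta> / q))\<^sup>2"
      using zero_le_power2[of "A x + x m * (\<beta> / q)"] by (simp add: power2_sum power2_diff)
    also have "(x m * (\<beta> / q))\<^sup>2 \<le> (x m)\<^sup>2 * 1"
      unfolding power_mult_distrib using bq by (intro mult_left_mono) auto
    finally have 1: "(A x - x m * \<beta> / q)\<^sup>2 \<le> 2 * (A x)\<^sup>2 + 2 * (x m)\<^sup>2" by simp
    have "K x * (A x - x m * \<beta> / q)\<^sup>2 \<le> 1 * (A x - x m * \<beta> / q)\<^sup>2" using K by (intro mult_right_mono) auto
    moreover have "0 \<le> K x * (A x - x m * \<beta> / q)\<^sup>2" using K by simp
    moreover have "2 * \<mu> * \<bar>x m\<bar> \<le> 2 * \<bar>x m\<bar>" using \<mu> by (intro mult_right_mono) auto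
    ultimately show ?thesis
      unfolding F using 1 abs_le_D1[OF T[of x]] abs_le_D2[OF T[of x]] abs_le_half_sq[of "x m"]
        zero_le_power2[of "A x"] zero_le_power2[of "x m"] by (intro abs_leI) (simp_all only: distrib_left, argo+)
  qed
  \<comment> \<open>The means of the three moment terms are 1/4, 3/64 and 3/64 in units of
    \<open>(1 - \<theta>) * \<theta>\<close>, leaving 5/32; the last term costs at most
    \<open>\<theta> / 32\<close>. What remains exceeds \<open>\<theta> / 32\<close>.\<close>
  define lower where "lower x = last0 m x * (A x)\<^sup>2 - (1 / 64) * (last0 m x * (A x) ^ 4)
      - (16 / \<mu> ^ 4) * (last0 m x * (dotp m w x) ^ 4) - 2 * \<mu> * \<bar>x m\<bar>" for x
  have low: "lower x \<le> \<mu> * HB m \<mu> w v v x" for x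
  proof (cases "x m = 0")
    case True
    define t where "t = dotp m w x / \<mu>"
    have "s x = dotp m w x" using True by (simp add: s_def qarg_def)
    then have "K x \<ge> 1 - t\<^sup>2" using tanh_sq_le[of t] by (simp add: K_def t_def)
    then have "K x * (A x)\<^sup>2 \<ge> (1 - t\<^sup>2) * (A x)\<^sup>2" by (intro mult_right_mono) auto
    \<comment> \<open>The weights 1/64 and 16 (their product is 1/4) balance the two fourth moments,
      which are of sizes 1 and \<open>\<mu> ^ 4 / 1024\<close>.\<close>
    moreover have "t\<^sup>2 * (A x)\<^sup>2 \<le> (1 / 64) * (A x) ^ 4 + 16 * t ^ 4"
      using zero_le_power2[of "(A x)\<^sup>2 / 8 - 4 * t\<^sup>2"]
      by (simp add: power2_diff power_divide power_mult_distrib power_mult[symmetric] algebra_simps)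
    moreover have "16 / \<mu> ^ 4 * (dotp m w x) ^ 4 = 16 * t ^ 4" by (simp add: t_def power_divide)
    ultimately show ?thesis
      unfolding F lower_def T_def using True by (simp add: last0_def left_diff_distrib)
  next
    case False
    then have "lower x = - 2 * \<mu> * \<bar>x m\<bar>" by (simp add: lower_def last0_def)
    moreover have "0 \<le> K x * (A x - x m * \<beta> / q)\<^sup>2" using K[of x] by simp
    ultimately show ?thesis unfolding F using abs_le_D1[OF T[of x]] by argo
  qed
  interpret C: prob_space "colM m \<theta>" by (rule prob_space_colM)
  have \<theta>': "0 \<le> \<theta>" "\<theta> \<le> 1" using \<theta> by auto
  note mA = colM_last0_moments[OF \<theta>', of m v, folded A_def, unfolded A_def[of v]] and mw = colM_last0_moments(3,4)[OF \<theta>', of m w]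
    and mx = colM_last_abs[OF \<theta>', of m]
  have intlow: "integrable (colM m \<theta>) lower"
    unfolding lower_def using mA mw mx by (intro Bochner_Integration.integrable_diff integrable_mult_right) auto
  have "(\<integral>x. lower x \<partial>colM m \<theta>) = (\<integral>x. last0 m x * (A x)\<^sup>2 \<partial>colM m \<theta>) - 1 / 64 * (\<integral>x. last0 m x * (A x) ^ 4 \<partial>colM m \<theta>)
     - 16 / \<mu> ^ 4 * (\<integral>x. last0 m x * (dotp m w x) ^ 4 \<partial>colM m \<theta>) - 2 * \<mu> * (\<integral>x. \<bar>x m\<bar> \<partial>colM m \<theta>)"
    unfolding lower_def using mA mw mx by simp
  also have "\<dots> \<ge> (1 - \<theta>) * (\<theta> * (1 / 4)) - 1 / 64 * ((1 - \<theta>) * (3 * \<theta> * 1)) - 16 / \<mu> ^ 4 * ((1 - \<theta>) * (3 * \<theta> * (\<mu>\<^sup>2 / 32)\<^sup>2)) - 2 * \<mu> * \<theta>"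
  proof (intro diff_mono mult_left_mono)
    show "(1 - \<theta>) * (\<theta> * (1 / 4)) \<le> (\<integral>x. last0 m x * (A x)\<^sup>2 \<partial>colM m \<theta>)"
      unfolding mA(2) using v \<theta> by (intro mult_left_mono) auto
    show "(\<integral>x. last0 m x * (A x) ^ 4 \<partial>colM m \<theta>) \<le> (1 - \<theta>) * (3 * \<theta> * 1)"
      using v \<theta> by (intro order_trans[OF mA(4)] mult_left_mono) (auto simp: power_le_one)
    show "(\<integral>x. last0 m x * (dotp m w x) ^ 4 \<partial>colM m \<theta>) \<le> (1 - \<theta>) * (3 * \<theta> * (\<mu>\<^sup>2 / 32)\<^sup>2)"
      using w \<theta> by (intro order_trans[OF mw(2)] mult_left_mono power_mono) auto
  qed (use mx \<mu> in auto)
  also have "16 / \<mu> ^ 4 * ((1 - \<theta>) * (3 * \<theta> * (\<mu>\<^sup>2 / 32)\<^sup>2)) = 3 / 64 * ((1 - \<theta>) * \<theta>)"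
    using \<mu> by (simp add: power_divide power_mult[symmetric])
  also have "(1 - \<theta>) * (\<theta> * (1 / 4)) - 1 / 64 * ((1 - \<theta>) * (3 * \<theta> * 1)) - 3 / 64 * ((1 - \<theta>) * \<theta>)
      = (1 - \<theta>) * \<theta> * (5 / 32)"
    by (simp add: field_simps)
  finally have "(\<integral>x. lower x \<partial>colM m \<theta>) \<ge> (1 - \<theta>) * \<theta> * (5 / 32) - 2 * \<mu> * \<theta>" .
  moreover have "(1 - \<theta>) * (\<theta> * (5 / 32)) \<ge> (1 / 2) * (\<theta> * (5 / 32))" using \<theta> by (intro mult_right_mono) auto
  moreover have "2 * \<mu> * \<theta> \<le> 2 * (1 / 64) * \<theta>" using \<mu> \<theta> by (intro mult_right_mono mult_left_mono) auto
  ultimately have Elow: "(\<integral>x. lower x \<partial>colM m \<theta>) \<ge> 2 * (\<theta> / 64)" using \<theta> by linarith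
  have expA: "(\<integral>\<^sup>+x. ennreal (exp ((A x)\<^sup>2 / 4)) \<partial>colM m \<theta>) \<le> ennreal (sqrt 2)"
    unfolding A_def by (rule nn_integral_colM_exp_dotp[OF \<theta>' v(2)])
  have exp_m: "(\<integral>\<^sup>+x. ennreal (exp ((x m)\<^sup>2 / 4)) \<partial>colM m \<theta>) \<le> ennreal (sqrt 2)"
    by (rule nn_integral_colM_exp_last[OF \<theta>']) simp
  have intF: "integrable (colM m \<theta>) (\<lambda>x. \<mu> * HB m \<mu> w v v x)"
    by (rule colM_integrable_quadratic_growth[OF \<theta>' _ bound[unfolded A_def]]) simp
  have "(\<integral>x. lower x \<partial>colM m \<theta>) \<le> (\<integral>x. \<mu> * HB m \<mu> w v v x \<partial>colM m \<theta>)"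
    by (rule integral_mono[OF intlow intF low])
  with Elow have mean: "(\<integral>x. \<mu> * HB m \<mu> w v v x \<partial>colM m \<theta>) \<ge> 2 * (\<theta> / 64)" by linarith
  show ?thesis
    unfolding good_family_def
  proof (intro conjI exI allI)
    show "\<bar>\<mu> * HB m \<mu> w v v x\<bar> \<le> 6 * (1 + ((A x)\<^sup>2 + (x m)\<^sup>2) / 2)" for x by (rule bound)
  qed (use \<theta> \<rho> expA exp_m mean in auto)
qed

text \<open>Both the mean and the growth are proportional to the radius \<open>R\<close>, so their
  ratio is free of it. The constant 6 lies slightly above \<open>4 * sqrt 2\<close>, so that rounded
  points of the shell still qualify.\<close>

lemma good_family_gradient:
  assumes \<theta>: "0 < \<theta>" "\<theta> < 1 / 2" and \<mu>: "0 < \<mu>" and R: "\<mu> \<le> 6 * vnorm m w" "dotp m w w \<le> 1 / 2000"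
    and \<rho>: "\<rho> \<le> \<theta> / 128"
  shows "good_family m \<theta> \<rho> (GF m \<mu> w w) (\<theta> * vnorm m w / 128)"
proof -
  define R where "R = vnorm m w"
  have R0: "R > 0" "\<mu> \<le> 6 * R" using R(1) \<mu> by (auto simp: R_def)
  have R2: "dotp m w w = R\<^sup>2" by (simp add: R_def vnorm_sq)
  define q where "q = lastq m w"
  have q2: "q\<^sup>2 = 1 - R\<^sup>2" "q \<ge> 0" using R(2) unfolding R2 by (auto simp: q_def lastq_def R2)
  have R2': "R\<^sup>2 \<le> 1 / 2000" using R(2) unfolding R2 .
  then have q2': "q\<^sup>2 \<ge> 1999 / 2000" using q2 by simp
  then have qpos: "q > 0" using q2(2) by (cases "q = 0") auto
  have Rq: "R / q \<le> 1 / 44"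
  proof -
    have "(44 * R)\<^sup>2 \<le> q\<^sup>2" using R2' q2' by (simp add: power_mult_distrib)
    then have "44 * R \<le> q" by (rule power2_le_imp_le) (use qpos in simp)
    then show ?thesis using qpos by (simp add: field_simps)
  qed
  define A where "A x = dotp m w x" for x
  have [measurable]: "A \<in> borel_measurable (colM m \<theta>)" unfolding A_def by measurable
  define G where "G = (\<lambda>(t, y). tanh ((t + q * y) / \<mu>) * t)"
  have G_meas [measurable]: "G \<in> borel_measurable (borel \<Otimes>\<^sub>M borel)"
    unfolding G_def tanh_real_altdef by measurable
  have F: "GF m \<mu> w w x = G (A x, x m) - tanh (qarg m w x / \<mu>) * (x m * (R * (R / q)))" for x
    unfolding GF_def G_def A_def qarg_def q_def[symmetric] R2
    by (simp add: power2_eq_square right_diff_distrib)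
  have Tb: "\<bar>tanh (qarg m w x / \<mu>) * (x m * (R * (R / q)))\<bar> \<le> (R / 44) * \<bar>x m\<bar>" for x
  proof -
    have "\<bar>x m * (R * (R / q))\<bar> = \<bar>x m\<bar> * (R * (R / q))" using R0 qpos by (simp add: abs_mult)
    also have "\<dots> \<le> \<bar>x m\<bar> * (R * (1 / 44))" using R0 Rq by (intro mult_left_mono) auto
    also have "\<dots> = (R / 44) * \<bar>x m\<bar>" by simp
    finally show ?thesis
      by (rule order_trans[OF abs_tanh_mult_le])
  qed
  have Gb: "\<bar>G (A x, x m)\<bar> \<le> \<bar>A x\<bar>" "\<bar>G (- A x, x m)\<bar> \<le> \<bar>A x\<bar>" for x
    unfolding G_def using abs_tanh_mult_le[of _ "A x"] abs_tanh_mult_le[of _ "- A x"] by auto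
  define a where "a = (\<lambda>i. (1 / R) * w i)"
  have Aa: "dotp m a x = A x / R" for x unfolding a_def A_def dotp_scale_left by simp
  have aa: "dotp m a a \<le> 1" unfolding a_def dotp_scale_left dotp_scale_right R2 using R0 by (simp add: power2_eq_square)
  have bound: "\<bar>GF m \<mu> w w x\<bar> \<le> R * (1 + ((dotp m a x)\<^sup>2 + (x m)\<^sup>2) / 2)" for x
  proof -
    have "\<bar>GF m \<mu> w w x\<bar> \<le> \<bar>A x\<bar> + R / 44 * \<bar>x m\<bar>"
      unfolding F using Gb(1)[of x] Tb[of x] by linarith
    also have "\<dots> \<le> R * \<bar>A x / R\<bar> + R * \<bar>x m\<bar>" using R0 by (simp add: abs_mult)
    also have "\<dots> \<le> R * ((1 + (A x / R)\<^sup>2) / 2) + R * ((1 + (x m)\<^sup>2) / 2)"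
      using R0 by (intro add_mono mult_left_mono abs_le_half_sq) auto
    finally show ?thesis unfolding Aa by (simp add: algebra_simps add_divide_distrib)
  qed
  interpret C: prob_space "colM m \<theta>" by (rule prob_space_colM)
  have \<theta>': "0 \<le> \<theta>" "\<theta> \<le> 1" using \<theta> by auto
  have intA: "integrable (colM m \<theta>) (\<lambda>x. \<bar>A x\<bar>)"
    unfolding A_def by (rule colM_dotp_abs_integrable(2)[OF \<theta>'])
  have intG: "integrable (colM m \<theta>) (\<lambda>x. G (A x, x m))" "integrable (colM m \<theta>) (\<lambda>x. G (- A x, x m))"
    by (rule Bochner_Integration.integrable_bound[OF intA]; use Gb in \<open>auto intro!: AE_I2\<close>)+
  note mA = colM_last0_moments[OF \<theta>', of m w, folded A_def, unfolded A_def[of w] R2] and mx = colM_last_abs[OF \<theta>', of m]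
  \<comment> \<open>Truncation at \<open>4 * R\<close> keeps 1 - 3/16 = 13/16 of the second moment.
    With \<open>\<mu> + 4 * R \<le> 10 * R\<close> and \<open>1 - \<theta> \<ge> 1 / 2\<close> the
    mean is at least \<open>13 / 320 * \<theta> * R\<close>; the tangent correction takes at most
    \<open>\<theta> * R / 44\<close>.\<close>
  define lower where "lower x = (last0 m x * (A x)\<^sup>2 - (1 / (4 * R)\<^sup>2) * (last0 m x * (A x) ^ 4)) / (\<mu> + 4 * R)" for x
  have low: "lower x \<le> 1 / 2 * (G (A x, x m) + G (- A x, x m))" for x
  proof (cases "x m = 0")
    case True
    have "1 / 2 * (G (A x, x m) + G (- A x, x m)) = A x * tanh (A x / \<mu>)"
      by (simp add: True G_def)
    then show ?thesis
      using mult_tanh_ge[of \<mu> "4 * R" "A x"] \<mu> R0 by (simp add: True lower_def last0_def)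
  next
    case False
    have "G (A x, x m) + G (- A x, x m) = (tanh ((A x + q * x m) / \<mu>) - tanh ((- A x + q * x m) / \<mu>)) * A x"
      by (simp add: G_def algebra_simps)
    also have "\<dots> \<ge> 0"
    proof (cases "A x \<ge> 0")
      case True
      then have "tanh ((A x + q * x m) / \<mu>) \<ge> tanh ((- A x + q * x m) / \<mu>)"
        using \<mu> by (simp add: divide_right_mono)
      then show ?thesis using True by simp
    next
      case False
      then have "tanh ((A x + q * x m) / \<mu>) \<le> tanh ((- A x + q * x m) / \<mu>)"
        using \<mu> by (simp add: divide_right_mono)
      then show ?thesis using False by (simp add: mult_nonpos_nonpos)
    qed
    finally show ?thesis using False by (simp add: lower_def last0_def)
  qed
  have intlow: "integrable (colM m \<theta>) lower"
    unfolding lower_def using mA by (intro Bochner_Integration.integrable_diff integrable_mult_right integrable_divide) auto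
  have "(\<integral>x. lower x \<partial>colM m \<theta>) = ((\<integral>x. last0 m x * (A x)\<^sup>2 \<partial>colM m \<theta>)
      - 1 / (4 * R)\<^sup>2 * (\<integral>x. last0 m x * (A x) ^ 4 \<partial>colM m \<theta>)) / (\<mu> + 4 * R)"
    unfolding lower_def using mA by simp
  also have "\<dots> \<ge> ((1 - \<theta>) * (\<theta> * R\<^sup>2) - 1 / (4 * R)\<^sup>2 * ((1 - \<theta>) * (3 * \<theta> * (R\<^sup>2)\<^sup>2))) / (\<mu> + 4 * R)"
    using mA(4) \<theta> \<mu> R0 unfolding mA(2)
    by (intro divide_right_mono diff_mono mult_left_mono) auto
  also have "(1 - \<theta>) * (\<theta> * R\<^sup>2) - 1 / (4 * R)\<^sup>2 * ((1 - \<theta>) * (3 * \<theta> * (R\<^sup>2)\<^sup>2)) = 13 / 16 * ((1 - \<theta>) * \<theta> * R\<^sup>2)"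
    using R0 by (simp add: field_simps power2_eq_square)
  finally have E1: "(\<integral>x. lower x \<partial>colM m \<theta>) \<ge> 13 / 16 * ((1 - \<theta>) * \<theta> * R\<^sup>2) / (\<mu> + 4 * R)" .
  have "13 / 320 * \<theta> * R \<le> 13 / 16 * ((1 - \<theta>) * \<theta> * R\<^sup>2) / (\<mu> + 4 * R)"
  proof -
    have "13 / 320 * \<theta> * R * (\<mu> + 4 * R) \<le> 13 / 320 * \<theta> * R * (10 * R)"
      using R0 \<theta> by (intro mult_left_mono) auto
    also have "\<dots> = 13 / 16 * (1 / 2 * \<theta> * R\<^sup>2)" by (simp add: power2_eq_square)
    also have "\<dots> \<le> 13 / 16 * ((1 - \<theta>) * \<theta> * R\<^sup>2)"
      using \<theta> by (intro mult_left_mono mult_right_mono) auto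
    finally show ?thesis
      by (rule pos_le_divide_eq[THEN iffD2, rotated]) (use \<mu> R0 in simp)
  qed
  with E1 have E1': "(\<integral>x. lower x \<partial>colM m \<theta>) \<ge> 13 / 320 * \<theta> * R" by linarith
  have refl: "(\<integral>x. G (A x, x m) \<partial>colM m \<theta>) = (\<integral>x. G (- A x, x m) \<partial>colM m \<theta>)"
    unfolding A_def by (rule colM_reflect[OF \<theta>' G_meas])
  have "(\<integral>x. lower x \<partial>colM m \<theta>) \<le> (\<integral>x. 1 / 2 * (G (A x, x m) + G (- A x, x m)) \<partial>colM m \<theta>)"
    using intG by (intro integral_mono intlow low) auto
  also have "\<dots> = (\<integral>x. G (A x, x m) \<partial>colM m \<theta>)" using intG refl by simp
  finally have E2: "(\<integral>x. G (A x, x m) \<partial>colM m \<theta>) \<ge> 13 / 320 * \<theta> * R" using E1' by linarith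
  have intF: "integrable (colM m \<theta>) (GF m \<mu> w w)"
    by (rule colM_integrable_quadratic_growth[OF \<theta>' _ bound]) simp
  have "(\<integral>x. G (A x, x m) - R / 44 * \<bar>x m\<bar> \<partial>colM m \<theta>) \<le> (\<integral>x. GF m \<mu> w w x \<partial>colM m \<theta>)"
  proof (rule integral_mono)
    fix x show "G (A x, x m) - R / 44 * \<bar>x m\<bar> \<le> GF m \<mu> w w x" unfolding F using Tb[of x] by linarith
  qed (use intF intG mx in auto)
  moreover have "(\<integral>x. G (A x, x m) - R / 44 * \<bar>x m\<bar> \<partial>colM m \<theta>)
      = (\<integral>x. G (A x, x m) \<partial>colM m \<theta>) - R / 44 * (\<integral>x. \<bar>x m\<bar> \<partial>colM m \<theta>)" using intG mx by simp
  moreover have "R / 44 * (\<integral>x. \<bar>x m\<bar> \<partial>colM m \<theta>) \<le> R / 44 * \<theta>" using mx R0 by (intro mult_left_mono) auto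
  moreover have "13 / 320 * \<theta> * R - R / 44 * \<theta> \<ge> 2 * (\<theta> * R / 128)"
    using mult_pos_pos[OF \<theta>(1) R0(1)] by (simp add: mult.commute)
  ultimately have mean: "(\<integral>x. GF m \<mu> w w x \<partial>colM m \<theta>) \<ge> 2 * (\<theta> * R / 128)" using E2 by linarith
  have exp_a: "(\<integral>\<^sup>+x. ennreal (exp ((dotp m a x)\<^sup>2 / 4)) \<partial>colM m \<theta>) \<le> ennreal (sqrt 2)"
    by (rule nn_integral_colM_exp_dotp[OF \<theta>' aa])
  have exp_m: "(\<integral>\<^sup>+x. ennreal (exp ((x m)\<^sup>2 / 4)) \<partial>colM m \<theta>) \<le> ennreal (sqrt 2)"
    by (rule nn_integral_colM_exp_last[OF \<theta>']) simp
  show ?thesis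
    unfolding good_family_def R_def[symmetric]
  proof (intro conjI exI allI)
    show "\<bar>GF m \<mu> w w x\<bar> \<le> R * (1 + ((dotp m a x)\<^sup>2 + (x m)\<^sup>2) / 2)" for x by (rule bound)
    show "\<rho> * R \<le> \<theta> * R / 128" using mult_right_mono[OF \<rho>, of R] R0 by simp
    show "\<theta> * R / 128 \<le> R" using \<theta> R0 mult_right_mono[of \<theta> 128 R] by simp
  qed (use \<theta> R0 exp_a exp_m mean in auto)
qed

text \<open>The summand with \<open>x i\<close> is odd under reflection and has mean 0, so the shift
  \<open>t\<close> is the whole mean. The two signs of \<open>c\<close> yield a two-sided bound on a
  coordinate of the gradient at 0.\<close>

lemma good_family_gradient_0:
  assumes \<theta>: "0 < \<theta>" "\<theta> < 1" and i: "i < m" and t: "0 < t" "t \<le> 1" and c: "\<bar>c\<bar> = 1" and \<rho>: "\<rho> \<le> t / 4"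
  shows "good_family m \<theta> \<rho> (\<lambda>x. t + c * (tanh (x m / \<mu>) * x i)) (t / 2)"
proof -
  interpret C: prob_space "colM m \<theta>" by (rule prob_space_colM)
  have \<theta>': "0 \<le> \<theta>" "\<theta> \<le> 1" using \<theta> by auto
  let ?e = "\<lambda>j. if j = i then 1 else 0 :: real"
  have e: "dotp m ?e x = x i" for x using i by (rule dotp_unit)
  define G where "G = (\<lambda>(s, y). tanh (y / \<mu>) * s)"
  have G_meas [measurable]: "G \<in> borel_measurable (borel \<Otimes>\<^sub>M borel)"
    unfolding G_def tanh_real_altdef by measurable
  have meas: "(\<lambda>x. tanh (x m / \<mu>) * x i) \<in> borel_measurable (colM m \<theta>)"
    using measurable_colM_component[of i m \<theta>] i unfolding tanh_real_altdef
    by (intro borel_measurable_times) (auto, measurable)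
  have int: "integrable (colM m \<theta>) (\<lambda>x. tanh (x m / \<mu>) * x i)"
    by (rule Bochner_Integration.integrable_bound[OF colM_dotp_abs_integrable(2)[OF \<theta>', of m ?e]])
       (use meas abs_tanh_mult_le in \<open>auto simp: e intro!: AE_I2\<close>)
  have "(\<integral>x. tanh (x m / \<mu>) * x i \<partial>colM m \<theta>) = (\<integral>x. - (tanh (x m / \<mu>) * x i) \<partial>colM m \<theta>)"
    using colM_reflect[OF \<theta>' G_meas, of m ?e] unfolding e by (simp add: G_def)
  then have E0: "(\<integral>x. tanh (x m / \<mu>) * x i \<partial>colM m \<theta>) = 0" by simp
  have mean: "(\<integral>x. t + c * (tanh (x m / \<mu>) * x i) \<partial>colM m \<theta>) = t"
    using int by (simp add: E0 C.prob_space)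
  have bound: "\<bar>t + c * (tanh (x m / \<mu>) * x i)\<bar> \<le> 2 * (1 + ((x i)\<^sup>2 + (x m)\<^sup>2) / 2)" for x
  proof -
    have "\<bar>c * (tanh (x m / \<mu>) * x i)\<bar> \<le> \<bar>x i\<bar>"
      using abs_tanh_mult_le[of "x m / \<mu>" "x i"] c by (simp add: abs_mult)
    then have "\<bar>c * (tanh (x m / \<mu>) * x i)\<bar> \<le> (1 + (x i)\<^sup>2) / 2"
      using abs_le_half_sq[of "x i"] by (rule order_trans)
    from abs_le_D1[OF this] abs_le_D2[OF this] show ?thesis
      using t zero_le_power2[of "x i"] zero_le_power2[of "x m"] by (intro abs_leI) argo+
  qed
  have m1: "(\<lambda>x. x i) \<in> borel_measurable (colM m \<theta>)" using i by (intro measurable_colM_component) simp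
  show ?thesis
    unfolding good_family_def
  proof (intro conjI exI allI)
    show "\<bar>t + c * (tanh (x m / \<mu>) * x i)\<bar> \<le> 2 * (1 + ((x i)\<^sup>2 + (x m)\<^sup>2) / 2)" for x by (rule bound)
    show "(\<lambda>x. t + c * (tanh (x m / \<mu>) * x i)) \<in> borel_measurable (colM m \<theta>)"
      using meas by simp
  qed (use i t \<rho> m1 mean nn_integral_colM_exp_last[OF \<theta>'] in auto)
qed

section \<open>Negative curvature in expectation\<close>

declare measurable_colM_component [measurable del] measurable_colM_last [measurable del]

text \<open>The second derivative of \<open>hmu \<mu>\<close>: a bump at 0 of height
  \<open>1 / \<mu>\<close> and width of order \<mu>.\<close>

definition sechk :: "real \<Rightarrow> real \<Rightarrow> real" where
  "sechk \<mu> s = (1 - (tanh (s / \<mu>))\<^sup>2) / \<mu>"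

lemma measurable_sechk [measurable]: "sechk \<mu> \<in> borel_measurable borel"
  unfolding sechk_def tanh_real_altdef by measurable

lemma sechk_nonneg: "\<mu> > 0 \<Longrightarrow> 0 \<le> sechk \<mu> s"
  using tanh_sq_le_1[of "s / \<mu>"] by (simp add: sechk_def)

lemma sechk_le: "\<mu> > 0 \<Longrightarrow> sechk \<mu> s \<le> 1 / \<mu>"
  by (simp add: sechk_def divide_right_mono)

text \<open>Follows from \<open>cosh t \<ge> 1 + t^2 / 2\<close>. The right-hand side is integrable
  over the line, which is what gains the extra power of \<mu> in the mean of \<open>sechk\<close>
  times the square.\<close>

lemma sech_sq_decay: "(1 - (tanh t)\<^sup>2) * t\<^sup>2 \<le> 4 / (1 + t\<^sup>2)" for t :: real
proof -
  have "\<bar>t / 2\<bar> \<le> \<bar>sinh (t / 2)\<bar>"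
    using real_le_abs_sinh[of "t / 2"] by (simp add: sinh_field_def exp_minus)
  then have "(t / 2)\<^sup>2 \<le> (sinh (t / 2))\<^sup>2" by (rule abs_le_square_iff[THEN iffD1])
  moreover have "cosh t = 1 + 2 * (sinh (t / 2))\<^sup>2"
    using cosh_double[of "t / 2"] cosh_square_eq[of "t / 2"] by simp
  ultimately have c: "1 + t\<^sup>2 / 2 \<le> cosh t" by (simp add: power_divide)
  then have "(1 + t\<^sup>2 / 2)\<^sup>2 \<le> (cosh t)\<^sup>2" by (intro power_mono) auto
  moreover have "t\<^sup>2 * (1 + t\<^sup>2) \<le> 4 * (1 + t\<^sup>2 / 2)\<^sup>2"
    by (simp add: power2_eq_square algebra_simps)
  ultimately have "t\<^sup>2 * (1 + t\<^sup>2) \<le> 4 * (cosh t)\<^sup>2" by linarith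
  moreover have "1 - (tanh t)\<^sup>2 = 1 / (cosh t)\<^sup>2"
  proof -
    have "1 - (tanh t)\<^sup>2 = ((cosh t)\<^sup>2 - (sinh t)\<^sup>2) / (cosh t)\<^sup>2"
      using cosh_real_pos[of t] by (simp add: tanh_def power_divide diff_divide_distrib)
    then show ?thesis by (simp only: hyperbolic_pythagoras)
  qed
  moreover have "0 \<le> 1 - (tanh t)\<^sup>2" using tanh_sq_le_1[of t] by simp
  ultimately have "(1 - (tanh t)\<^sup>2) * (t\<^sup>2 * (1 + t\<^sup>2)) \<le> 1 / (cosh t)\<^sup>2 * (4 * (cosh t)\<^sup>2)"
    by (metis mult_left_mono)
  also have "\<dots> = 4" using cosh_real_pos[of t] by simp
  finally have "(1 - (tanh t)\<^sup>2) * t\<^sup>2 * (1 + t\<^sup>2) \<le> 4" by (simp only: mult.assoc)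
  then show ?thesis
    by (rule pos_le_divide_eq[THEN iffD2, rotated]) (simp add: add_pos_nonneg)
qed

lemma sechk_mult_sq: 
  assumes "\<mu> > 0"
  shows "sechk \<mu> s * s\<^sup>2 \<le> 4 * \<mu> / (1 + (s / \<mu>)\<^sup>2)"
proof -
  have "sechk \<mu> s * s\<^sup>2 = \<mu> * ((1 - (tanh (s / \<mu>))\<^sup>2) * (s / \<mu>)\<^sup>2)"
    using assms by (simp add: sechk_def power_divide power2_eq_square)
  also have "\<dots> \<le> \<mu> * (4 / (1 + (s / \<mu>)\<^sup>2))"
    using assms by (intro mult_left_mono sech_sq_decay) simp
  finally show ?thesis by (simp only: times_divide_eq_right mult.commute[of \<mu> 4])
qed

lemma sechk_mult_sq_le: 
  assumes "\<mu> > 0"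
  shows "sechk \<mu> s * s\<^sup>2 \<le> 4 * \<mu>"
proof -
  have "4 * \<mu> / (1 + (s / \<mu>)\<^sup>2) \<le> 4 * \<mu> / 1"
    using assms by (intro divide_left_mono) (auto simp: add_pos_nonneg)
  then show ?thesis using sechk_mult_sq[OF assms, of s] by simp
qed

section \<open>One-dimensional Gaussian averages of the kernel\<close>

lemma stdN_integral: "f \<in> borel_measurable borel \<Longrightarrow> (\<integral>x. f x \<partial>stdN) = (\<integral>x. std_normal_density x * f x \<partial>lborel)"
  for f :: "real \<Rightarrow> real"
  by (subst integral_density) auto

lemma stdN_integrable: "f \<in> borel_measurable borel \<Longrightarrow> integrable stdN f \<longleftrightarrow> integrable lborel (\<lambda>x. std_normal_density x * f x)"
  for f :: "real \<Rightarrow> real"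
  by (subst integrable_density) auto

lemma stdN_integrable_bounded:
  assumes "f \<in> borel_measurable borel" "\<And>x. \<bar>f x\<bar> \<le> B"
  shows "integrable stdN (f :: real \<Rightarrow> real)"
  by (rule stdN.integrable_const_bound[of _ B]) (use assms in auto)

lemma stdN_moments:
  "integrable stdN (\<lambda>x. x)" "(\<integral>x. x \<partial>stdN) = 0"
  "integrable stdN (\<lambda>x. x\<^sup>2)" "(\<integral>x. x\<^sup>2 \<partial>stdN) = 1"
  using integrable_std_normal_moment[of 1] integrable_std_normal_moment[of 2]
    integral_std_normal_moment_odd[of 0] integral_std_normal_moment_even[of 1]
  by (simp_all add: stdN_integral stdN_integrable)

lemma std_normal_density_le_half: "std_normal_density x \<le> 1 / 2"
proof -
  have "2\<^sup>2 \<le> 2 * pi" using pi_ge_two by simp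
  then have "2 \<le> sqrt (2 * pi)" by (rule real_le_rsqrt)
  then have "1 / sqrt (2 * pi) \<le> 1 / 2" by (simp add: frac_le)
  moreover have "exp (- x\<^sup>2 / 2) \<le> 1" by simp
  ultimately have "1 / sqrt (2 * pi) * exp (- x\<^sup>2 / 2) \<le> 1 / 2 * 1" by (intro mult_mono) auto
  then show ?thesis by (simp add: std_normal_density_def)
qed

lemma std_normal_density_ge:
  assumes "\<bar>x\<bar> \<le> 1 / 2"
  shows "std_normal_density x \<ge> 4 / 15"
proof -
  have "sqrt (2 * pi) \<le> 3" using pi_less_4 by (intro real_le_lsqrt) auto
  then have 1: "1 / 3 \<le> 1 / sqrt (2 * pi)" by (simp add: frac_le)
  have "x\<^sup>2 \<le> (1 / 2)\<^sup>2" using assms by (simp add: abs_le_square_iff[symmetric])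
  then have "1 - 1 / 8 \<le> 1 + - x\<^sup>2 / 2" by (simp add: power2_eq_square)
  also have "\<dots> \<le> exp (- x\<^sup>2 / 2)" by (rule exp_ge_add_one_self)
  finally have "1 / 3 * (7 / 8) \<le> 1 / sqrt (2 * pi) * exp (- x\<^sup>2 / 2)"
    using 1 by (intro mult_mono) auto
  then show ?thesis by (simp add: std_normal_density_def)
qed

text \<open>On a window of length \<mu> around 0 the kernel is at least
  \<open>3 / (4 * \<mu>)\<close> and the density at least 4/15; the product of the three is
  1/5.\<close>

lemma sechk_mean_lower:
  assumes \<mu>: "0 < \<mu>" "\<mu> \<le> 1" and \<sigma>: "0 < \<sigma>" "\<sigma> \<le> 1"
  shows "(\<integral>x. sechk \<mu> (\<sigma> * x) \<partial>stdN) \<ge> 1 / 5"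
proof -
  have int: "integrable stdN (\<lambda>x. sechk \<mu> (\<sigma> * x))"
    using sechk_nonneg[OF \<mu>(1)] sechk_le[OF \<mu>(1)] by (intro stdN_integrable_bounded[of _ "1 / \<mu>"]) auto
  have pt: "indicator {- \<mu> / 2..\<mu> / 2} x * (1 / 5 / \<mu>) \<le> std_normal_density x * sechk \<mu> (\<sigma> * x)" for x
  proof (cases "x \<in> {- \<mu> / 2..\<mu> / 2}")
    case True
    then have x: "\<bar>x\<bar> \<le> \<mu> / 2" by auto
    have "\<bar>\<sigma> * x / \<mu>\<bar> = \<sigma> * (\<bar>x\<bar> / \<mu>)" using \<mu> \<sigma> by (simp add: abs_mult)
    also have "\<dots> \<le> 1 * (1 / 2)" using x \<mu> \<sigma> by (intro mult_mono) (auto simp: field_simps)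
    finally have "(\<sigma> * x / \<mu>)\<^sup>2 \<le> (1 / 2)\<^sup>2" by (simp add: abs_le_square_iff[symmetric])
    then have "(tanh (\<sigma> * x / \<mu>))\<^sup>2 \<le> 1 / 4"
      using tanh_sq_le[of "\<sigma> * x / \<mu>"] unfolding power2_eq_square[of "1 / 2"] by linarith
    then have s: "3 / 4 / \<mu> \<le> sechk \<mu> (\<sigma> * x)"
      unfolding sechk_def using \<mu> by (intro divide_right_mono) auto
    have "4 / 15 * (3 / 4 / \<mu>) \<le> std_normal_density x * sechk \<mu> (\<sigma> * x)"
      using x \<mu> by (intro mult_mono s std_normal_density_ge) auto
    then show ?thesis using True by simp
  next
    case False
    then show ?thesis using sechk_nonneg[OF \<mu>(1)] by simp
  qed
  have "1 / 5 = (\<integral>x. indicator {- \<mu> / 2..\<mu> / 2} x * (1 / 5 / \<mu>) \<partial>lborel)"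
    using \<mu> by simp
  also have "\<dots> \<le> (\<integral>x. std_normal_density x * sechk \<mu> (\<sigma> * x) \<partial>lborel)"
    using int \<mu> by (intro integral_mono pt) (auto simp: stdN_integrable)
  also have "\<dots> = (\<integral>x. sechk \<mu> (\<sigma> * x) \<partial>stdN)" by (simp add: stdN_integral)
  finally show ?thesis .
qed

lemma nn_integral_inverse_1_plus_sq: "(\<integral>\<^sup>+x. ennreal (inverse (1 + x\<^sup>2)) \<partial>lborel) = ennreal pi"
proof -
  have int: "integrable lborel (\<lambda>x::real. inverse (1 + x\<^sup>2))"
    using integrable_inverse_1_plus_square by (simp add: set_integrable_def)
  have "(\<integral>x. inverse (1 + x\<^sup>2) \<partial>lborel) = pi"
    using LBINT_inverse_1_plus_square by (simp add: interval_lebesgue_integral_def set_lebesgue_integral_def)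
  then show ?thesis using int by (simp add: nn_integral_eq_integral)
qed

text \<open>The density is at most 1/2 and the rest at most
  \<open>4 * \<mu> / (1 + (\<sigma> * x / \<mu>)^2)\<close>. Rescaling by
  \<open>\<mu> / \<sigma>\<close> gives the arctangent integral, with value
  \<open>pi < 4\<close>.\<close>

lemma sechk_sq_mean_upper:
  assumes \<mu>: "0 < \<mu>" and \<sigma>: "0 < \<sigma>"
  shows "integrable stdN (\<lambda>x. sechk \<mu> (\<sigma> * x) * (\<sigma> * x)\<^sup>2)"
    and "(\<integral>x. sechk \<mu> (\<sigma> * x) * (\<sigma> * x)\<^sup>2 \<partial>stdN) \<le> 8 * \<mu>\<^sup>2 / \<sigma>"
proof -
  have nn: "0 \<le> sechk \<mu> (\<sigma> * x) * (\<sigma> * x)\<^sup>2" for x using sechk_nonneg[OF \<mu>] by simp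
  show int: "integrable stdN (\<lambda>x. sechk \<mu> (\<sigma> * x) * (\<sigma> * x)\<^sup>2)"
    using nn sechk_mult_sq_le[OF \<mu>] by (intro stdN_integrable_bounded[of _ "4 * \<mu>"]) auto
  have pt: "std_normal_density x * (sechk \<mu> (\<sigma> * x) * (\<sigma> * x)\<^sup>2) \<le> 2 * \<mu> * inverse (1 + (\<sigma> / \<mu> * x)\<^sup>2)" for x
  proof -
    have "std_normal_density x * (sechk \<mu> (\<sigma> * x) * (\<sigma> * x)\<^sup>2) \<le> 1 / 2 * (4 * \<mu> / (1 + (\<sigma> * x / \<mu>)\<^sup>2))"
      using nn by (intro mult_mono std_normal_density_le_half sechk_mult_sq[OF \<mu>]) auto
    then show ?thesis by (simp add: inverse_eq_divide)
  qed
  have "(\<integral>\<^sup>+x. ennreal (sechk \<mu> (\<sigma> * x) * (\<sigma> * x)\<^sup>2) \<partial>stdN)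
      = (\<integral>\<^sup>+x. ennreal (std_normal_density x * (sechk \<mu> (\<sigma> * x) * (\<sigma> * x)\<^sup>2)) \<partial>lborel)"
    using nn by (simp add: nn_integral_density ennreal_mult)
  also have "\<dots> \<le> (\<integral>\<^sup>+x. ennreal (2 * \<mu>) * ennreal (inverse (1 + (\<sigma> / \<mu> * x)\<^sup>2)) \<partial>lborel)"
    using pt \<mu> by (intro nn_integral_mono) (simp add: ennreal_mult[symmetric] ennreal_leI)
  also have "\<dots> = ennreal (2 * \<mu>) * (\<integral>\<^sup>+x. ennreal (inverse (1 + (\<sigma> / \<mu> * x)\<^sup>2)) \<partial>lborel)"
    by (rule nn_integral_cmult) measurable
  also have "(\<integral>\<^sup>+x. ennreal (inverse (1 + (\<sigma> / \<mu> * x)\<^sup>2)) \<partial>lborel)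
     = ennreal (\<mu> / \<sigma>) * (\<integral>\<^sup>+x. ennreal (inverse (1 + x\<^sup>2)) \<partial>lborel)"
    using \<mu> \<sigma> by (subst nn_integral_real_affine[where c="\<mu> / \<sigma>" and t=0]) auto
  also have "ennreal (2 * \<mu>) * (ennreal (\<mu> / \<sigma>) * (\<integral>\<^sup>+x. ennreal (inverse (1 + x\<^sup>2)) \<partial>lborel))
     = ennreal (2 * \<mu> * (\<mu> / \<sigma> * pi))"
    using \<mu> \<sigma> by (simp add: nn_integral_inverse_1_plus_sq ennreal_mult[symmetric])
  finally have "(\<integral>x. sechk \<mu> (\<sigma> * x) * (\<sigma> * x)\<^sup>2 \<partial>stdN) \<le> 2 * \<mu> * (\<mu> / \<sigma> * pi)"
    using \<mu> \<sigma> nn by (subst (asm) nn_integral_eq_integral[OF int]) auto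
  also have "\<dots> \<le> 2 * \<mu> * (\<mu> / \<sigma> * 4)"
    using \<mu> \<sigma> pi_less_4 by (intro mult_left_mono) auto
  finally show "(\<integral>x. sechk \<mu> (\<sigma> * x) * (\<sigma> * x)\<^sup>2 \<partial>stdN) \<le> 8 * \<mu>\<^sup>2 / \<sigma>"
    by (simp add: power2_eq_square)
qed

text \<open>Gaussian integration by parts, obtained by integrating the derivative \<open>g\<close>
  of density times tanh over the line: the boundary values vanish because the density does and tanh
  is bounded.\<close>

lemma tanh_Stein:
  assumes \<mu>: "0 < \<mu>"
  shows "integrable stdN (\<lambda>x. x * tanh (\<sigma> * x / \<mu>))"
    and "(\<integral>x. x * tanh (\<sigma> * x / \<mu>) \<partial>stdN) = \<sigma> * (\<integral>x. sechk \<mu> (\<sigma> * x) \<partial>stdN)"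
proof -
  let ?T = "\<lambda>x. tanh (\<sigma> * x / \<mu>)" and ?n = std_normal_density
  have [measurable]: "?T \<in> borel_measurable borel" unfolding tanh_real_altdef by measurable
  have ixT: "integrable stdN (\<lambda>x. x * ?T x)"
  proof (rule Bochner_Integration.integrable_bound[OF stdN_moments(1)])
    show "AE x in stdN. norm (x * ?T x) \<le> norm x"
      using abs_tanh_mult_le by (intro AE_I2) (simp add: mult.commute)
  qed simp
  then show "integrable stdN (\<lambda>x. x * tanh (\<sigma> * x / \<mu>))" .
  have ik: "integrable stdN (\<lambda>x. \<sigma> * sechk \<mu> (\<sigma> * x))"
    using sechk_nonneg[OF \<mu>] sechk_le[OF \<mu>]
    by (intro integrable_mult_right stdN_integrable_bounded[of _ "1 / \<mu>"]) auto
  define g where "g x = ?n x * (\<sigma> * sechk \<mu> (\<sigma> * x)) - ?n x * (x * ?T x)" for x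
  have n': "(?n has_real_derivative - x * ?n x) (at x)" for x
  proof -
    have "((\<lambda>x. exp (- x\<^sup>2 / 2)) has_real_derivative exp (- x\<^sup>2 / 2) * (- x)) (at x)"
      by (auto intro!: derivative_eq_intros)
    from DERIV_cmult[OF this, of "1 / sqrt (2 * pi)"] show ?thesis
      unfolding std_normal_density_def by (rule DERIV_cong) (simp only: mult_ac)
  qed
  have T': "(?T has_real_derivative \<sigma> * sechk \<mu> (\<sigma> * x)) (at x)" for x
  proof -
    have "((\<lambda>x. \<sigma> * x / \<mu>) has_real_derivative \<sigma> / \<mu>) (at x)"
      using \<mu> by (auto intro!: derivative_eq_intros)
    then have "(?T has_real_derivative (1 - (?T x)\<^sup>2) * (\<sigma> / \<mu>)) (at x)"
      by (rule DERIV_chain2[rotated]) (auto intro!: derivative_eq_intros)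
    then show ?thesis by (simp add: sechk_def mult_ac)
  qed
  have D: "((\<lambda>x. ?n x * ?T x) has_real_derivative g x) (at x)" for x
    by (rule DERIV_cong[OF DERIV_mult[OF n' T']]) (simp add: g_def mult_ac)
  have contT: "isCont ?T x" for x using T' by (rule DERIV_isCont)
  have contn: "isCont ?n x" for x using n' by (rule DERIV_isCont)
  have contg: "isCont g x" for x
    unfolding g_def sechk_def using \<mu> by (intro continuous_intros contn contT) auto
  have intg: "integrable lborel g"
    unfolding g_def
    by (intro Bochner_Integration.integrable_diff stdN_integrable[THEN iffD1, OF _ ik] stdN_integrable[THEN iffD1, OF _ ixT])
       measurable
  have lim_abs: "((\<lambda>x. ?n x * ?T x) \<longlongrightarrow> 0) F" if "(?n \<longlongrightarrow> 0) F" for F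
  proof (rule Lim_null_comparison[OF _ that])
    show "\<forall>\<^sub>F x in F. norm (?n x * ?T x) \<le> ?n x"
    proof (rule always_eventually, rule allI)
      fix x :: real
      show "norm (?n x * ?T x) \<le> ?n x"
        using abs_tanh_mult_le[of "\<sigma> * x / \<mu>" "?n x"] by (simp add: mult.commute)
    qed
  qed
  have sq_top: "filterlim (\<lambda>x::real. x\<^sup>2 / 2) at_top at_top" "filterlim (\<lambda>x::real. x\<^sup>2 / 2) at_top at_bot"
  proof -
    show "filterlim (\<lambda>x::real. x\<^sup>2 / 2) at_top at_top"
      by (rule filterlim_at_top_mono[OF filterlim_ident])
         (auto intro!: eventually_at_top_linorderI[of 2] simp: power2_eq_square)
    then show "filterlim (\<lambda>x::real. x\<^sup>2 / 2) at_top at_bot"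
      by (simp add: filterlim_at_bot_mirror)
  qed
  have lim_n: "(?n \<longlongrightarrow> 0) F" if "filterlim (\<lambda>x::real. x\<^sup>2 / 2) at_top F" for F
  proof -
    have "((\<lambda>x. exp (- (x\<^sup>2 / 2))) \<longlongrightarrow> 0) F"
      by (rule filterlim_compose[OF exp_at_bot]) (use that in \<open>simp add: filterlim_uminus_at_top\<close>)
    from tendsto_mult_right_zero[OF this, of "1 / sqrt (2 * pi)"] show ?thesis
      by (simp add: std_normal_density_def[abs_def])
  qed
  have "(LBINT x=-\<infinity>..\<infinity>. g x) = 0 - 0"
  proof (rule interval_integral_FTC_integrable)
    show "((\<lambda>x. ?n x * ?T x) has_vector_derivative g x) (at x)" for x
      using D[of x] by (simp add: has_real_derivative_iff_has_vector_derivative)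
    show "(((\<lambda>x. ?n x * ?T x) \<circ> real_of_ereal) \<longlongrightarrow> 0) (at_right (- \<infinity>))"
      using lim_abs[OF lim_n[OF sq_top(2)]] by (simp add: ereal_tendsto_simps)
    show "(((\<lambda>x. ?n x * ?T x) \<circ> real_of_ereal) \<longlongrightarrow> 0) (at_left \<infinity>)"
      using lim_abs[OF lim_n[OF sq_top(1)]] by (simp add: ereal_tendsto_simps)
  qed (use contg intg in \<open>auto simp: set_integrable_def\<close>)
  then have "(\<integral>x. g x \<partial>lborel) = 0"
    by (simp add: interval_lebesgue_integral_def set_lebesgue_integral_def)
  moreover have "(\<integral>x. g x \<partial>lborel) = (\<integral>x. ?n x * (\<sigma> * sechk \<mu> (\<sigma> * x)) \<partial>lborel) - (\<integral>x. ?n x * (x * ?T x) \<partial>lborel)"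
    unfolding g_def
    by (rule Bochner_Integration.integral_diff;
        rule stdN_integrable[THEN iffD1, OF _ ik] stdN_integrable[THEN iffD1, OF _ ixT]) measurable
  moreover have "(\<integral>x. ?n x * (\<sigma> * sechk \<mu> (\<sigma> * x)) \<partial>lborel) = (\<integral>x. \<sigma> * sechk \<mu> (\<sigma> * x) \<partial>stdN)"
    by (rule stdN_integral[symmetric]) measurable
  moreover have "(\<integral>x. ?n x * (x * ?T x) \<partial>lborel) = (\<integral>x. x * ?T x \<partial>stdN)"
    by (rule stdN_integral[symmetric]) measurable
  ultimately show "(\<integral>x. x * tanh (\<sigma> * x / \<mu>) \<partial>stdN) = \<sigma> * (\<integral>x. sechk \<mu> (\<sigma> * x) \<partial>stdN)"
    by simp
qed

section \<open>Expected curvature for a fixed support\<close>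

lemma distr_stdN_rotate:
  assumes c: "c \<noteq> 0" and cd: "c\<^sup>2 + d\<^sup>2 = 1"
  shows "distr (stdN \<Otimes>\<^sub>M stdN) (borel \<Otimes>\<^sub>M borel) (\<lambda>(x, y). (d * x + c * y, c * x - d * y)) = stdN \<Otimes>\<^sub>M stdN"
proof (rule measure_eqI)
  show "sets (distr (stdN \<Otimes>\<^sub>M stdN) (borel \<Otimes>\<^sub>M borel) (\<lambda>(x, y). (d * x + c * y, c * x - d * y))) = sets (stdN \<Otimes>\<^sub>M stdN)"
    by (simp cong: sets_pair_measure_cong)
  fix A assume "A \<in> sets (distr (stdN \<Otimes>\<^sub>M stdN) (borel \<Otimes>\<^sub>M borel) (\<lambda>(x, y). (d * x + c * y, c * x - d * y)))"
  then have A [measurable]: "A \<in> sets (borel \<Otimes>\<^sub>M borel)" by simp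
  have A2: "A \<in> sets (stdN \<Otimes>\<^sub>M stdN)" using A by (simp cong: sets_pair_measure_cong)
  have T [measurable]: "(\<lambda>(x, y). (d * x + c * y, c * x - d * y)) \<in> measurable (stdN \<Otimes>\<^sub>M stdN) (borel \<Otimes>\<^sub>M borel)"
    by measurable
  define \<Phi> :: "real \<times> real \<Rightarrow> ennreal" where "\<Phi> = (\<lambda>(x, y). indicator A (d * x + c * y, c * x - d * y))"
  have [measurable]: "\<Phi> \<in> borel_measurable (borel \<Otimes>\<^sub>M borel)" unfolding \<Phi>_def by measurable
  \<comment> \<open>The orthogonal map has determinant -1 and is its own inverse. Applying the
    substitution rule with the same map therefore undoes it.\<close>
  have e: "d * (c * v + d * z) + c * (c * z - d * v) = z" "c * (c * v + d * z) - d * (c * z - d * v) = v" for v z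
  proof -
    have "d * (c * v + d * z) + c * (c * z - d * v) = (c\<^sup>2 + d\<^sup>2) * z"
      "c * (c * v + d * z) - d * (c * z - d * v) = (c\<^sup>2 + d\<^sup>2) * v"
      by (simp_all add: power2_eq_square algebra_simps)
    then show "d * (c * v + d * z) + c * (c * z - d * v) = z" "c * (c * v + d * z) - d * (c * z - d * v) = v"
      by (simp_all add: cd)
  qed
  have "emeasure (distr (stdN \<Otimes>\<^sub>M stdN) (borel \<Otimes>\<^sub>M borel) (\<lambda>(x, y). (d * x + c * y, c * x - d * y))) A
     = (\<integral>\<^sup>+p. indicator A p \<partial>distr (stdN \<Otimes>\<^sub>M stdN) (borel \<Otimes>\<^sub>M borel) (\<lambda>(x, y). (d * x + c * y, c * x - d * y)))"
    by (rule nn_integral_indicator[symmetric]) simp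
  also have "\<dots> = (\<integral>\<^sup>+p. \<Phi> p \<partial>(stdN \<Otimes>\<^sub>M stdN))"
    unfolding \<Phi>_def by (subst nn_integral_distr) (auto simp: case_prod_unfold)
  also have "\<dots> = (\<integral>\<^sup>+x. \<integral>\<^sup>+y. \<Phi> (x, y) \<partial>stdN \<partial>stdN)"
    by (rule stdN.nn_integral_fst[symmetric]) simp
  also have "\<dots> = (\<integral>\<^sup>+z. \<integral>\<^sup>+v. \<Phi> (c * v + d * z, c * z - d * v) \<partial>stdN \<partial>stdN)"
    by (rule nn_integral_stdN_rotate[OF _ c cd, symmetric]) simp
  also have "\<dots> = (\<integral>\<^sup>+z. \<integral>\<^sup>+v. indicator A (z, v) \<partial>stdN \<partial>stdN)"
    unfolding \<Phi>_def by (simp only: prod.case e)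
  also have "\<dots> = (\<integral>\<^sup>+p. indicator A p \<partial>(stdN \<Otimes>\<^sub>M stdN))"
    by (rule stdN.nn_integral_fst) simp
  also have "\<dots> = emeasure (stdN \<Otimes>\<^sub>M stdN) A"
    using A2 by simp
  finally show "emeasure (distr (stdN \<Otimes>\<^sub>M stdN) (borel \<Otimes>\<^sub>M borel) (\<lambda>(x, y). (d * x + c * y, c * x - d * y))) A
    = emeasure (stdN \<Otimes>\<^sub>M stdN) A" .
qed

lemma NN_product:
  fixes f g :: "real \<Rightarrow> real"
  assumes f: "integrable stdN f" and g: "integrable stdN g"
  shows "integrable (stdN \<Otimes>\<^sub>M stdN) (\<lambda>(x, y). f x * g y)"
    and "(\<integral>p. (case p of (x, y) \<Rightarrow> f x * g y) \<partial>(stdN \<Otimes>\<^sub>M stdN)) = (\<integral>x. f x \<partial>stdN) * (\<integral>y. g y \<partial>stdN)"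
proof -
  have [measurable]: "f \<in> borel_measurable stdN" "g \<in> borel_measurable stdN" using f g by auto
  show int: "integrable (stdN \<Otimes>\<^sub>M stdN) (\<lambda>(x, y). f x * g y)"
  proof (rule NN.Fubini_integrable)
    show "(\<lambda>(x, y). f x * g y) \<in> borel_measurable (stdN \<Otimes>\<^sub>M stdN)" by measurable
    show "integrable stdN (\<lambda>x. \<integral>y. norm (case (x, y) of (x, y) \<Rightarrow> f x * g y) \<partial>stdN)"
      using f g by (simp add: abs_mult)
    show "AE x in stdN. integrable stdN (\<lambda>y. case (x, y) of (x, y) \<Rightarrow> f x * g y)"
      using g by simp
  qed
  show "(\<integral>p. (case p of (x, y) \<Rightarrow> f x * g y) \<partial>(stdN \<Otimes>\<^sub>M stdN)) = (\<integral>x. f x \<partial>stdN) * (\<integral>y. g y \<partial>stdN)"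
    unfolding NN.integral_fst'[OF int, symmetric] by simp
qed

text \<open>The radial second derivative for one column, written in \<open>t = dotp m w x\<close>
  and the last entry \<open>y\<close>. On the sphere the squared norm of \<open>w\<close> is
  \<open>1 - q^2\<close>, which merges the \<open>1 / q\<close> and \<open>1 / q ^ 3\<close> terms
  of \<open>HB\<close> into one.\<close>

definition curvature_fun :: "real \<Rightarrow> real \<Rightarrow> real \<times> real \<Rightarrow> real" where
  "curvature_fun \<mu> q = (\<lambda>(t, y). sechk \<mu> (t + q * y) * (t - y * (1 - q\<^sup>2) / q)\<^sup>2
      - y * tanh ((t + q * y) / \<mu>) * ((1 - q\<^sup>2) / q ^ 3))"

lemma measurable_curvature_fun [measurable]:
  "curvature_fun \<mu> q \<in> borel_measurable (borel \<Otimes>\<^sub>M borel)"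
  unfolding curvature_fun_def tanh_real_altdef by measurable

lemma abs_diff_leI:
  fixes N T M P B :: real
  shows "N \<le> M \<Longrightarrow> 0 \<le> N \<Longrightarrow> \<bar>T\<bar> \<le> P \<Longrightarrow> M + P \<le> B \<Longrightarrow> \<bar>N - T\<bar> \<le> B"
  by linarith

text \<open>The bending term alone would cost \<open>1 / q ^ 3\<close>; the hypothesis
  \<open>\<mu> \<le> q\<close> trades one factor \<open>1 / q\<close> for \<open>1 / \<mu>\<close>,
  so both terms fit under \<open>1 / (\<mu> * q^2)\<close>.\<close>

lemma curvature_fun_bound:
  assumes \<mu>: "0 < \<mu>" "\<mu> \<le> q" and q: "0 < q" "q \<le> 1"
  shows "\<bar>curvature_fun \<mu> q (t, y)\<bar> \<le> 6 / (\<mu> * q\<^sup>2) * (1 + (t\<^sup>2 + y\<^sup>2) / 2)"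
proof -
  define r where "r = 1 / q"
  have r: "r \<ge> 1" using q by (simp add: r_def)
  have r2: "r\<^sup>2 \<ge> 1" using r by simp
  have q2: "0 \<le> 1 - q\<^sup>2" "1 - q\<^sup>2 \<le> 1" using q by (simp_all add: power_le_one)
  have "(t - y * (1 - q\<^sup>2) / q)\<^sup>2 \<le> 2 * t\<^sup>2 + 2 * (y * ((1 - q\<^sup>2) * r))\<^sup>2"
    using zero_le_power2[of "t + y * ((1 - q\<^sup>2) * r)"] by (simp add: r_def power2_sum power2_diff)
  also have "(y * ((1 - q\<^sup>2) * r))\<^sup>2 = (y\<^sup>2 * (1 - q\<^sup>2)\<^sup>2) * r\<^sup>2" by (simp add: power_mult_distrib)
  also have "\<dots> \<le> (y\<^sup>2 * 1) * r\<^sup>2" using q2 by (intro mult_right_mono mult_left_mono power_le_one) auto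
  also have "2 * t\<^sup>2 \<le> 2 * (t\<^sup>2 * r\<^sup>2)" using mult_left_mono[OF r2, of "t\<^sup>2"] by simp
  finally have "(t - y * (1 - q\<^sup>2) / q)\<^sup>2 \<le> (2 * t\<^sup>2 + 2 * y\<^sup>2) * r\<^sup>2" by (simp add: algebra_simps)
  then have "sechk \<mu> (t + q * y) * (t - y * (1 - q\<^sup>2) / q)\<^sup>2 \<le> 1 / \<mu> * ((2 * t\<^sup>2 + 2 * y\<^sup>2) * r\<^sup>2)"
    using \<mu> by (intro mult_mono sechk_le) auto
  moreover have "0 \<le> sechk \<mu> (t + q * y) * (t - y * (1 - q\<^sup>2) / q)\<^sup>2" using sechk_nonneg[OF \<mu>(1)] by simp
  moreover have "\<bar>y * tanh ((t + q * y) / \<mu>) * ((1 - q\<^sup>2) / q ^ 3)\<bar> \<le> 1 / \<mu> * ((1 + y\<^sup>2) / 2 * r\<^sup>2)"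
  proof -
    have "\<bar>y * tanh ((t + q * y) / \<mu>)\<bar> \<le> (1 + y\<^sup>2) / 2"
      using abs_tanh_mult_le[of "(t + q * y) / \<mu>" y] abs_le_half_sq[of y] by (simp add: mult.commute)
    moreover have "\<bar>(1 - q\<^sup>2) / q ^ 3\<bar> \<le> 1 / \<mu> * r\<^sup>2"
    proof -
      have "\<bar>(1 - q\<^sup>2) / q ^ 3\<bar> = (1 - q\<^sup>2) / q ^ 3" using q q2 by simp
      also have "\<dots> \<le> 1 / q ^ 3" using q q2 by (intro divide_right_mono) auto
      also have "\<dots> = 1 / q * r\<^sup>2" by (simp add: r_def power3_eq_cube power2_eq_square)
      also have "\<dots> \<le> 1 / \<mu> * r\<^sup>2" using \<mu> q by (intro mult_right_mono divide_left_mono) auto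
      finally show ?thesis .
    qed
    ultimately have "\<bar>y * tanh ((t + q * y) / \<mu>)\<bar> * \<bar>(1 - q\<^sup>2) / q ^ 3\<bar> \<le> (1 + y\<^sup>2) / 2 * (1 / \<mu> * r\<^sup>2)"
      by (intro mult_mono) auto
    then show ?thesis by (simp add: abs_mult)
  qed
  moreover have "1 / \<mu> * ((2 * t\<^sup>2 + 2 * y\<^sup>2) * r\<^sup>2) + 1 / \<mu> * ((1 + y\<^sup>2) / 2 * r\<^sup>2)
      \<le> 6 / (\<mu> * q\<^sup>2) * (1 + (t\<^sup>2 + y\<^sup>2) / 2)"
  proof -
    have "(2 * t\<^sup>2 + 2 * y\<^sup>2) + (1 + y\<^sup>2) / 2 \<le> 6 * (1 + (t\<^sup>2 + y\<^sup>2) / 2)"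
      using zero_le_power2[of t] zero_le_power2[of y] by argo
    then have "(1 / \<mu> * r\<^sup>2) * ((2 * t\<^sup>2 + 2 * y\<^sup>2) + (1 + y\<^sup>2) / 2) \<le> (1 / \<mu> * r\<^sup>2) * (6 * (1 + (t\<^sup>2 + y\<^sup>2) / 2))"
      using \<mu> by (intro mult_left_mono) auto
    moreover have "(1 / \<mu> * r\<^sup>2) * (6 * X) = 6 / (\<mu> * q\<^sup>2) * X" for X
      by (simp add: r_def power_divide)
    moreover have "(1 / \<mu> * r\<^sup>2) * (X + Y) = 1 / \<mu> * (X * r\<^sup>2) + 1 / \<mu> * (Y * r\<^sup>2)" for X Y
      by (simp add: algebra_simps add_divide_distrib)
    ultimately show ?thesis by metis
  qed
  ultimately show ?thesis
    unfolding curvature_fun_def prod.case by (intro abs_diff_leI)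
qed

text \<open>In rotated coordinates the argument of the kernel is \<open>\<sigma> * x\<close> and the
  tangent form is \<open>\<alpha> * \<sigma> * x + \<beta> * y\<close> with an independent
  \<open>y\<close>. Terms odd in \<open>y\<close> vanish, \<open>y^2\<close> averages to 1, and
  \<open>tanh_Stein\<close> converts the tanh term into a mean of the kernel.\<close>

lemma curvature_gaussian_mean:
  assumes \<mu>: "0 < \<mu>" and q: "0 < q" and \<sigma>: "0 < \<sigma>" "\<sigma>\<^sup>2 = a\<^sup>2 + q\<^sup>2"
  shows "(\<integral>p. curvature_fun \<mu> q (a * fst p, snd p) \<partial>(stdN \<Otimes>\<^sub>M stdN))
    = (1 - 1 / \<sigma>\<^sup>2)\<^sup>2 * (\<integral>x. sechk \<mu> (\<sigma> * x) * (\<sigma> * x)\<^sup>2 \<partial>stdN) + (1 - 1 / \<sigma>\<^sup>2) * (\<integral>x. sechk \<mu> (\<sigma> * x) \<partial>stdN)"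
proof -
  define c where "c = q / \<sigma>"
  define d where "d = a / \<sigma>"
  have c: "c \<noteq> 0" using q \<sigma> by (simp add: c_def)
  have cd: "c\<^sup>2 + d\<^sup>2 = 1"
  proof -
    have "c\<^sup>2 + d\<^sup>2 = (a\<^sup>2 + q\<^sup>2) / \<sigma>\<^sup>2"
      by (simp add: c_def d_def power_divide add_divide_distrib add.commute)
    then show ?thesis using \<sigma>(1) unfolding \<sigma>(2)[symmetric] by simp
  qed
  define \<alpha> where "\<alpha> = 1 - 1 / \<sigma>\<^sup>2"
  define \<beta> where "\<beta> = a / (\<sigma> * q)"
  define \<gamma> where "\<gamma> = (1 - q\<^sup>2) / q ^ 3"
  define k where "k x = sechk \<mu> (\<sigma> * x)" for x
  define T where "T x = tanh (\<sigma> * x / \<mu>)" for x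
  let ?F = "\<lambda>p. curvature_fun \<mu> q (a * fst p, snd p)"
  have arg: "a * (d * x + c * y) + q * (c * x - d * y) = \<sigma> * x" for x y
  proof -
    have "a * (d * x + c * y) + q * (c * x - d * y) = (a\<^sup>2 + q\<^sup>2) / \<sigma> * x"
      by (simp add: c_def d_def power2_eq_square field_simps add_divide_distrib)
    also have "(a\<^sup>2 + q\<^sup>2) / \<sigma> = \<sigma>" using \<sigma>(1) unfolding \<sigma>(2)[symmetric] by (simp add: power2_eq_square)
    finally show ?thesis .
  qed
  have lin: "a * (d * x + c * y) - (c * x - d * y) * (1 - q\<^sup>2) / q = \<alpha> * (\<sigma> * x) + \<beta> * y" for x y
  proof -
    have "a * (d * x + c * y) - (c * x - d * y) * (1 - q\<^sup>2) / q
        = (a * (d * x + c * y) + q * (c * x - d * y)) - (c * x - d * y) / q"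
      using q by (simp add: field_simps power2_eq_square)
    also have "\<dots> = \<sigma> * x - (c * x - d * y) / q" unfolding arg ..
    also have "\<dots> = \<alpha> * (\<sigma> * x) + \<beta> * y"
      using q \<sigma>(1) by (simp add: c_def d_def \<alpha>_def \<beta>_def field_simps power2_eq_square)
    finally show ?thesis .
  qed
  have rot: "?F (d * x + c * y, c * x - d * y)
     = (\<alpha>\<^sup>2 * (k x * (\<sigma> * x)\<^sup>2) - c * \<gamma> * (x * T x)) * 1 + (2 * \<alpha> * \<beta> * \<sigma> * (k x * x) + d * \<gamma> * T x) * y
       + (\<beta>\<^sup>2 * k x) * y\<^sup>2" for x y
  proof -
    have "?F (d * x + c * y, c * x - d * y) = k x * (\<alpha> * (\<sigma> * x) + \<beta> * y)\<^sup>2 - (c * x - d * y) * T x * \<gamma>"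
      unfolding curvature_fun_def fst_conv snd_conv prod.case arg lin k_def T_def \<gamma>_def ..
    then show ?thesis by (simp add: power2_eq_square algebra_simps)
  qed
  have k_int: "integrable stdN k"
    unfolding k_def using sechk_nonneg[OF \<mu>] sechk_le[OF \<mu>] by (intro stdN_integrable_bounded[of _ "1 / \<mu>"]) auto
  have T_meas: "T \<in> borel_measurable borel" unfolding T_def tanh_real_altdef by measurable
  have T_int: "integrable stdN T"
    using abs_tanh_less_1 by (intro stdN_integrable_bounded[OF T_meas, of 1]) (auto simp: T_def intro: less_imp_le)
  have k2_int: "integrable stdN (\<lambda>x. k x * (\<sigma> * x)\<^sup>2)"
    unfolding k_def by (rule sechk_sq_mean_upper(1)[OF \<mu> \<sigma>(1)])
  have xT_int: "integrable stdN (\<lambda>x. x * T x)" unfolding T_def by (rule tanh_Stein(1)[OF \<mu>])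
  have kx_int: "integrable stdN (\<lambda>x. k x * x)"
  proof (rule Bochner_Integration.integrable_bound)
    show "integrable stdN (\<lambda>x. 1 / \<mu> * x)" using stdN_moments(1) by simp
    have "\<bar>k x\<bar> * \<bar>x\<bar> \<le> \<bar>1 / \<mu>\<bar> * \<bar>x\<bar>" for x
      using sechk_nonneg[OF \<mu>, of "\<sigma> * x"] sechk_le[OF \<mu>, of "\<sigma> * x"] \<mu>
      by (intro mult_right_mono) (auto simp: k_def)
    then show "AE x in stdN. norm (k x * x) \<le> norm (1 / \<mu> * x)"
      unfolding real_norm_def abs_mult by (rule AE_I2)
  qed (use k_int in simp)
  define f0 where "f0 x = \<alpha>\<^sup>2 * (k x * (\<sigma> * x)\<^sup>2) - c * \<gamma> * (x * T x)" for x
  define f1 where "f1 x = 2 * \<alpha> * \<beta> * \<sigma> * (k x * x) + d * \<gamma> * T x" for x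
  have f_int: "integrable stdN f0" "integrable stdN f1"
    unfolding f0_def f1_def using k2_int xT_int kx_int T_int by auto
  note p0 = NN_product[OF f_int(1), of "\<lambda>_. 1"] and p1 = NN_product[OF f_int(2) stdN_moments(1)]
    and p2 = NN_product[of "\<lambda>x. \<beta>\<^sup>2 * k x", OF integrable_mult_right[OF k_int] stdN_moments(3)]
  have F_meas: "?F \<in> borel_measurable (borel \<Otimes>\<^sub>M borel)" by measurable
  have "(\<integral>p. ?F p \<partial>(stdN \<Otimes>\<^sub>M stdN))
      = (\<integral>p. ?F p \<partial>distr (stdN \<Otimes>\<^sub>M stdN) (borel \<Otimes>\<^sub>M borel) (\<lambda>(x, y). (d * x + c * y, c * x - d * y)))"
    unfolding distr_stdN_rotate[OF c cd] ..
  also have "\<dots> = (\<integral>p. ?F (case p of (x, y) \<Rightarrow> (d * x + c * y, c * x - d * y)) \<partial>(stdN \<Otimes>\<^sub>M stdN))"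
    using F_meas by (intro integral_distr) measurable
  also have "\<dots> = (\<integral>p. (case p of (x, y) \<Rightarrow> f0 x * 1) + (case p of (x, y) \<Rightarrow> f1 x * y)
        + (case p of (x, y) \<Rightarrow> \<beta>\<^sup>2 * k x * y\<^sup>2) \<partial>(stdN \<Otimes>\<^sub>M stdN))"
    by (intro Bochner_Integration.integral_cong refl)
       (auto simp only: rot f0_def f1_def prod.case split: prod.split)
  also have "\<dots> = (\<integral>x. f0 x \<partial>stdN) + \<beta>\<^sup>2 * (\<integral>x. k x \<partial>stdN)"
    using p0 p1 p2 k_int stdN.prob_space by (simp add: stdN_moments)
  also have "(\<integral>x. f0 x \<partial>stdN) = \<alpha>\<^sup>2 * (\<integral>x. k x * (\<sigma> * x)\<^sup>2 \<partial>stdN) - c * \<gamma> * (\<integral>x. x * T x \<partial>stdN)"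
    unfolding f0_def using k2_int xT_int by simp
  also have "(\<integral>x. x * T x \<partial>stdN) = \<sigma> * (\<integral>x. k x \<partial>stdN)"
    unfolding T_def k_def by (rule tanh_Stein(2)[OF \<mu>])
  also have "\<alpha>\<^sup>2 * (\<integral>x. k x * (\<sigma> * x)\<^sup>2 \<partial>stdN) - c * \<gamma> * (\<sigma> * (\<integral>x. k x \<partial>stdN)) + \<beta>\<^sup>2 * (\<integral>x. k x \<partial>stdN)
     = \<alpha>\<^sup>2 * (\<integral>x. k x * (\<sigma> * x)\<^sup>2 \<partial>stdN) + (\<beta>\<^sup>2 - c * \<gamma> * \<sigma>) * (\<integral>x. k x \<partial>stdN)"
    by (simp add: algebra_simps)
  \<comment> \<open>The decisive cancellation: both \<open>\<beta>^2\<close> and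
    \<open>c * \<gamma> * \<sigma>\<close> contain \<open>1 / q^2\<close>, but their difference is
    \<open>1 - 1 / \<sigma>^2\<close>, which is not positive when \<sigma> is at most 1.\<close>
  also have "\<beta>\<^sup>2 - c * \<gamma> * \<sigma> = \<alpha>"
  proof -
    have "c * \<gamma> * \<sigma> = (1 - q\<^sup>2) / q\<^sup>2"
      using q \<sigma>(1) by (simp add: c_def \<gamma>_def power2_eq_square power3_eq_cube)
    moreover have "\<beta>\<^sup>2 = (\<sigma>\<^sup>2 - q\<^sup>2) / (\<sigma>\<^sup>2 * q\<^sup>2)"
      using \<sigma>(2) by (simp add: \<beta>_def power_divide power_mult_distrib)
    moreover have "(S - P) / (S * P) - (1 - P) / P = 1 - 1 / S" if "S > 0" "P > 0" for S P :: real
      using that by (simp add: field_simps)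
    ultimately show ?thesis
      using q \<sigma>(1) by (simp add: \<alpha>_def)
  qed
  finally show ?thesis unfolding \<alpha>_def k_def .
qed

text \<open>The mixture formula for nonnegative integrals, applied to positive and negative parts.
  Positivity of \<theta> is what passes finiteness from the mixture to its Gaussian
  component.\<close>

lemma BG_integral:
  fixes h :: "real \<Rightarrow> real"
  assumes \<theta>: "0 < \<theta>" "\<theta> < 1" and h: "integrable (BG \<theta>) h"
  shows "integrable stdN h" and "(\<integral>y. h y \<partial>BG \<theta>) = (1 - \<theta>) * h 0 + \<theta> * (\<integral>y. h y \<partial>stdN)"
proof -
  have hm: "h \<in> borel_measurable borel" using h by (simp add: borel_measurable_integrable cong: measurable_cong_sets)
  have part: "(\<integral>\<^sup>+y. ennreal (g y) \<partial>stdN) < \<infinity> \<and> enn2real (\<integral>\<^sup>+y. ennreal (g y) \<partial>BG \<theta>)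
      = (1 - \<theta>) * max 0 (g 0) + \<theta> * enn2real (\<integral>\<^sup>+y. ennreal (g y) \<partial>stdN)"
    if fin: "(\<integral>\<^sup>+y. ennreal (g y) \<partial>BG \<theta>) \<noteq> \<infinity>" and g: "g \<in> borel_measurable borel" for g :: "real \<Rightarrow> real"
  proof -
    have eq: "(\<integral>\<^sup>+y. ennreal (g y) \<partial>BG \<theta>) = ennreal (1 - \<theta>) * ennreal (g 0) + ennreal \<theta> * (\<integral>\<^sup>+y. ennreal (g y) \<partial>stdN)"
      using g \<theta> by (intro nn_integral_BG) auto
    have "(\<integral>\<^sup>+y. ennreal (g y) \<partial>stdN) \<noteq> \<infinity>"
    proof
      assume "(\<integral>\<^sup>+y. ennreal (g y) \<partial>stdN) = \<infinity>"
      then show False using eq fin \<theta> by (simp add: ennreal_mult_top)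
    qed
    moreover have "enn2real (ennreal (1 - \<theta>) * ennreal (g 0) + ennreal \<theta> * (\<integral>\<^sup>+y. ennreal (g y) \<partial>stdN))
       = enn2real (ennreal (1 - \<theta>) * ennreal (g 0)) + enn2real (ennreal \<theta> * (\<integral>\<^sup>+y. ennreal (g y) \<partial>stdN))"
      using calculation by (intro enn2real_plus) (auto simp: ennreal_mult_eq_top_iff less_top[symmetric])
    ultimately show ?thesis
      unfolding eq using \<theta> by (simp add: enn2real_mult less_top[symmetric] max_def ennreal_neg)
  qed
  have fin: "(\<integral>\<^sup>+y. ennreal (h y) \<partial>BG \<theta>) \<noteq> \<infinity>" "(\<integral>\<^sup>+y. ennreal (- h y) \<partial>BG \<theta>) \<noteq> \<infinity>"
    using h by (auto simp: real_integrable_def)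
  note p = part[OF fin(1) hm] part[OF fin(2)]
  show int: "integrable stdN h"
    unfolding real_integrable_def using p hm by (auto simp: less_top)
  have "max 0 (h 0) - max 0 (- h 0) = h 0" by (simp add: max_def)
  then have "(1 - \<theta>) * h 0 = (1 - \<theta>) * max 0 (h 0) - (1 - \<theta>) * max 0 (- h 0)"
    by (metis right_diff_distrib)
  then show "(\<integral>y. h y \<partial>BG \<theta>) = (1 - \<theta>) * h 0 + \<theta> * (\<integral>y. h y \<partial>stdN)"
    using p hm by (simp add: real_lebesgue_integral_def[OF h] real_lebesgue_integral_def[OF int] right_diff_distrib)
qed

text \<open>Signed counterpart of \<open>colM_joint_law\<close>: the planar law is the image of a
  product measure, so Fubini applies, and the atom of the last entry is split from its Gaussian
  part. The order of integration fits the Gaussian pair handled by rotation.\<close>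

lemma colM_joint_law_integral:
  assumes \<theta>: "0 < \<theta>" "\<theta> < 1"
  shows "\<exists>Q :: real pmf. set_pmf Q \<subseteq> {0..dotp m a a} \<and> integrable Q (\<lambda>s. s) \<and> (\<integral>s. s \<partial>Q) = \<theta> * dotp m a a \<and>
    (\<forall>F\<in>borel_measurable (borel \<Otimes>\<^sub>M borel). integrable (colM m \<theta>) (\<lambda>x. F (dotp m a x, x m)) \<longrightarrow>
       integrable Q (\<lambda>s. (1 - \<theta>) * (\<integral>z. F (sqrt s * z, 0) \<partial>stdN) + \<theta> * (\<integral>y. \<integral>z. F (sqrt s * z, y) \<partial>stdN \<partial>stdN)) \<and>
       (\<integral>x. F (dotp m a x, x m) \<partial>colM m \<theta>)
        = (\<integral>s. (1 - \<theta>) * (\<integral>z. F (sqrt s * z, 0) \<partial>stdN) + \<theta> * (\<integral>y. \<integral>z. F (sqrt s * z, y) \<partial>stdN \<partial>stdN) \<partial>Q))"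
proof -
  interpret BG: prob_space "BG \<theta>" by (rule prob_space_BG)
  interpret NB: pair_prob_space stdN "BG \<theta>" ..
  have \<theta>': "0 \<le> \<theta>" "\<theta> \<le> 1" using \<theta> by auto
  from colM_joint_law[OF \<theta>', of m a] obtain Q :: "real pmf" where
    Q: "set_pmf Q \<subseteq> {0..dotp m a a}" "(\<integral>\<^sup>+s. ennreal s \<partial>Q) = ennreal (\<theta> * dotp m a a)"
    "\<And>\<Phi>. \<Phi> \<in> borel_measurable (borel \<Otimes>\<^sub>M borel) \<Longrightarrow> (\<integral>\<^sup>+x. \<Phi> (dotp m a x, x m) \<partial>colM m \<theta>)
        = (\<integral>\<^sup>+s. \<integral>\<^sup>+z. \<integral>\<^sup>+y. \<Phi> (sqrt s * z, y) \<partial>BG \<theta> \<partial>stdN \<partial>Q)"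
    by auto
  interpret QNB: pair_prob_space "measure_pmf Q" "stdN \<Otimes>\<^sub>M BG \<theta>" ..
  have ae: "AE s in Q. 0 \<le> s" using Q(1) by (auto simp: AE_measure_pmf_iff)
  have "has_bochner_integral Q (\<lambda>s. s) (\<theta> * dotp m a a)"
    by (rule has_bochner_integral_nn_integral) (use ae \<theta> Q(2) in auto)
  then have mean: "integrable Q (\<lambda>s. s)" "(\<integral>s. s \<partial>Q) = \<theta> * dotp m a a"
    by (auto simp: has_bochner_integral_iff)
  let ?K = "measure_pmf Q \<Otimes>\<^sub>M (stdN \<Otimes>\<^sub>M BG \<theta>)"
  let ?T = "\<lambda>x. (dotp m a x, x m)" and ?S = "\<lambda>(s, (z, y)). (sqrt s * z, y)"
  have S_meas [measurable]: "?S \<in> measurable ?K (borel \<Otimes>\<^sub>M borel)"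
  proof -
    have 1: "(\<lambda>p. sqrt (fst p)) \<in> borel_measurable ?K"
      by (rule measurable_compose[OF measurable_fst]) simp
    have 2: "(\<lambda>p. fst (snd p)) \<in> borel_measurable ?K"
      using measurable_compose[OF measurable_snd measurable_fst, of "measure_pmf Q" stdN "BG \<theta>"]
      by (simp cong: measurable_cong_sets)
    have 3: "(\<lambda>p. snd (snd p)) \<in> borel_measurable ?K"
      using measurable_compose[OF measurable_snd measurable_snd, of "measure_pmf Q" stdN "BG \<theta>"]
      by (simp cong: measurable_cong_sets)
    show ?thesis
      unfolding case_prod_unfold by (intro measurable_Pair borel_measurable_times 1 2 3)
  qed
  have T_meas [measurable]: "?T \<in> measurable (colM m \<theta>) (borel \<Otimes>\<^sub>M borel)"
    by (intro measurable_Pair measurable_dotp measurable_colM_last)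
  have law: "distr (colM m \<theta>) (borel \<Otimes>\<^sub>M borel) ?T = distr ?K (borel \<Otimes>\<^sub>M borel) ?S"
  proof (rule measure_eqI)
    fix A assume "A \<in> sets (distr (colM m \<theta>) (borel \<Otimes>\<^sub>M borel) ?T)"
    then have A [measurable]: "A \<in> sets (borel \<Otimes>\<^sub>M borel)" by simp
    have "emeasure (distr (colM m \<theta>) (borel \<Otimes>\<^sub>M borel) ?T) A
        = (\<integral>\<^sup>+p. indicator A p \<partial>distr (colM m \<theta>) (borel \<Otimes>\<^sub>M borel) ?T)"
      by (rule nn_integral_indicator[symmetric]) simp
    also have "\<dots> = (\<integral>\<^sup>+x. indicator A (dotp m a x, x m) \<partial>colM m \<theta>)"
      by (rule nn_integral_distr[OF T_meas]) simp
    also have "\<dots> = (\<integral>\<^sup>+s. \<integral>\<^sup>+z. \<integral>\<^sup>+y. indicator A (sqrt s * z, y) \<partial>BG \<theta> \<partial>stdN \<partial>Q)"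
      by (rule Q(3)) simp
    also have "\<dots> = (\<integral>\<^sup>+s. \<integral>\<^sup>+p. indicator A (?S (s, p)) \<partial>(stdN \<Otimes>\<^sub>M BG \<theta>) \<partial>Q)"
    proof (rule nn_integral_cong)
      fix s :: real
      have "(\<lambda>p. indicator A (sqrt s * fst p, snd p) :: ennreal) \<in> borel_measurable (stdN \<Otimes>\<^sub>M BG \<theta>)"
        by measurable
      from BG.nn_integral_fst[OF this]
      show "(\<integral>\<^sup>+z. \<integral>\<^sup>+y. indicator A (sqrt s * z, y) \<partial>BG \<theta> \<partial>stdN)
        = (\<integral>\<^sup>+p. indicator A (?S (s, p)) \<partial>(stdN \<Otimes>\<^sub>M BG \<theta>))"
        by (simp add: case_prod_unfold)
    qed
    also have "\<dots> = (\<integral>\<^sup>+p. indicator A (?S p) \<partial>?K)"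
      by (rule NB.nn_integral_fst[OF measurable_compose[OF S_meas borel_measurable_indicator[OF A]]])
    also have "\<dots> = (\<integral>\<^sup>+p. indicator A p \<partial>distr ?K (borel \<Otimes>\<^sub>M borel) ?S)"
      by (rule nn_integral_distr[OF S_meas, symmetric]) simp
    also have "\<dots> = emeasure (distr ?K (borel \<Otimes>\<^sub>M borel) ?S) A"
      by (rule nn_integral_indicator) simp
    finally show "emeasure (distr (colM m \<theta>) (borel \<Otimes>\<^sub>M borel) ?T) A = emeasure (distr ?K (borel \<Otimes>\<^sub>M borel) ?S) A" .
  qed simp
  have main: "integrable Q (\<lambda>s. (1 - \<theta>) * (\<integral>z. F (sqrt s * z, 0) \<partial>stdN) + \<theta> * (\<integral>y. \<integral>z. F (sqrt s * z, y) \<partial>stdN \<partial>stdN)) \<and>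
       (\<integral>x. F (dotp m a x, x m) \<partial>colM m \<theta>)
        = (\<integral>s. (1 - \<theta>) * (\<integral>z. F (sqrt s * z, 0) \<partial>stdN) + \<theta> * (\<integral>y. \<integral>z. F (sqrt s * z, y) \<partial>stdN \<partial>stdN) \<partial>Q)"
    if F [measurable]: "F \<in> borel_measurable (borel \<Otimes>\<^sub>M borel)" and int: "integrable (colM m \<theta>) (\<lambda>x. F (dotp m a x, x m))"
    for F :: "real \<times> real \<Rightarrow> real"
  proof -
    have "integrable (distr ?K (borel \<Otimes>\<^sub>M borel) ?S) F"
      unfolding law[symmetric] using int by (subst integrable_distr_eq[OF T_meas F])
    then have intK: "integrable ?K (\<lambda>p. F (?S p))"
      by (subst (asm) integrable_distr_eq[OF S_meas F])
    have "(\<integral>x. F (dotp m a x, x m) \<partial>colM m \<theta>) = integral\<^sup>L (distr (colM m \<theta>) (borel \<Otimes>\<^sub>M borel) ?T) F"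
      by (rule integral_distr[OF T_meas F, symmetric])
    also have "\<dots> = (\<integral>p. F (?S p) \<partial>?K)"
      unfolding law by (rule integral_distr[OF S_meas F])
    also have "\<dots> = (\<integral>s. \<integral>p. F (?S (s, p)) \<partial>(stdN \<Otimes>\<^sub>M BG \<theta>) \<partial>Q)"
      by (rule QNB.integral_fst'[OF intK, symmetric])
    finally have eq: "(\<integral>x. F (dotp m a x, x m) \<partial>colM m \<theta>) = (\<integral>s. \<integral>p. F (?S (s, p)) \<partial>(stdN \<Otimes>\<^sub>M BG \<theta>) \<partial>Q)" .
    have inner: "AE s in Q. (\<integral>p. F (?S (s, p)) \<partial>(stdN \<Otimes>\<^sub>M BG \<theta>))
       = (1 - \<theta>) * (\<integral>z. F (sqrt s * z, 0) \<partial>stdN) + \<theta> * (\<integral>y. \<integral>z. F (sqrt s * z, y) \<partial>stdN \<partial>stdN)"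
      using QNB.AE_integrable_fst'[OF intK]
    proof eventually_elim
      case (elim s)
      then have i: "integrable (stdN \<Otimes>\<^sub>M BG \<theta>) (\<lambda>(z, y). F (sqrt s * z, y))" by (simp add: case_prod_unfold)
      have "(\<integral>p. F (?S (s, p)) \<partial>(stdN \<Otimes>\<^sub>M BG \<theta>)) = (\<integral>y. \<integral>z. F (sqrt s * z, y) \<partial>stdN \<partial>BG \<theta>)"
        unfolding NB.integral_snd[OF i] by (simp add: case_prod_unfold)
      also have "\<dots> = (1 - \<theta>) * (\<integral>z. F (sqrt s * z, 0) \<partial>stdN) + \<theta> * (\<integral>y. \<integral>z. F (sqrt s * z, y) \<partial>stdN \<partial>stdN)"
        by (rule BG_integral(2)[OF \<theta> NB.integrable_snd[OF i]])
      finally show ?case .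
    qed
    have "integrable Q (\<lambda>s. \<integral>p. F (?S (s, p)) \<partial>(stdN \<Otimes>\<^sub>M BG \<theta>))"
      by (rule QNB.integrable_fst'[OF intK])
    moreover have "integrable Q (\<lambda>s. \<integral>p. F (?S (s, p)) \<partial>(stdN \<Otimes>\<^sub>M BG \<theta>)) \<longleftrightarrow>
      integrable Q (\<lambda>s. (1 - \<theta>) * (\<integral>z. F (sqrt s * z, 0) \<partial>stdN) + \<theta> * (\<integral>y. \<integral>z. F (sqrt s * z, y) \<partial>stdN \<partial>stdN))"
      by (rule integrable_cong_AE[OF _ _ inner]) simp_all
    moreover have "(\<integral>s. \<integral>p. F (?S (s, p)) \<partial>(stdN \<Otimes>\<^sub>M BG \<theta>) \<partial>Q)
      = (\<integral>s. (1 - \<theta>) * (\<integral>z. F (sqrt s * z, 0) \<partial>stdN) + \<theta> * (\<integral>y. \<integral>z. F (sqrt s * z, y) \<partial>stdN \<partial>stdN) \<partial>Q)"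
      by (rule integral_cong_AE[OF _ _ inner]) simp_all
    ultimately show ?thesis unfolding eq by blast
  qed
  show ?thesis
    using Q(1) mean main by (intro exI[of _ Q]) blast
qed

text \<open>If the last entry vanishes, the contribution is at most \<open>4 * \<mu>\<close>.
  Otherwise it is at most \<open>8 / 10 ^ 7 - (1 - q^2 - s) / 5\<close>, linear in the squared norm
  \<open>s\<close> of \<open>w\<close> on the support, so averaging over the support only needs the
  mean of \<open>s\<close>.\<close>

lemma curvature_mean:
  assumes \<theta>: "0 < \<theta>" "\<theta> < 1 / 2" and \<mu>: "0 < \<mu>" "\<mu> \<le> \<theta> / 10 ^ 7" "\<mu>\<^sup>2 \<le> q ^ 5 / 10 ^ 7" "\<mu> \<le> q"
    and q: "0 < q" "q \<le> 1" and R: "dotp m w w = 1 - q\<^sup>2" "1 / 2500 \<le> 1 - q\<^sup>2"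
  shows "(\<integral>x. curvature_fun \<mu> q (dotp m w x, x m) \<partial>colM m \<theta>) \<le> - (2 * (\<theta> / 100000))"
proof -
  have \<theta>': "0 < \<theta>" "\<theta> < 1" using \<theta> by auto
  have mu1: "\<mu> \<le> 1" using \<mu> q by simp
  let ?C = "curvature_fun \<mu> q"
  have int: "integrable (colM m \<theta>) (\<lambda>x. ?C (dotp m w x, x m))"
    using \<theta> by (intro colM_integrable_quadratic_growth[OF _ _ _ curvature_fun_bound[OF \<mu>(1,4) q]])
       (auto intro!: measurable_compose[OF _ measurable_curvature_fun] measurable_Pair measurable_colM_last)
  from colM_joint_law_integral[OF \<theta>', of m w] obtain Q :: "real pmf" where
    Q: "set_pmf Q \<subseteq> {0..dotp m w w}" "integrable Q (\<lambda>s. s)" "(\<integral>s. s \<partial>Q) = \<theta> * dotp m w w"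
    "integrable Q (\<lambda>s. (1 - \<theta>) * (\<integral>z. ?C (sqrt s * z, 0) \<partial>stdN) + \<theta> * (\<integral>y. \<integral>z. ?C (sqrt s * z, y) \<partial>stdN \<partial>stdN))"
    "(\<integral>x. ?C (dotp m w x, x m) \<partial>colM m \<theta>)
        = (\<integral>s. (1 - \<theta>) * (\<integral>z. ?C (sqrt s * z, 0) \<partial>stdN) + \<theta> * (\<integral>y. \<integral>z. ?C (sqrt s * z, y) \<partial>stdN \<partial>stdN) \<partial>Q)"
    using int measurable_curvature_fun by blast
  have pt: "(1 - \<theta>) * (\<integral>z. ?C (sqrt s * z, 0) \<partial>stdN) + \<theta> * (\<integral>y. \<integral>z. ?C (sqrt s * z, y) \<partial>stdN \<partial>stdN)
      \<le> (4 * \<mu> + \<theta> * (8 / 10 ^ 7)) - \<theta> / 5 * ((1 - q\<^sup>2) - s)" if s: "s \<in> set_pmf Q" for s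
  proof -
    have s01: "0 \<le> s" "s \<le> 1 - q\<^sup>2" using s Q(1) R(1) by auto
    have "(\<integral>z. ?C (sqrt s * z, 0) \<partial>stdN) \<le> (\<integral>z. 4 * \<mu> \<partial>stdN)"
    proof (rule integral_mono)
      show "?C (sqrt s * z, 0) \<le> 4 * \<mu>" for z
        using sechk_mult_sq_le[OF \<mu>(1), of "sqrt s * z"] by (simp add: curvature_fun_def)
      have "\<bar>?C (sqrt s * z, 0)\<bar> \<le> 4 * \<mu>" for z
        using sechk_mult_sq_le[OF \<mu>(1), of "sqrt s * z"] sechk_nonneg[OF \<mu>(1), of "sqrt s * z"]
        by (simp add: curvature_fun_def)
      then show "integrable stdN (\<lambda>z. ?C (sqrt s * z, 0))"
        by (intro stdN_integrable_bounded[of _ "4 * \<mu>"]) (auto intro!: measurable_compose[OF _ measurable_curvature_fun])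
    qed simp
    then have A: "(\<integral>z. ?C (sqrt s * z, 0) \<partial>stdN) \<le> 4 * \<mu>" using stdN.prob_space by simp
    define \<sigma> where "\<sigma> = sqrt (s + q\<^sup>2)"
    have sg: "0 < \<sigma>" "\<sigma>\<^sup>2 = (sqrt s)\<^sup>2 + q\<^sup>2" "\<sigma>\<^sup>2 = s + q\<^sup>2"
      using s01 q by (auto simp: \<sigma>_def add_nonneg_pos)
    have sg1: "\<sigma> \<le> 1" using s01 by (simp add: \<sigma>_def)
    have qsg: "q \<le> \<sigma>" unfolding \<sigma>_def using s01 by (intro real_le_rsqrt) simp
    have intN: "integrable (stdN \<Otimes>\<^sub>M stdN) (\<lambda>(z, y). ?C (sqrt s * z, y))"
    proof (rule Bochner_Integration.integrable_bound)
      note p = NN_product(1)[of "\<lambda>x. x\<^sup>2" "\<lambda>_. 1"] NN_product(1)[of "\<lambda>_. 1" "\<lambda>x. x\<^sup>2"]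
      show "integrable (stdN \<Otimes>\<^sub>M stdN) (\<lambda>z. 6 / (\<mu> * q\<^sup>2) * (1 + (s * (case z of (x, y) \<Rightarrow> x\<^sup>2 * 1) + (case z of (x, y) \<Rightarrow> 1 * y\<^sup>2)) / 2))"
        using p stdN_moments(3) by simp
      show "(\<lambda>(z, y). ?C (sqrt s * z, y)) \<in> borel_measurable (stdN \<Otimes>\<^sub>M stdN)" by measurable
      have "\<bar>?C (sqrt s * x, y)\<bar> \<le> 6 / (\<mu> * q\<^sup>2) * (1 + (s * (x\<^sup>2 * 1) + 1 * y\<^sup>2) / 2)" for x y
        using curvature_fun_bound[OF \<mu>(1,4) q, of "sqrt s * x" y] s01 by (simp add: power_mult_distrib)
      then have "\<bar>?C (sqrt s * x, y)\<bar> \<le> \<bar>6 / (\<mu> * q\<^sup>2) * (1 + (s * (x\<^sup>2 * 1) + 1 * y\<^sup>2) / 2)\<bar>" for x y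
        by (rule order_trans[OF _ abs_ge_self])
      then show "AE z in stdN \<Otimes>\<^sub>M stdN. norm (case z of (z, y) \<Rightarrow> ?C (sqrt s * z, y))
         \<le> norm (6 / (\<mu> * q\<^sup>2) * (1 + (s * (case z of (x, y) \<Rightarrow> x\<^sup>2 * 1) + (case z of (x, y) \<Rightarrow> 1 * y\<^sup>2)) / 2))"
        unfolding real_norm_def by (intro AE_I2) (simp only: split_beta)
    qed
    define K0 where "K0 = (\<integral>x. sechk \<mu> (\<sigma> * x) \<partial>stdN)"
    define K2 where "K2 = (\<integral>x. sechk \<mu> (\<sigma> * x) * (\<sigma> * x)\<^sup>2 \<partial>stdN)"
    have "(\<integral>y. \<integral>z. ?C (sqrt s * z, y) \<partial>stdN \<partial>stdN) = (\<integral>p. ?C (sqrt s * fst p, snd p) \<partial>(stdN \<Otimes>\<^sub>M stdN))"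
      unfolding NN.integral_snd[OF intN] by (simp add: case_prod_unfold)
    also have "\<dots> = (1 - 1 / \<sigma>\<^sup>2)\<^sup>2 * K2 + (1 - 1 / \<sigma>\<^sup>2) * K0"
      unfolding K0_def K2_def by (rule curvature_gaussian_mean[OF \<mu>(1) q(1) sg(1,2)])
    also have "\<dots> \<le> 8 / 10 ^ 7 - 1 / 5 * ((1 - q\<^sup>2) - s)"
    proof -
      have K0: "K0 \<ge> 1 / 5" unfolding K0_def by (rule sechk_mean_lower[OF \<mu>(1) mu1 sg(1) sg1])
      have K2: "K2 \<le> 8 * \<mu>\<^sup>2 / \<sigma>" unfolding K2_def by (rule sechk_sq_mean_upper(2)[OF \<mu>(1) sg(1)])
      have K2': "0 \<le> K2" unfolding K2_def by (intro integral_nonneg_AE AE_I2 mult_nonneg_nonneg sechk_nonneg[OF \<mu>(1)]) auto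
      define r where "r = 1 / \<sigma>\<^sup>2"
      have r1: "r \<ge> 1" using sg1 sg(1) by (simp add: r_def power_le_one)
      \<comment> \<open>The square of \<open>1 / \<sigma>^2\<close> and the factor
        \<open>1 / \<sigma>\<close> of \<open>K2\<close> produce
        \<open>\<mu>^2 / \<sigma> ^ 5\<close>. The worst case \<sigma> = q is the origin of the
        hypothesis on \<open>q ^ 5\<close>.\<close>
      have "(1 - r)\<^sup>2 \<le> r\<^sup>2" using r1 by (simp add: power2_eq_square algebra_simps)
      then have "(1 - r)\<^sup>2 * K2 \<le> r\<^sup>2 * (8 * \<mu>\<^sup>2 / \<sigma>)" using K2 K2' by (intro mult_mono) auto
      also have "\<dots> = 8 * \<mu>\<^sup>2 / \<sigma> ^ 5" by (simp add: r_def power_divide power_mult[symmetric] power_Suc2[symmetric] del: power_Suc)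
      also have "\<dots> \<le> 8 * \<mu>\<^sup>2 / q ^ 5" using qsg q sg by (intro divide_left_mono power_mono) auto
      also have "\<dots> \<le> 8 * (q ^ 5 / 10 ^ 7) / q ^ 5" using \<mu>(3) q by (intro divide_right_mono mult_left_mono) auto
      also have "\<dots> = 8 / 10 ^ 7" using q by simp
      finally have 1: "(1 - r)\<^sup>2 * K2 \<le> 8 / 10 ^ 7" .
      have rK: "(r - 1) * (1 / 5) \<le> (r - 1) * K0" using K0 r1 by (intro mult_left_mono) auto
      \<comment> \<open>\<open>1 / \<sigma>^2 - 1 \<ge> 1 - \<sigma>^2\<close> makes the bound
        linear in \<open>s\<close>.\<close>
      have "1 - q\<^sup>2 - s \<le> r - 1"
      proof -
        have "r - 1 = (1 - \<sigma>\<^sup>2) * r" using sg(1) by (simp add: r_def field_simps)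
        also have "\<dots> \<ge> (1 - \<sigma>\<^sup>2) * 1" using r1 sg1 sg(1) by (intro mult_left_mono) (auto simp: power_le_one)
        finally show ?thesis using sg(3) by simp
      qed
      then have "1 / 5 * ((1 - q\<^sup>2) - s) \<le> (r - 1) * (1 / 5)" by simp
      then have 2: "1 / 5 * ((1 - q\<^sup>2) - s) \<le> (r - 1) * K0" using rK by (rule order_trans)
      have "(1 - r) * K0 = - ((r - 1) * K0)" by (simp add: algebra_simps)
      then have "(1 - r) * K0 \<le> - (1 / 5 * ((1 - q\<^sup>2) - s))" using 2 by (simp only: neg_le_iff_le)
      from add_mono[OF 1 this] show ?thesis unfolding r_def[symmetric] by (simp only: diff_conv_add_uminus)
    qed
    finally have B: "(\<integral>y. \<integral>z. ?C (sqrt s * z, y) \<partial>stdN \<partial>stdN) \<le> 8 / 10 ^ 7 - 1 / 5 * ((1 - q\<^sup>2) - s)" .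
    have "(1 - \<theta>) * (\<integral>z. ?C (sqrt s * z, 0) \<partial>stdN) \<le> 1 * (4 * \<mu>)"
      using A \<theta> \<mu>(1) order_trans[OF mult_left_mono[OF A, of "1 - \<theta>"] mult_right_mono[of "1 - \<theta>" 1 "4 * \<mu>"]] by simp
    moreover have "\<theta> * (\<integral>y. \<integral>z. ?C (sqrt s * z, y) \<partial>stdN \<partial>stdN) \<le> \<theta> * (8 / 10 ^ 7 - 1 / 5 * ((1 - q\<^sup>2) - s))"
      using B \<theta> by (intro mult_left_mono) auto
    ultimately show ?thesis by (simp add: algebra_simps)
  qed
  have "(\<integral>x. ?C (dotp m w x, x m) \<partial>colM m \<theta>)
      \<le> (\<integral>s. (4 * \<mu> + \<theta> * (8 / 10 ^ 7)) - \<theta> / 5 * ((1 - q\<^sup>2) - s) \<partial>Q)"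
    unfolding Q(5) by (rule integral_mono_AE[OF Q(4)]) (use Q(2) pt in \<open>auto simp: AE_measure_pmf_iff\<close>)
  also have "\<dots> = (4 * \<mu> + \<theta> * (8 / 10 ^ 7)) - \<theta> / 5 * ((1 - q\<^sup>2) - \<theta> * (1 - q\<^sup>2))"
    using Q(2,3) R(1) by simp
  \<comment> \<open>The main term is \<open>\<theta> / 25000\<close>, the errors add up to
    \<open>12 * \<theta> / 10 ^ 7\<close>; hence the target
    \<open>2 * \<theta> / 100000\<close>.\<close>
  also have "\<dots> \<le> (4 * (\<theta> / 10 ^ 7) + \<theta> * (8 / 10 ^ 7)) - \<theta> / 5 * (1 / 2 * (1 / 2500))"
  proof (intro diff_mono add_mono mult_left_mono order_refl \<mu>(2))
    have "1 / 2 * (1 / 2500) \<le> (1 - \<theta>) * (1 - q\<^sup>2)" using \<theta> R(2) by (intro mult_mono) auto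
    then show "1 / 2 * (1 / 2500) \<le> (1 - q\<^sup>2) - \<theta> * (1 - q\<^sup>2)" by (simp add: algebra_simps)
  qed (use \<theta> in auto)
  also have "\<dots> \<le> - (2 * (\<theta> / 100000))" using \<theta> by simp
  finally show ?thesis .
qed

lemma HB_curvature_fun:
  assumes "\<mu> > 0" "dotp m w w < 1"
  shows "HB m \<mu> w w w x = curvature_fun \<mu> (lastq m w) (dotp m w x, x m)"
proof -
  define q where "q = lastq m w"
  have q: "q > 0" "dotp m w w = 1 - q\<^sup>2" using assms by (auto simp: q_def lastq_def)
  have alg: "(1 - q\<^sup>2) / q + (1 - q\<^sup>2) * (1 - q\<^sup>2) / q ^ 3 = (1 - q\<^sup>2) / q ^ 3"
    using q(1) by (simp add: field_simps power2_eq_square power3_eq_cube)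
  show ?thesis
    unfolding HB_def curvature_fun_def prod.case qarg_def sechk_def q_def[symmetric] q(2) alg
    by (simp add: power2_eq_square)
qed

text \<open>The bound on \<rho> is the quotient of \<open>\<theta> / 100000\<close> by the growth
  constant \<open>6 / (\<mu> * q^2)\<close>.\<close>

lemma good_family_curvature:
  assumes \<theta>: "0 < \<theta>" "\<theta> < 1 / 2" and \<mu>: "0 < \<mu>" "\<mu> \<le> \<theta> / 10 ^ 7" "\<mu>\<^sup>2 \<le> (lastq m w) ^ 5 / 10 ^ 7" "\<mu> \<le> lastq m w"
    and R: "1 / 2500 \<le> dotp m w w" "dotp m w w < 1" and \<rho>: "\<rho> \<le> \<theta> / 600000 * \<mu> * (lastq m w)\<^sup>2"
  shows "good_family m \<theta> \<rho> (\<lambda>x. - HB m \<mu> w w w x) (\<theta> / 100000)"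
proof -
  define q where "q = lastq m w"
  have q: "q > 0" "dotp m w w = 1 - q\<^sup>2" using R by (auto simp: q_def lastq_def)
  have q1: "q \<le> 1" by (simp add: q_def lastq_def)
  have bound: "\<bar>- HB m \<mu> w w w x\<bar> \<le> 6 / (\<mu> * q\<^sup>2) * (1 + ((dotp m w x)\<^sup>2 + (x m)\<^sup>2) / 2)" for x
    using curvature_fun_bound[OF \<mu>(1) \<mu>(4)[folded q_def] q(1) q1, of "dotp m w x" "x m"]
    by (simp add: HB_curvature_fun[OF \<mu>(1) R(2)] q_def)
  have "(\<integral>x. HB m \<mu> w w w x \<partial>colM m \<theta>) \<le> - (2 * (\<theta> / 100000))"
    unfolding HB_curvature_fun[OF \<mu>(1) R(2)] q_def[symmetric]
    using curvature_mean[OF \<theta> \<mu>(1,2) \<mu>(3,4)[folded q_def] q(1) q1 q(2)] R(1) q(2) by simp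
  then have mean: "(\<integral>x. - HB m \<mu> w w w x \<partial>colM m \<theta>) \<ge> 2 * (\<theta> / 100000)" by simp
  have \<theta>': "0 \<le> \<theta>" "\<theta> \<le> 1" using \<theta> by auto
  have mq: "\<mu> * q\<^sup>2 \<le> 1" "\<mu> * q\<^sup>2 > 0"
    using \<mu> q q1 mult_mono[of \<mu> 1 "q\<^sup>2" 1] by (auto simp: power_le_one q_def[symmetric])
  show ?thesis
    unfolding good_family_def
  proof (intro conjI exI allI)
    show "\<bar>- HB m \<mu> w w w x\<bar> \<le> 6 / (\<mu> * q\<^sup>2) * (1 + ((dotp m w x)\<^sup>2 + (x m)\<^sup>2) / 2)" for x by (rule bound)
    show "(\<integral>\<^sup>+x. ennreal (exp ((dotp m w x)\<^sup>2 / 4)) \<partial>colM m \<theta>) \<le> ennreal (sqrt 2)"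
      by (rule nn_integral_colM_exp_dotp[OF \<theta>']) (use R in simp)
    show "(\<integral>\<^sup>+x. ennreal (exp ((x m)\<^sup>2 / 4)) \<partial>colM m \<theta>) \<le> ennreal (sqrt 2)"
      by (rule nn_integral_colM_exp_last[OF \<theta>']) simp
    have "1 \<le> 6 / (\<mu> * q\<^sup>2)" using mq by (simp add: le_divide_eq)
    then show "\<theta> / 100000 \<le> 6 / (\<mu> * q\<^sup>2)" using \<theta> by simp
    have "\<rho> * (6 / (\<mu> * q\<^sup>2)) \<le> (\<theta> / 600000 * \<mu> * q\<^sup>2) * (6 / (\<mu> * q\<^sup>2))"
      using \<rho> mq by (intro mult_right_mono) (auto simp: q_def)
    also have "\<dots> = \<theta> / 100000" using \<mu> q by simp
    finally show "\<rho> * (6 / (\<mu> * q\<^sup>2)) \<le> \<theta> / 100000" .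
    show "(\<lambda>x. x m) \<in> borel_measurable (colM m \<theta>)" by (rule measurable_colM_last)
  qed (use \<theta> mean in auto)
qed

section \<open>Discretization\<close>

text \<open>
  Sums and products preserve this relation with a larger \<open>k\<close>, so the Lipschitz bounds for \<open>GF\<close> and \<open>HB\<close>
  reduce to adding exponents.
\<close>

definition near :: "real \<Rightarrow> real \<Rightarrow> nat \<Rightarrow> real \<Rightarrow> real \<Rightarrow> bool" where
  "near Y h k a b \<longleftrightarrow> \<bar>a\<bar> \<le> Y ^ k \<and> \<bar>b\<bar> \<le> Y ^ k \<and> \<bar>a - b\<bar> \<le> Y ^ k * h"

locale near_calculus =
  fixes Y h :: real
  assumes Y: "2 \<le> Y" and h: "0 \<le> h"
begin

lemma near_const: "\<bar>a\<bar> \<le> Y ^ k \<Longrightarrow> near Y h k a a"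
  using Y h by (simp add: near_def)

lemma near_mono: "near Y h k a b \<Longrightarrow> k \<le> l \<Longrightarrow> near Y h l a b"
proof -
  assume n: "near Y h k a b" and "k \<le> l"
  then have "Y ^ k \<le> Y ^ l" using Y by (intro power_increasing) auto
  with mult_right_mono[OF this h] n show ?thesis unfolding near_def by linarith
qed

text \<open>\<open>Y \<ge> 2\<close> pays for each factor 2 in a sum or product rule with one more
  exponent.\<close>

lemma double_power_le: "2 * Y ^ k \<le> Y ^ Suc k"
  using Y by (simp add: mult_right_mono)

lemma near_add:
  assumes "near Y h k a b" "near Y h k c d"
  shows "near Y h (Suc k) (a + c) (b + d)"
proof -
  have "\<bar>a + c\<bar> \<le> 2 * Y ^ k" "\<bar>b + d\<bar> \<le> 2 * Y ^ k" "\<bar>(a + c) - (b + d)\<bar> \<le> 2 * Y ^ k * h"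
    using assms unfolding near_def by linarith+
  moreover have "2 * Y ^ k * h \<le> Y ^ Suc k * h" using double_power_le h by (rule mult_right_mono)
  ultimately show ?thesis using double_power_le[of k] unfolding near_def by linarith
qed

lemma near_minus: "near Y h k a b \<Longrightarrow> near Y h k (- a) (- b)"
  unfolding near_def by linarith

lemma near_diff: "near Y h k a b \<Longrightarrow> near Y h k c d \<Longrightarrow> near Y h (Suc k) (a - c) (b - d)"
  using near_add[of k a b "- c" "- d"] near_minus[of k c d] by simp

lemma near_mult:
  assumes "near Y h k a b" "near Y h l c d"
  shows "near Y h (Suc (k + l)) (a * c) (b * d)"
proof -
  have Y0: "Y ^ k \<ge> 0" "Y ^ l \<ge> 0" using Y by auto
  have 1: "\<bar>a * c\<bar> \<le> Y ^ (k + l)" "\<bar>b * d\<bar> \<le> Y ^ (k + l)"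
    unfolding abs_mult power_add using assms Y0 by (auto simp: near_def intro!: mult_mono)
  have "\<bar>a * c - b * d\<bar> = \<bar>(a - b) * c + b * (c - d)\<bar>" by (simp add: algebra_simps)
  also have "\<dots> \<le> \<bar>a - b\<bar> * \<bar>c\<bar> + \<bar>b\<bar> * \<bar>c - d\<bar>" unfolding abs_mult[symmetric] by (rule abs_triangle_ineq)
  also have "\<dots> \<le> (Y ^ k * h) * Y ^ l + Y ^ k * (Y ^ l * h)"
    using assms Y0 h by (intro add_mono mult_mono) (auto simp: near_def)
  also have "\<dots> = 2 * Y ^ (k + l) * h" by (simp add: power_add)
  also have "\<dots> \<le> Y ^ Suc (k + l) * h" using double_power_le h by (rule mult_right_mono)
  finally have "\<bar>a * c - b * d\<bar> \<le> Y ^ Suc (k + l) * h" .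
  then show ?thesis using 1 double_power_le[of "k + l"] Y0 zero_le_power[of Y "k + l"] Y unfolding near_def by linarith
qed

lemma near_dotp:
  assumes "real m \<le> Y" and "\<And>i. i < m \<Longrightarrow> near Y h k (a i * c i) (b i * d i)"
  shows "near Y h (Suc k) (dotp m a c) (dotp m b d)"
proof -
  have c: "real (card {..<m}) * Y ^ k \<le> Y ^ Suc k" using assms(1) Y by (simp add: mult_right_mono)
  have "\<bar>dotp m a c\<bar> \<le> (\<Sum>i<m. Y ^ k)" "\<bar>dotp m b d\<bar> \<le> (\<Sum>i<m. Y ^ k)"
    unfolding dotp_def using assms(2) by (auto intro!: order_trans[OF sum_abs] sum_mono simp: near_def simp del: sum_constant)
  moreover have "\<bar>dotp m a c - dotp m b d\<bar> \<le> (\<Sum>i<m. Y ^ k * h)"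
    unfolding dotp_def sum_subtractf[symmetric] using assms(2)
    by (auto intro!: order_trans[OF sum_abs] sum_mono simp: near_def simp del: sum_constant)
  moreover have "(\<Sum>i<m. Y ^ k * h) \<le> Y ^ Suc k * h"
    using mult_right_mono[OF c h] by (simp add: mult.assoc)
  ultimately show ?thesis using c unfolding near_def by simp
qed

end

text \<open>A single \<open>Y\<close> dominates the dimension, \<open>1 / \<mu>\<close>, the entries
  of the column and \<open>1 / lastq\<close>, so every loss is counted as a power of
  \<open>Y\<close>. \<open>h\<close> is the mesh of the grid.\<close>

locale perturbed_column = near_calculus +
  fixes m :: nat and \<mu> :: real and w w' v v' x :: "nat \<Rightarrow> real"
  assumes mY: "real m \<le> Y" and \<mu>: "0 < \<mu>" "1 / \<mu> \<le> Y"
    and w: "\<And>i. i < m \<Longrightarrow> near Y h 0 (w i) (w' i)"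
    and v: "\<And>i. i < m \<Longrightarrow> near Y h 0 (v i) (v' i)"
    and x: "\<And>i. i \<le> m \<Longrightarrow> \<bar>x i\<bar> \<le> Y"
    and q: "1 / Y \<le> lastq m w" "1 / Y \<le> lastq m w'"
    and w1: "dotp m w w < 1" "dotp m w' w' < 1"
begin

lemma near_x: "i \<le> m \<Longrightarrow> near Y h 1 (x i) (x i)"
  using x by (intro near_const) simp

lemma near_wx: "near Y h 3 (dotp m w x) (dotp m w' x)"
  using near_dotp[OF mY near_mult[OF w near_x]] by (simp add: numeral_3_eq_3)

lemma near_vx: "near Y h 3 (dotp m v x) (dotp m v' x)"
  using near_dotp[OF mY near_mult[OF v near_x]] by (simp add: numeral_3_eq_3)

lemma near_wv: "near Y h 2 (dotp m w v) (dotp m w' v')"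
  using near_dotp[OF mY near_mult[OF w v]] by (simp add: numeral_2_eq_2)

lemma near_vv: "near Y h 2 (dotp m v v) (dotp m v' v')"
  using near_dotp[OF mY near_mult[OF v v]] by (simp add: numeral_2_eq_2)

lemma near_ww: "near Y h 2 (dotp m w w) (dotp m w' w')"
  using near_dotp[OF mY near_mult[OF w w]] by (simp add: numeral_2_eq_2)

text \<open>Difference of squares: \<open>(q - q') * (q + q')\<close> is a difference of squared
  norms, and \<open>q + q'\<close> is at least \<open>1 / Y\<close>, so dividing costs one
  exponent.\<close>

lemma near_q: "near Y h 3 (lastq m w) (lastq m w')"
proof -
  let ?q = "lastq m w" and ?q' = "lastq m w'"
  have Y0: "Y > 0" using Y by simp
  have qp: "?q > 0" "?q' > 0" using q Y0 by (auto intro: less_le_trans[rotated])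
  have q1: "?q \<le> 1" "?q' \<le> 1" by (auto simp: lastq_def)
  have "(?q - ?q') * (?q + ?q') = ?q\<^sup>2 - ?q'\<^sup>2" by (simp add: power2_eq_square algebra_simps)
  also have "\<dots> = dotp m w' w' - dotp m w w" using w1 by (simp add: lastq_def)
  finally have "\<bar>?q - ?q'\<bar> * (?q + ?q') = \<bar>dotp m w w - dotp m w' w'\<bar>"
    using qp by (metis abs_minus_commute abs_mult abs_of_pos add_pos_pos)
  also have "\<dots> \<le> Y ^ 2 * h" using near_ww by (simp add: near_def)
  finally have a: "\<bar>?q - ?q'\<bar> * (?q + ?q') \<le> Y ^ 2 * h" .
  have "1 / Y \<le> ?q + ?q'" using q qp by linarith
  then have "\<bar>?q - ?q'\<bar> * (1 / Y) \<le> \<bar>?q - ?q'\<bar> * (?q + ?q')" by (rule mult_left_mono) simp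
  with a have "\<bar>?q - ?q'\<bar> * (1 / Y) \<le> Y ^ 2 * h" by linarith
  then have "\<bar>?q - ?q'\<bar> \<le> Y ^ 2 * h * Y" using Y0 by (simp add: divide_le_eq)
  then have d: "\<bar>?q - ?q'\<bar> \<le> Y ^ 3 * h" by (simp add: power3_eq_cube power2_eq_square mult_ac)
  have "1 \<le> Y ^ 3" using Y by simp
  then show ?thesis using d q1 qp unfolding near_def by linarith
qed

lemma near_r: "near Y h 5 (1 / lastq m w) (1 / lastq m w')"
proof -
  let ?q = "lastq m w" and ?q' = "lastq m w'"
  have Y0: "Y > 0" using Y by simp
  have qp: "?q > 0" "?q' > 0" using q Y0 by (auto intro: less_le_trans[rotated])
  have r: "1 / ?q \<le> Y" "1 / ?q' \<le> Y" using q qp Y0 by (simp_all add: divide_le_eq mult.commute)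
  have "1 / ?q - 1 / ?q' = (?q' - ?q) * (1 / ?q * (1 / ?q'))" using qp by (simp add: field_simps)
  then have "\<bar>1 / ?q - 1 / ?q'\<bar> = \<bar>?q - ?q'\<bar> * (1 / ?q * (1 / ?q'))"
    using qp by (simp add: abs_mult abs_minus_commute)
  also have "\<dots> \<le> (Y ^ 3 * h) * (Y * Y)"
    using near_q r qp Y h by (intro mult_mono) (auto simp: near_def)
  also have "\<dots> = Y ^ 5 * h" by (simp add: eval_nat_numeral)
  finally have d: "\<bar>1 / ?q - 1 / ?q'\<bar> \<le> Y ^ 5 * h" .
  have "Y ^ 1 \<le> Y ^ 5" using Y by (intro power_increasing) auto
  then have "1 / ?q \<le> Y ^ 5" "1 / ?q' \<le> Y ^ 5" using r by simp_all
  then show ?thesis using d qp unfolding near_def by (simp add: abs_of_pos)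
qed

lemma near_qarg: "near Y h 6 (qarg m w x) (qarg m w' x)"
proof -
  have "near Y h 5 (lastq m w * x m) (lastq m w' * x m)"
    using near_mult[OF near_q near_x[of m]] by (simp add: eval_nat_numeral)
  from near_add[OF near_mono[OF near_wx] this] show ?thesis
    by (simp add: qarg_def eval_nat_numeral)
qed

lemma near_tanh: "near Y h 7 (tanh (qarg m w x / \<mu>)) (tanh (qarg m w' x / \<mu>))"
proof -
  have "\<bar>tanh (qarg m w x / \<mu>) - tanh (qarg m w' x / \<mu>)\<bar> \<le> \<bar>qarg m w x / \<mu> - qarg m w' x / \<mu>\<bar>"
    by (rule tanh_diff_le)
  also have "\<dots> = \<bar>qarg m w x - qarg m w' x\<bar> * (1 / \<mu>)"
    using \<mu>(1) by (simp add: diff_divide_distrib[symmetric])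
  also have "\<dots> \<le> (Y ^ 6 * h) * Y"
    using near_qarg \<mu> h Y by (intro mult_mono) (auto simp: near_def)
  also have "\<dots> = Y ^ 7 * h" by (simp add: eval_nat_numeral)
  finally have "\<bar>tanh (qarg m w x / \<mu>) - tanh (qarg m w' x / \<mu>)\<bar> \<le> Y ^ 7 * h" .
  moreover have "1 \<le> Y ^ 7" using Y by simp
  ultimately show ?thesis
    unfolding near_def using abs_tanh_less_1[of "qarg m w x / \<mu>"] abs_tanh_less_1[of "qarg m w' x / \<mu>"] by linarith
qed

lemma near_tangent:
  "near Y h 11 (dotp m v x - x m * dotp m w v / lastq m w) (dotp m v' x - x m * dotp m w' v' / lastq m w')"
proof -
  have "near Y h 10 (x m * dotp m w v * (1 / lastq m w)) (x m * dotp m w' v' * (1 / lastq m w'))"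
    using near_mult[OF near_mult[OF near_x[of m] near_wv] near_r] by (simp add: eval_nat_numeral)
  from near_diff[OF near_mono[OF near_vx] this] show ?thesis by (simp add: eval_nat_numeral)
qed

lemma near_GF: "near Y h 19 (GF m \<mu> w v x) (GF m \<mu> w' v' x)"
  using near_mult[OF near_tanh near_tangent] unfolding GF_def by (simp add: eval_nat_numeral)

text \<open>The exponent 43 fixes the mesh: with \<open>Y = P^2\<close> it amounts to
  \<open>P ^ 86\<close>, and mesh \<open>1 / P ^ 90\<close> leaves an error
  \<open>1 / P ^ 4\<close>.\<close>

lemma near_HB: "near Y h 43 (HB m \<mu> w v v x) (HB m \<mu> w' v' v' x)"
proof -
  let ?T = "tanh (qarg m w x / \<mu>)" and ?T' = "tanh (qarg m w' x / \<mu>)"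
  let ?q = "lastq m w" and ?q' = "lastq m w'"
  have T2: "near Y h 15 (?T\<^sup>2) (?T'\<^sup>2)"
    using near_mult[OF near_tanh near_tanh] by (simp add: power2_eq_square)
  have "near Y h 15 1 1" using Y by (intro near_const) simp
  from near_diff[OF this T2] have "near Y h 16 (1 - ?T\<^sup>2) (1 - ?T'\<^sup>2)" by simp
  moreover have "near Y h 1 (1 / \<mu>) (1 / \<mu>)" using \<mu> by (intro near_const) simp
  ultimately have K: "near Y h 18 ((1 - ?T\<^sup>2) / \<mu>) ((1 - ?T'\<^sup>2) / \<mu>)"
    using near_mult[of 16 "1 - ?T\<^sup>2" "1 - ?T'\<^sup>2" 1 "1 / \<mu>" "1 / \<mu>"] by simp
  have first: "near Y h 42
     ((1 - ?T\<^sup>2) / \<mu> * (dotp m v x - x m * dotp m w v / ?q) * (dotp m v x - x m * dotp m w v / ?q))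
     ((1 - ?T'\<^sup>2) / \<mu> * (dotp m v' x - x m * dotp m w' v' / ?q') * (dotp m v' x - x m * dotp m w' v' / ?q'))"
    using near_mult[OF near_mult[OF K near_tangent] near_tangent] by simp
  have r3: "near Y h 17 (1 / ?q * (1 / ?q) * (1 / ?q)) (1 / ?q' * (1 / ?q') * (1 / ?q'))"
    using near_mult[OF near_mult[OF near_r near_r] near_r] by simp
  have b2: "near Y h 5 (dotp m w v * dotp m w v) (dotp m w' v' * dotp m w' v')"
    using near_mult[OF near_wv near_wv] by simp
  have "near Y h 23 (dotp m w v * dotp m w v / ?q ^ 3) (dotp m w' v' * dotp m w' v' / ?q' ^ 3)"
    using near_mult[OF b2 r3] by (simp add: power3_eq_cube)
  moreover have "near Y h 8 (dotp m v v / ?q) (dotp m v' v' / ?q')"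
    using near_mult[OF near_vv near_r] by simp
  ultimately have c: "near Y h 24 (dotp m v v / ?q + dotp m w v * dotp m w v / ?q ^ 3)
      (dotp m v' v' / ?q' + dotp m w' v' * dotp m w' v' / ?q' ^ 3)"
    using near_add[OF near_mono[of 8 _ _ 23]] by simp
  have "near Y h 9 (x m * ?T) (x m * ?T')"
    using near_mult[OF near_x[of m] near_tanh] by simp
  from near_mult[OF this c] have second: "near Y h 34 (x m * ?T * (dotp m v v / ?q + dotp m w v * dotp m w v / ?q ^ 3))
      (x m * ?T' * (dotp m v' v' / ?q' + dotp m w' v' * dotp m w' v' / ?q' ^ 3))"
    by simp
  from near_diff[OF first near_mono[OF second]] show ?thesis
    unfolding HB_def by simp
qed

end

section \<open>Rounding to a grid\<close>

definition grid :: "nat \<Rightarrow> nat \<Rightarrow> (nat \<Rightarrow> real) set" where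
  "grid m M = (\<lambda>f i. if i < m then real_of_int (f i) / real M else 0) ` (PiE {..<m} (\<lambda>_. {- int M..int M}))"

lemma finite_grid: "finite (grid m M)"
  unfolding grid_def by (intro finite_imageI finite_PiE) auto

lemma card_grid: "card (grid m M) \<le> (2 * M + 1) ^ m"
proof -
  have "card (grid m M) \<le> card (PiE {..<m} (\<lambda>_. {- int M..int M}))"
    unfolding grid_def by (intro card_image_le finite_PiE) auto
  also have "\<dots> = (2 * M + 1) ^ m" by (simp add: card_PiE nat_add_distrib nat_mult_distrib)
  finally show ?thesis .
qed

text \<open>Rounding towards zero never increases the norm, so upper bounds on \<open>\<parallel>w\<parallel>\<close> survive it.\<close>

definition rtz :: "nat \<Rightarrow> real \<Rightarrow> int" where
  "rtz M t = (if t \<ge> 0 then \<lfloor>t * real M\<rfloor> else \<lceil>t * real M\<rceil>)"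

lemma rtz:
  assumes "M > 0"
  shows "\<bar>real_of_int (rtz M t) / real M\<bar> \<le> \<bar>t\<bar>" "\<bar>t - real_of_int (rtz M t) / real M\<bar> \<le> 1 / real M"
    and "\<bar>t\<bar> \<le> 1 \<Longrightarrow> rtz M t \<in> {- int M..int M}"
proof -
  have M: "real M > 0" using assms by simp
  have "\<bar>real_of_int (rtz M t)\<bar> \<le> \<bar>t * real M\<bar> \<and> \<bar>t * real M - real_of_int (rtz M t)\<bar> \<le> 1"
  proof (cases "t \<ge> 0")
    case True
    then have a: "0 \<le> t * real M" using M by simp
    then have "0 \<le> real_of_int \<lfloor>t * real M\<rfloor>" by simp
    then show ?thesis using True a of_int_floor_le[of "t * real M"] real_of_int_floor_add_one_gt[of "t * real M"]
      unfolding rtz_def by simp linarith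
  next
    case False
    then have a: "t * real M \<le> 0" using M by (simp add: mult_nonpos_nonneg)
    then have "real_of_int \<lceil>t * real M\<rceil> \<le> 0" by simp
    then show ?thesis using False a le_of_int_ceiling[of "t * real M"] of_int_ceiling_le_add_one[of "t * real M"]
      unfolding rtz_def by simp linarith
  qed
  then have 1: "\<bar>real_of_int (rtz M t)\<bar> \<le> \<bar>t\<bar> * real M" and 2: "\<bar>t * real M - real_of_int (rtz M t)\<bar> \<le> 1"
    using M by (auto simp: abs_mult)
  show "\<bar>real_of_int (rtz M t) / real M\<bar> \<le> \<bar>t\<bar>" using 1 M by (simp add: divide_le_eq)
  have "t - real_of_int (rtz M t) / real M = (t * real M - real_of_int (rtz M t)) / real M"
    using M by (simp add: field_simps)
  then show "\<bar>t - real_of_int (rtz M t) / real M\<bar> \<le> 1 / real M"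
    using 2 M by (simp add: divide_right_mono)
  assume "\<bar>t\<bar> \<le> 1"
  then have "\<bar>t\<bar> * real M \<le> 1 * real M" using M by (intro mult_right_mono) auto
  with 1 have "\<bar>real_of_int (rtz M t)\<bar> \<le> real M" by simp
  then show "rtz M t \<in> {- int M..int M}" by (auto simp: abs_le_iff)
qed

definition grid_round :: "nat \<Rightarrow> nat \<Rightarrow> (nat \<Rightarrow> real) \<Rightarrow> nat \<Rightarrow> real" where
  "grid_round m M w = (\<lambda>i. if i < m then real_of_int (rtz M (w i)) / real M else 0)"

lemma grid_round_in_grid:
  assumes "M > 0" "\<And>i. i < m \<Longrightarrow> \<bar>w i\<bar> \<le> 1"
  shows "grid_round m M w \<in> grid m M"
  unfolding grid_def
proof (rule image_eqI[of _ _ "\<lambda>i\<in>{..<m}. rtz M (w i)"])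
  show "grid_round m M w = (\<lambda>i. if i < m then real_of_int ((\<lambda>i\<in>{..<m}. rtz M (w i)) i) / real M else 0)"
    by (auto simp: grid_round_def)
qed (use rtz(3)[OF assms(1)] assms(2) in auto)

lemma abs_component_le:
  assumes "dotp m w w \<le> 1" "i < m"
  shows "\<bar>w i\<bar> \<le> 1"
proof -
  have "w i * w i \<le> dotp m w w" unfolding dotp_def using assms(2) by (intro member_le_sum) auto
  then show ?thesis using assms(1) by (simp add: abs_square_le_1[symmetric] power2_eq_square)
qed

lemma grid_round_near:
  assumes "M > 0" "dotp m w w \<le> 1" "i < m"
  shows "near Y (1 / real M) 0 (w i) (grid_round m M w i)"
  using rtz[OF assms(1), of "w i"] abs_component_le[OF assms(2,3)] assms(3)
  by (simp add: near_def grid_round_def)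

lemma dotp_grid_round_le:
  assumes "M > 0"
  shows "dotp m (grid_round m M w) (grid_round m M w) \<le> dotp m w w"
  unfolding dotp_def
proof (rule sum_mono)
  fix i assume "i \<in> {..<m}"
  then have "\<bar>grid_round m M w i\<bar> \<le> \<bar>w i\<bar>" using rtz(1)[OF assms] by (simp add: grid_round_def)
  then show "grid_round m M w i * grid_round m M w i \<le> w i * w i"
    by (simp add: abs_le_square_iff power2_eq_square)
qed

text \<open>Turns the logarithm of \<open>n / (\<mu> \<theta>)\<close> in the sample size into a logarithm of \<open>p\<close>.\<close>

lemma ln_growth:
  fixes P M N C :: real
  assumes C: "C \<ge> 1" and N: "ln N \<ge> 1" "N > 1" and M: "1 \<le> M" "M \<le> N ^ 3" and P: "P \<ge> 64 * C\<^sup>2 * M * ln N"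
  shows "P \<ge> C * M * ln P"
proof -
  have MN: "1 \<le> M * ln N" using M(1) N(1) mult_mono[of 1 M 1 "ln N"] by simp
  have "64 * C\<^sup>2 * 1 \<le> 64 * C\<^sup>2 * (M * ln N)" using MN by (intro mult_left_mono) auto
  with P have P64: "P \<ge> 64 * C\<^sup>2" by (simp add: mult.assoc)
  have "1 \<le> C\<^sup>2" using C by simp
  with P64 have P0: "P > 1" by linarith
  show ?thesis
  \<comment> \<open>For small \<open>P\<close> the two logarithms are comparable. For large
    \<open>P\<close> let \<open>y\<close> be the eighth root: then \<open>M \<le> y ^ 3\<close> and
    \<open>ln P \<le> 8 * y\<close>, so the product is at most \<open>8 * y ^ 4\<close>, and 64 *
    C^2 is what makes \<open>8 * C \<le> y ^ 4\<close>.\<close>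
  proof (cases "P \<le> N ^ 8")
    case True
    then have "ln P \<le> ln (N ^ 8)" using P0 N by (subst ln_le_cancel_iff) auto
    also have "\<dots> = 8 * ln N" using N by (simp add: ln_realpow)
    finally have "C * M * ln P \<le> C * M * (8 * ln N)" using C M by (intro mult_left_mono) auto
    also have "\<dots> = 8 * C * (M * ln N)" by simp
    also have "\<dots> \<le> 64 * C\<^sup>2 * (M * ln N)"
      using MN C by (intro mult_right_mono) (auto simp: power2_eq_square)
    finally show ?thesis using P by (simp add: mult.assoc)
  next
    case False
    define y where "y = root 8 P"
    have y8: "y ^ 8 = P" using P0 by (simp add: y_def)
    have y0: "y > 0" using P0 by (simp add: y_def)
    have "N \<le> y" by (rule power_le_imp_le_base[of N 7]) (use False y8 y0 in auto)
    then have "M \<le> y ^ 3" using M(2) N power_mono[of N y 3] by linarith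
    moreover have "ln P \<le> 8 * y"
    proof -
      have "ln P = 8 * ln y" unfolding y8[symmetric] using y0 by (simp add: ln_realpow)
      moreover have "ln y \<le> y" using ln_le_minus_one[OF y0] by simp
      ultimately show ?thesis by simp
    qed
    moreover have "0 \<le> ln P" using P0 by simp
    ultimately have "M * ln P \<le> y ^ 3 * (8 * y)" using M y0 by (intro mult_mono) auto
    then have "C * (M * ln P) \<le> C * (8 * y ^ 4)" using C by (intro mult_left_mono) (auto simp: eval_nat_numeral)
    also have "\<dots> = (8 * C) * y ^ 4" by simp
    also have "8 * C \<le> y ^ 4"
    proof (rule power2_le_imp_le)
      show "(8 * C)\<^sup>2 \<le> (y ^ 4)\<^sup>2" using P64 y8 by (simp add: power_mult_distrib power_mult[symmetric])
    qed (use y0 in simp)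
    then have "(8 * C) * y ^ 4 \<le> y ^ 4 * y ^ 4" using y0 by (intro mult_right_mono) auto
    also have "y ^ 4 * y ^ 4 = P" using y8 by (simp add: power_add[symmetric])
    finally show ?thesis by (simp add: mult.assoc)
  qed
qed

section \<open>The good event\<close>

lemma dotp_col: "dotp m v (col m X k) = dotp m v (\<lambda>i. X (i, k))"
  by (rule dotp_cong) (auto simp: col_def)

lemma GF_col: "GF m \<mu> w v (col m X k) = GF m \<mu> w v (\<lambda>i. X (i, k))"
  unfolding GF_def qarg_def dotp_col by (simp add: col_def)

lemma HB_col: "HB m \<mu> w u v (col m X k) = HB m \<mu> w u v (\<lambda>i. X (i, k))"
  unfolding HB_def qarg_def dotp_col by (simp add: col_def)

text \<open>\<open>\<mu>5\<close> is the hypothesis \<mu> < c n^(-5/4), squared to avoid fractional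
  powers: n^(5/2) is the fifth power of \<open>sqrt n\<close>. \<open>p_growth\<close> already
  contains \<open>ln p\<close> instead of the logarithm of n / (\<mu> \<theta>).\<close>

locale regime =
  fixes m p :: nat and \<theta> \<mu> :: real
  assumes m: "m \<ge> 1" and \<theta>: "0 < \<theta>" "\<theta> < 1 / 2" and \<mu>: "0 < \<mu>"
    and \<mu>\<theta>: "\<mu> * real (Suc m) \<le> \<theta> / 10 ^ 7" and \<mu>5: "\<mu>\<^sup>2 * sqrt (real (Suc m)) ^ 5 \<le> 1 / 10 ^ 14"
    and p_large: "10 ^ 18 \<le> real p" and p_growth: "10 ^ 18 * (real (Suc m) ^ 3 / (\<mu> * \<theta>)\<^sup>2) * ln (real p) \<le> real p"
begin

definition N :: real where "N = real (Suc m)"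
definition P :: real where "P = real p"

lemma N2: "N \<ge> 2" using m by (simp add: N_def)

lemma P_large: "10 ^ 18 \<le> P" using p_large by (simp add: P_def)

lemma P0: "P > 0" using P_large by (rule less_le_trans[rotated]) simp

lemma lnP: "ln P \<ge> 1"
proof -
  have "exp 1 \<le> (3 :: real)" by (rule exp_le)
  also have "\<dots> \<le> P" using P_large by (rule order_trans[rotated]) simp
  finally show ?thesis using P0 by (simp add: ln_ge_iff)
qed

lemma mu_small: "\<mu> \<le> \<theta> / 10 ^ 7" "\<mu> \<le> 1 / 10 ^ 7" "\<mu> \<le> 1" "\<mu> * N \<le> 1 / 10 ^ 7"
proof -
  have "\<mu> * 1 \<le> \<mu> * N" using \<mu> N2 by (intro mult_left_mono) auto
  moreover have "\<mu> * N \<le> \<theta> / 10 ^ 7" using \<mu>\<theta> by (simp add: N_def)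
  moreover have "\<theta> / 10 ^ 7 \<le> 1 / 10 ^ 7" using \<theta> by (intro divide_right_mono) auto
  moreover have "(1::real) / 10 ^ 7 \<le> 1" by simp
  ultimately show "\<mu> \<le> \<theta> / 10 ^ 7" "\<mu> \<le> 1 / 10 ^ 7" "\<mu> \<le> 1" "\<mu> * N \<le> 1 / 10 ^ 7" by linarith+
qed

lemma growth: "10 ^ 18 * (N ^ 3 / (\<mu> * \<theta>)\<^sup>2) * ln P \<le> P"
  using p_growth by (simp add: N_def P_def)

text \<open>All three come from \<open>growth\<close>, since N^3 / (\<mu> \<theta>)^2 dominates each
  of the quantities. They are what allows \<open>Y = P^2\<close> in the rounding estimates.\<close>

lemma P_bounds: "N \<le> P" "1 / \<mu> \<le> P" "1 / \<theta> \<le> P"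
proof -
  have mt: "0 < \<mu> * \<theta>" "\<mu> * \<theta> \<le> \<mu>" "\<mu> * \<theta> \<le> \<theta>"
    using \<mu> \<theta> mu_small mult_right_mono[of \<mu> 1 \<theta>] mult_left_mono[of \<theta> 1 \<mu>] by auto
  have mt1: "\<mu> * \<theta> \<le> 1" using mt mu_small by linarith
  define r where "r = 1 / (\<mu> * \<theta>)"
  have r: "r \<ge> 1" "1 / \<mu> \<le> r" "1 / \<theta> \<le> r"
    using mt mt1 \<mu> \<theta> unfolding r_def by (auto intro!: divide_left_mono)
  have N3: "N \<le> N ^ 3" "1 \<le> N ^ 3" using N2 power_increasing[of 1 3 N] by auto
  have r2: "r \<le> r\<^sup>2" "1 \<le> r\<^sup>2" using r power_increasing[of 1 2 r] by auto
  have eq: "N ^ 3 / (\<mu> * \<theta>)\<^sup>2 = N ^ 3 * r\<^sup>2" by (simp add: r_def power_divide)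
  have "N ^ 3 * r\<^sup>2 * 1 \<le> N ^ 3 * r\<^sup>2 * ln P" using lnP N2 by (intro mult_left_mono) auto
  moreover have "1 * (N ^ 3 * r\<^sup>2 * ln P) \<le> 10 ^ 18 * (N ^ 3 * r\<^sup>2 * ln P)"
    using lnP N2 by (intro mult_right_mono) auto
  ultimately have G: "N ^ 3 * r\<^sup>2 \<le> P" using growth unfolding eq by (simp only: mult.assoc)
  have "N ^ 3 * 1 \<le> N ^ 3 * r\<^sup>2" using r2 N2 by (intro mult_left_mono) auto
  moreover have "1 * r\<^sup>2 \<le> N ^ 3 * r\<^sup>2" using N3 by (intro mult_right_mono) auto
  ultimately show "N \<le> P" "1 / \<mu> \<le> P" "1 / \<theta> \<le> P" using G N3 r r2 by linarith+
qed

text \<open>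
  The ratio \<open>\<tau> / L\<close> of the curvature family, the worst of the three: \<open>\<tau> = \<theta> / 10\<^sup>5\<close> against
  \<open>L = 6 / (\<mu> q\<^sub>n\<^sup>2)\<close> with \<open>q\<^sub>n\<^sup>2 \<ge> 1 / (4 n)\<close>.
\<close>

definition \<rho> :: real where "\<rho> = \<theta> * \<mu> / (2400000 * N)"

lemma \<rho>_pos: "\<rho> > 0" using \<theta> \<mu> N2 by (simp add: \<rho>_def)

text \<open>The square of \<rho> cancels N^2 / (\<mu> \<theta>)^2 in \<open>growth\<close>, leaving
  one factor \<open>N\<close>; 10^18 / (2400000^2 * 512) is about 339.\<close>

lemma \<rho>_exponent: "300 * N * ln P \<le> P * (\<rho>\<^sup>2 / 512)"
proof -
  have "P * (\<rho>\<^sup>2 / 512) \<ge> (10 ^ 18 * (N ^ 3 / (\<mu> * \<theta>)\<^sup>2) * ln P) * (\<rho>\<^sup>2 / 512)"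
    using growth by (intro mult_right_mono) auto
  moreover have "(10 ^ 18 * (N ^ 3 / (\<mu> * \<theta>)\<^sup>2) * ln P) * (\<rho>\<^sup>2 / 512) = 10 ^ 18 / (2400000\<^sup>2 * 512) * (N * ln P)"
    using \<theta> \<mu> N2 by (simp add: \<rho>_def field_simps power2_eq_square power3_eq_cube)
  moreover have "300 * (N * ln P) \<le> 10 ^ 18 / (2400000\<^sup>2 * 512) * (N * ln P)"
    using N2 lnP by (intro mult_right_mono) (auto simp: power2_eq_square)
  ultimately show ?thesis by (simp only: mult.assoc)
qed

definition M :: nat where "M = p ^ 90"

lemma M0: "M > 0" using P0 by (simp add: M_def P_def)

lemma real_M: "real M = P ^ 90" by (simp add: M_def P_def)

lemma card_grid_le: "real (card (grid m M)) \<le> exp (91 * N * ln P)"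
proof -
  have P3: "3 \<le> P" using P_large by (rule order_trans[rotated]) simp
  have "real (card (grid m M)) \<le> real ((2 * M + 1) ^ m)" using card_grid of_nat_mono by blast
  also have "\<dots> = (2 * P ^ 90 + 1) ^ m" by (simp add: real_M add.commute)
  also have "\<dots> \<le> (P ^ 91) ^ m"
  proof (rule power_mono)
    have "1 \<le> P ^ 90" using P3 by simp
    then have "2 * P ^ 90 + 1 \<le> 3 * P ^ 90" by linarith
    also have "\<dots> \<le> P * P ^ 90" using P3 by (intro mult_right_mono) auto
    also have "\<dots> = P ^ 91" by (simp add: eval_nat_numeral)
    finally show "2 * P ^ 90 + 1 \<le> P ^ 91" .
  qed (use P0 in simp)
  also have "\<dots> = exp (91 * real m * ln P)"
  proof -
    have "(P ^ 91) ^ m = exp (ln P) ^ (91 * m)" using P0 by (simp add: power_mult)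
    also have "\<dots> = exp (real (91 * m) * ln P)" by (rule exp_of_nat_mult[symmetric])
    finally show ?thesis by simp
  qed
  also have "\<dots> \<le> exp (91 * N * ln P)"
    unfolding exp_le_cancel_iff N_def using lnP by (intro mult_right_mono) auto
  finally show ?thesis .
qed

text \<open>182 = 2 * 91 counts pairs of grid points. The exponent 300 exceeds it by 118, far more
  than the 6 required.\<close>

lemma union_small:
  assumes "c \<le> exp (182 * N * ln P)"
  shows "c * exp (- (real p * (\<rho>\<^sup>2 / 512))) \<le> 1 / P ^ 6"
proof -
  have "c * exp (- (real p * (\<rho>\<^sup>2 / 512))) \<le> exp (182 * N * ln P) * exp (- (300 * N * ln P))"
    using assms \<rho>_exponent by (intro mult_mono) (auto simp: P_def)
  also have "\<dots> = exp (- (118 * N * ln P))" unfolding exp_add[symmetric] by simp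
  also have "\<dots> \<le> exp (- (6 * ln P))"
    unfolding exp_le_cancel_iff neg_le_iff_le using N2 lnP by (intro mult_right_mono) auto
  also have "\<dots> = 1 / P ^ 6"
  proof -
    have "exp (6 * ln P) = P ^ 6" using exp_of_nat_mult[of 6 "ln P"] P0 by simp
    then show ?thesis by (simp add: exp_minus inverse_eq_divide)
  qed
  finally show ?thesis .
qed

text \<open>Threshold for the coordinates of the gradient at 0. With 256^2 = 65536 and ratio
  \<open>t / 4\<close> the tail exponent \<open>P * t^2 / (16 * 512)\<close> is exactly
  \<open>8 * ln P\<close>.\<close>

definition t :: real where "t = 256 * sqrt (ln P / P)"

text \<open>The last inequality is the one that later brings the bound on the minimizer below
  \<open>\<mu> / 16\<close>; it uses that (65536 * 16)^2 is smaller than 10^18.\<close>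

lemma t: "0 < t" "t \<le> 1" "P * (t\<^sup>2 / 16 / 512) = 8 * ln P" "65536 * 16 * sqrt (N * ln P / P) \<le> \<theta>"
proof -
  show "0 < t" using lnP P0 unfolding t_def by (intro mult_pos_pos real_sqrt_gt_zero divide_pos_pos) linarith+
  have lPP: "0 \<le> ln P / P" using lnP P0 by (intro divide_nonneg_pos) linarith+
  then have t2: "t\<^sup>2 = 65536 * (ln P / P)" by (simp add: t_def power_mult_distrib)
  then show "P * (t\<^sup>2 / 16 / 512) = 8 * ln P" using P0 by simp
  have r: "N / \<theta>\<^sup>2 \<le> N ^ 3 / (\<mu> * \<theta>)\<^sup>2"
  proof -
    have "N \<le> N ^ 3" using N2 power_increasing[of 1 3 N] by auto
    moreover have "\<mu>\<^sup>2 \<le> 1" using mu_small \<mu> by (simp add: power_le_one)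
    then have "\<mu>\<^sup>2 * \<theta>\<^sup>2 \<le> 1 * \<theta>\<^sup>2" by (intro mult_right_mono) auto
    ultimately show ?thesis
      using N2 \<theta> \<mu> by (intro frac_le) (auto simp: power_mult_distrib)
  qed
  have "10 ^ 18 * (N / \<theta>\<^sup>2) * ln P \<le> 10 ^ 18 * (N ^ 3 / (\<mu> * \<theta>)\<^sup>2) * ln P"
    using r lnP by (intro mult_right_mono mult_left_mono) auto
  with growth have g: "10 ^ 18 * (N / \<theta>\<^sup>2) * ln P \<le> P" by linarith
  have g': "(65536 * 16)\<^sup>2 * (N * ln P / P) \<le> \<theta>\<^sup>2"
  proof -
    have "10 ^ 18 * (N * ln P) \<le> P * \<theta>\<^sup>2" using g \<theta> by (simp add: field_simps)
    moreover have "(65536 * 16)\<^sup>2 * (N * ln P) \<le> 10 ^ 18 * (N * ln P)"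
      using N2 lnP by (intro mult_right_mono) auto
    ultimately have "(65536 * 16)\<^sup>2 * (N * ln P) \<le> \<theta>\<^sup>2 * P" by (simp add: mult.commute)
    then show ?thesis using P0 by (simp add: pos_divide_le_eq)
  qed
  have nn: "0 \<le> N * ln P / P"
    using N2 lnP P0 by (intro divide_nonneg_pos mult_nonneg_nonneg) linarith+
  show "65536 * 16 * sqrt (N * ln P / P) \<le> \<theta>"
  proof (rule power2_le_imp_le)
    show "(65536 * 16 * sqrt (N * ln P / P))\<^sup>2 \<le> \<theta>\<^sup>2"
      using g' nn by (simp add: power_mult_distrib)
  qed (use \<theta> in simp)
  have "1 * (ln P / P) \<le> N * (ln P / P)" using N2 by (intro mult_right_mono lPP) auto
  then have "t\<^sup>2 \<le> 65536 * (N * ln P / P)" unfolding t2 by simp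
  also have "\<dots> \<le> (65536 * 16)\<^sup>2 * (N * ln P / P)" using nn by (intro mult_right_mono) auto
  also have "\<dots> \<le> \<theta>\<^sup>2" by (rule g')
  also have "\<dots> \<le> 1" using \<theta> by (simp add: power_le_one)
  finally show "t \<le> 1" using \<open>0 < t\<close> by (simp add: abs_square_le_1)
qed

text \<open>On \<Gamma> the last coordinate is at least \<open>1 / (2 * sqrt N)\<close>, so its
  fifth power is at least \<open>1 / (32 * sqrt N ^ 5)\<close>. This is where \<open>\<mu>5\<close>
  becomes the smallness of \<mu>^2 needed for the curvature.\<close>

lemma lastq_lower:
  assumes "dotp m w w \<le> 1 - 1 / (4 * N)"
  shows "1 / (4 * N) \<le> (lastq m w)\<^sup>2" "1 / P\<^sup>2 \<le> lastq m w" "\<mu> \<le> lastq m w" "\<mu>\<^sup>2 \<le> (lastq m w) ^ 5 / 10 ^ 7"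
    "dotp m w w < 1"
proof -
  have N0: "0 < 1 / (4 * N)" using N2 by simp
  show "dotp m w w < 1" using assms N0 by linarith
  then show q2: "1 / (4 * N) \<le> (lastq m w)\<^sup>2" using assms by (simp add: lastq_def)
  have q0: "lastq m w \<ge> 0" using \<open>dotp m w w < 1\<close> by (simp add: lastq_def)
  have ql: "1 / (2 * sqrt N) \<le> lastq m w"
    using q2 q0 N2 by (intro power2_le_imp_le[of "1 / (2 * sqrt N)"]) (auto simp: power_divide power_mult_distrib)
  have sN: "sqrt N \<le> N" using N2 by (intro real_le_lsqrt) (auto simp: power2_eq_square)
  have "1 / (2 * N) \<le> 1 / (2 * sqrt N)" using sN N2 by (intro divide_left_mono) auto
  with ql have qN: "1 / (2 * N) \<le> lastq m w" by linarith
  have "1 / P\<^sup>2 \<le> 1 / (2 * N)"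
  proof (rule divide_left_mono)
    have "2 * N \<le> P * P" using P_bounds P_large N2 by (intro mult_mono) auto
    then show "2 * N \<le> P\<^sup>2" by (simp add: power2_eq_square)
  qed (use N2 P0 in auto)
  with qN show "1 / P\<^sup>2 \<le> lastq m w" by linarith
  have "\<mu> \<le> 1 / (2 * N)" using mu_small(4) N2 by (simp add: field_simps)
  with qN show "\<mu> \<le> lastq m w" by linarith
  have s5: "sqrt N ^ 5 > 0" using N2 by simp
  have "\<mu>\<^sup>2 \<le> 1 / 10 ^ 14 / sqrt N ^ 5"
    using \<mu>5 s5 by (simp add: N_def pos_le_divide_eq)
  also have "\<dots> \<le> (1 / (2 * sqrt N)) ^ 5 / 10 ^ 7"
    using s5 by (simp add: power_divide power_mult_distrib field_simps)
  also have "\<dots> \<le> (lastq m w) ^ 5 / 10 ^ 7" using ql N2 by (intro divide_right_mono power_mono) auto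
  finally show "\<mu>\<^sup>2 \<le> (lastq m w) ^ 5 / 10 ^ 7" .
qed

lemma \<rho>_le: "\<rho> \<le> \<theta> / 384" "\<rho> \<le> \<theta> / 128" "1 / (4 * N) \<le> q2 \<Longrightarrow> \<rho> \<le> \<theta> / 600000 * \<mu> * q2"
proof -
  have "\<rho> = \<theta> / 600000 * \<mu> * (1 / (4 * N))" by (simp add: \<rho>_def)
  also assume "1 / (4 * N) \<le> q2"
  then have "\<theta> / 600000 * \<mu> * (1 / (4 * N)) \<le> \<theta> / 600000 * \<mu> * q2"
    using \<theta> \<mu> by (intro mult_left_mono) auto
  finally show "\<rho> \<le> \<theta> / 600000 * \<mu> * q2" .
next
  have "\<mu> / (2400000 * N) \<le> 1 / 384" using mu_small(3) N2 \<mu> by (intro frac_le) auto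
  then have "\<theta> * (\<mu> / (2400000 * N)) \<le> \<theta> * (1 / 384)" using \<theta> by (intro mult_left_mono) auto
  then show "\<rho> \<le> \<theta> / 384" by (simp add: \<rho>_def)
  then show "\<rho> \<le> \<theta> / 128" using \<theta> by simp
qed

text \<open>The index regions are slightly wider than the target ones (1/36 for 1/32, 1/2500 for
  1/2000, and 1/4 for the squared norm 1 of \<open>v\<close>), because rounding towards zero can
  only shorten a vector.\<close>

definition I1 where "I1 = {(w, v). w \<in> grid m M \<and> v \<in> grid m M \<and> dotp m w w \<le> \<mu>\<^sup>2 / 32 \<and> 1 / 4 \<le> dotp m v v \<and> dotp m v v \<le> 1}"
definition I2 where "I2 = {w \<in> grid m M. \<mu>\<^sup>2 / 36 \<le> dotp m w w \<and> dotp m w w \<le> 1 / 2000}"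
definition I3 where "I3 = {w \<in> grid m M. 1 / 2500 \<le> dotp m w w \<and> dotp m w w \<le> 1 - 1 / (4 * N)}"
definition I4 where "I4 = {..<m} \<times> {-1, 1 :: real}"

definition BGM :: "(nat \<times> nat \<Rightarrow> real) measure" where "BGM = BG_matrix (Suc m) p \<theta>"

definition low_set where
  "low_set I F \<tau> = {X \<in> space BGM. \<exists>\<iota>\<in>I. (\<Sum>k<p. F \<iota> (col m X k)) < real p * \<tau> \<iota> / 2}"

definition E1 where "E1 = low_set I1 (\<lambda>\<iota> x. \<mu> * HB m \<mu> (fst \<iota>) (snd \<iota>) (snd \<iota>) x) (\<lambda>_. \<theta> / 64)"
definition E2 where "E2 = low_set I2 (\<lambda>w. GF m \<mu> w w) (\<lambda>w. \<theta> * vnorm m w / 128)"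
definition E3 where "E3 = low_set I3 (\<lambda>w x. - HB m \<mu> w w w x) (\<lambda>_. \<theta> / 100000)"
definition E4 where "E4 = low_set I4 (\<lambda>\<iota> x. t + snd \<iota> * (tanh (x m / \<mu>) * x (fst \<iota>))) (\<lambda>_. t / 2)"
text \<open>Outside this event the entries are at most \<open>P^2\<close>, as the deterministic
  Lipschitz bounds with \<open>Y = P^2\<close> require.\<close>

definition E0 where "E0 = {X \<in> space BGM. \<exists>j\<in>{..<Suc m} \<times> {..<p}. P\<^sup>2 < \<bar>X j\<bar>}"

lemma fin: "finite I1" "finite I2" "finite I3" "finite I4"
  and card: "real (card I1) \<le> exp (182 * N * ln P)" "real (card I2) \<le> exp (182 * N * ln P)"
     "real (card I3) \<le> exp (182 * N * ln P)" "card I4 = 2 * m"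
proof -
  have s1: "I1 \<subseteq> grid m M \<times> grid m M" by (auto simp: I1_def)
  show "finite I1" by (rule finite_subset[OF s1]) (simp add: finite_grid)
  have s2: "I2 \<subseteq> grid m M" "I3 \<subseteq> grid m M" by (auto simp: I2_def I3_def)
  show "finite I2" "finite I3" using s2 finite_grid by (auto intro: finite_subset)
  show "finite I4" "card I4 = 2 * m" by (auto simp: I4_def card_cartesian_product)
  have "real (card I1) \<le> real (card (grid m M)) * real (card (grid m M))"
    using card_mono[OF _ s1] finite_grid by (simp add: card_cartesian_product flip: of_nat_mult)
  also have "\<dots> \<le> exp (91 * N * ln P) * exp (91 * N * ln P)"
    using card_grid_le by (intro mult_mono) auto
  also have "\<dots> = exp (182 * N * ln P)" unfolding exp_add[symmetric] by simp
  finally show "real (card I1) \<le> exp (182 * N * ln P)" .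
  have "91 * N * ln P \<le> 182 * N * ln P" using N2 lnP by (intro mult_right_mono) auto
  then have "exp (91 * N * ln P) \<le> exp (182 * N * ln P)" by simp
  moreover have "real (card I2) \<le> real (card (grid m M))" "real (card I3) \<le> real (card (grid m M))"
    using card_mono[OF finite_grid s2(1)] card_mono[OF finite_grid s2(2)] by auto
  ultimately show "real (card I2) \<le> exp (182 * N * ln P)" "real (card I3) \<le> exp (182 * N * ln P)"
    using card_grid_le by linarith+
qed

lemma measure_low_set:
  assumes "finite I" "real (card I) \<le> exp (182 * N * ln P)" "\<And>\<iota>. \<iota> \<in> I \<Longrightarrow> good_family m \<theta> \<rho> (F \<iota>) (\<tau> \<iota>)"
  shows "low_set I F \<tau> \<in> sets BGM" "measure BGM (low_set I F \<tau>) \<le> 1 / P ^ 6"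
proof -
  show "low_set I F \<tau> \<in> sets BGM"
    unfolding low_set_def BGM_def by (rule good_family_union_tail(1)[OF assms(1) \<rho>_pos assms(3)])
  have "measure BGM (low_set I F \<tau>) \<le> real (card I) * exp (- (real p * (\<rho>\<^sup>2 / 512)))"
    unfolding low_set_def BGM_def by (rule good_family_union_tail(2)[OF assms(1) \<rho>_pos assms(3)])
  also have "\<dots> \<le> 1 / P ^ 6" by (rule union_small[OF assms(2)])
  finally show "measure BGM (low_set I F \<tau>) \<le> 1 / P ^ 6" .
qed

lemma E1: "E1 \<in> sets BGM" "measure BGM E1 \<le> 1 / P ^ 6"
proof -
  have "good_family m \<theta> \<rho> (\<lambda>x. \<mu> * HB m \<mu> (fst \<iota>) (snd \<iota>) (snd \<iota>) x) (\<theta> / 64)" if "\<iota> \<in> I1" for \<iota>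
    using that \<theta> \<mu> mu_small(2) \<rho>_le(1) by (intro good_family_hessian_near_0) (auto simp: I1_def)
  from measure_low_set[OF fin(1) card(1) this] show "E1 \<in> sets BGM" "measure BGM E1 \<le> 1 / P ^ 6"
    by (simp_all add: E1_def)
qed

lemma vnorm_ge: "0 \<le> a \<Longrightarrow> a\<^sup>2 \<le> dotp m w w \<Longrightarrow> a \<le> vnorm m w"
  unfolding vnorm_eq by (rule real_le_rsqrt)

lemma E2: "E2 \<in> sets BGM" "measure BGM E2 \<le> 1 / P ^ 6"
proof -
  have "good_family m \<theta> \<rho> (GF m \<mu> w w) (\<theta> * vnorm m w / 128)" if "w \<in> I2" for w
  proof (rule good_family_gradient[OF \<theta> \<mu>])
    have "\<mu> / 6 \<le> vnorm m w" using that \<mu> by (intro vnorm_ge) (auto simp: I2_def power_divide)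
    then show "\<mu> \<le> 6 * vnorm m w" by simp
  qed (use that \<rho>_le in \<open>auto simp: I2_def\<close>)
  from measure_low_set[OF fin(2) card(2) this] show "E2 \<in> sets BGM" "measure BGM E2 \<le> 1 / P ^ 6"
    by (simp_all add: E2_def)
qed

lemma E3: "E3 \<in> sets BGM" "measure BGM E3 \<le> 1 / P ^ 6"
proof -
  have "good_family m \<theta> \<rho> (\<lambda>x. - HB m \<mu> w w w x) (\<theta> / 100000)" if "w \<in> I3" for w
  proof -
    have w: "1 / 2500 \<le> dotp m w w" "dotp m w w \<le> 1 - 1 / (4 * N)" using that by (auto simp: I3_def)
    note l = lastq_lower[OF w(2)]
    show ?thesis by (rule good_family_curvature[OF \<theta> \<mu> mu_small(1) l(4,3) w(1) l(5) \<rho>_le(3)[OF l(1)]])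
  qed
  from measure_low_set[OF fin(3) card(3) this] show "E3 \<in> sets BGM" "measure BGM E3 \<le> 1 / P ^ 6"
    by (simp_all add: E3_def)
qed

text \<open>Only \<open>2 * m\<close> functions are involved and their growth constant is 2, so the
  smaller threshold \<open>t\<close> with its own ratio \<open>t / 4\<close> is affordable: each
  tail is \<open>1 / P ^ 8\<close>.\<close>

lemma E4: "E4 \<in> sets BGM" "measure BGM E4 \<le> 2 / P ^ 6"
proof -
  have good: "good_family m \<theta> (t / 4) (\<lambda>x. t + snd \<iota> * (tanh (x m / \<mu>) * x (fst \<iota>))) (t / 2)" if "\<iota> \<in> I4" for \<iota>
    using that \<theta> t(1,2) by (intro good_family_gradient_0) (auto simp: I4_def)
  have t4: "t / 4 > 0" using t(1) by simp
  show "E4 \<in> sets BGM" unfolding E4_def low_set_def BGM_def by (rule good_family_union_tail(1)[OF fin(4) t4 good])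
  have "measure BGM E4 \<le> real (card I4) * exp (- (real p * ((t / 4)\<^sup>2 / 512)))"
    unfolding E4_def low_set_def BGM_def by (rule good_family_union_tail(2)[OF fin(4) t4 good])
  also have "real p * ((t / 4)\<^sup>2 / 512) = 8 * ln P" using t(3) by (simp add: power_divide P_def)
  also have "exp (- (8 * ln P)) = 1 / P ^ 8"
  proof -
    have "exp (8 * ln P) = P ^ 8" using exp_of_nat_mult[of 8 "ln P"] P0 by simp
    then show ?thesis by (simp add: exp_minus inverse_eq_divide)
  qed
  also have "real (card I4) * (1 / P ^ 8) \<le> (2 * P) * (1 / P ^ 8)"
    using P_bounds(1) P0 unfolding card by (intro mult_right_mono) (auto simp: N_def)
  also have "\<dots> = 2 / P ^ 7" using P0 by (simp add: eval_nat_numeral)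
  also have "\<dots> \<le> 2 / P ^ 6"
    using P_large P0 by (intro divide_left_mono power_increasing) auto
  finally show "measure BGM E4 \<le> 2 / P ^ 6" .
qed

lemma E0: "E0 \<in> sets BGM" "measure BGM E0 \<le> 1 / P ^ 6"
proof -
  interpret B: prob_space BGM unfolding BGM_def by (rule prob_space_BG_matrix)
  let ?J = "{..<Suc m} \<times> {..<p}"
  have meas: "(\<lambda>X. X j) \<in> borel_measurable BGM" if "j \<in> ?J" for j
    using measurable_component_singleton[of j ?J "\<lambda>_. BG \<theta>"] that
    by (simp add: BGM_def BG_matrix_def cong: measurable_cong_sets)
  define D where "D j = {X \<in> space BGM. P\<^sup>2 < \<bar>X j\<bar>}" for j
  have D_sets: "D j \<in> sets BGM" if "j \<in> ?J" for j
    unfolding D_def using meas[OF that] by measurable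
  have un: "E0 = (\<Union>j\<in>?J. D j)" by (auto simp: E0_def D_def)
  show "E0 \<in> sets BGM" unfolding un using D_sets by (intro sets.finite_UN) auto
  let ?e = "exp (- (P ^ 4 / 4))"
  have D_meas: "measure BGM (D j) \<le> 2 * ?e" if j: "j \<in> ?J" for j
  proof -
    interpret product_prob_space "\<lambda>_::nat \<times> nat. BG \<theta>" ?J
      by (intro product_prob_spaceI prob_space_BG)
    have "(\<integral>\<^sup>+X. ennreal (exp ((X j)\<^sup>2 / 4)) \<partial>BGM) = (\<integral>\<^sup>+x. ennreal (exp (x\<^sup>2 / 4)) \<partial>distr BGM (BG \<theta>) (\<lambda>X. X j))"
      using meas[OF j] by (subst nn_integral_distr) (auto cong: measurable_cong_sets)
    also have "distr BGM (BG \<theta>) (\<lambda>X. X j) = BG \<theta>"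
      unfolding BGM_def BG_matrix_def using j by (subst PiM_component) auto
    also have "(\<integral>\<^sup>+x. ennreal (exp (x\<^sup>2 / 4)) \<partial>BG \<theta>) \<le> ennreal (sqrt 2)"
      using \<theta> by (intro nn_integral_BG_exp) auto
    finally have mgf: "(\<integral>\<^sup>+X. ennreal (exp ((X j)\<^sup>2 / 4)) \<partial>BGM) \<le> ennreal (sqrt 2)" .
    have "emeasure BGM (D j) = (\<integral>\<^sup>+X. indicator (D j) X \<partial>BGM)" using D_sets[OF j] by simp
    also have "\<dots> \<le> (\<integral>\<^sup>+X. ennreal ?e * ennreal (exp ((X j)\<^sup>2 / 4)) \<partial>BGM)"
    proof (rule nn_integral_mono)
      fix X
      show "indicator (D j) X \<le> ennreal ?e * ennreal (exp ((X j)\<^sup>2 / 4))"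
      proof (cases "X \<in> D j")
        case True
        then have "(P\<^sup>2)\<^sup>2 \<le> \<bar>X j\<bar>\<^sup>2" by (intro power_mono) (auto simp: D_def)
        then have "1 \<le> exp (- (P ^ 4 / 4) + (X j)\<^sup>2 / 4)" by (simp add: power_mult[symmetric])
        then have "ennreal 1 \<le> ennreal (?e * exp ((X j)\<^sup>2 / 4))" unfolding exp_add by (rule ennreal_leI)
        then show ?thesis using True by (simp add: ennreal_mult)
      qed simp
    qed
    also have "\<dots> = ennreal ?e * (\<integral>\<^sup>+X. ennreal (exp ((X j)\<^sup>2 / 4)) \<partial>BGM)"
      using meas[OF j] by (intro nn_integral_cmult) simp
    also have "\<dots> \<le> ennreal ?e * ennreal (sqrt 2)" using mgf by (intro mult_left_mono) auto
    finally have "measure BGM (D j) \<le> ?e * sqrt 2"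
      by (simp add: B.emeasure_eq_measure ennreal_mult[symmetric])
    also have "\<dots> \<le> ?e * 2" by (intro mult_left_mono real_le_lsqrt) auto
    finally show ?thesis by simp
  qed
  have "measure BGM E0 \<le> (\<Sum>j\<in>?J. measure BGM (D j))"
    unfolding un using D_sets by (intro B.finite_measure_subadditive_finite) auto
  also have "\<dots> \<le> (\<Sum>j\<in>?J. 2 * ?e)" by (rule sum_mono[OF D_meas])
  also have "\<dots> = N * P * (2 * ?e)" by (simp add: card_cartesian_product N_def P_def algebra_simps)
  also have "\<dots> \<le> P * P * (2 * ?e)" using P_bounds P0 by (intro mult_right_mono) auto
  \<comment> \<open>The exponential is traded for a power via x \<le> exp x at x = P^4 / 12, cubed.
    Nine powers suffice: two go to the number of entries, and one of the remaining seven to the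
    factor 128.\<close>
  also have "\<dots> \<le> P * P * (2 * (64 / P ^ 8 / P))"
  proof (intro mult_left_mono)
    have "P ^ 4 / 8 \<le> exp (P ^ 4 / 8)" using exp_ge_add_one_self[of "P ^ 4 / 8"] by linarith
    then have "(P ^ 4 / 8)\<^sup>2 \<le> (exp (P ^ 4 / 8))\<^sup>2" using P0 by (intro power_mono) auto
    then have 1: "P ^ 8 / 64 \<le> exp (P ^ 4 / 4)"
      by (simp add: power_divide power_mult[symmetric] exp_double[symmetric])
    have "P ^ 4 / 12 \<le> exp (P ^ 4 / 12)" using exp_ge_add_one_self[of "P ^ 4 / 12"] by linarith
    then have "(P ^ 4 / 12) ^ 3 \<le> (exp (P ^ 4 / 12)) ^ 3" using P0 by (intro power_mono) auto
    then have 2: "P ^ 12 / 1728 \<le> exp (P ^ 4 / 4)"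
      by (simp add: power_divide power_mult[symmetric] exp_of_nat_mult[symmetric])
    have "P ^ 8 * P / 64 \<le> P ^ 12 / 1728"
    proof -
      have "27 \<le> P ^ 3" using P_large power_mono[of 3 P 3] by simp
      then have "27 * P ^ 9 \<le> P ^ 3 * P ^ 9" using P0 by (intro mult_right_mono) auto
      also have "\<dots> = P ^ 12" by (simp add: power_add[symmetric])
      finally show ?thesis by (simp add: eval_nat_numeral)
    qed
    with 2 have 3: "P ^ 8 * P / 64 \<le> exp (P ^ 4 / 4)" by linarith
    have "?e = 1 / exp (P ^ 4 / 4)" by (simp add: exp_minus inverse_eq_divide)
    also have "\<dots> \<le> 1 / (P ^ 8 * P / 64)" using 3 P0 by (intro divide_left_mono) auto
    finally show "?e \<le> 64 / P ^ 8 / P" by simp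
  qed (use P0 in auto)
  also have "\<dots> = 128 / P ^ 7" using P0 by (simp add: eval_nat_numeral)
  also have "\<dots> \<le> P / P ^ 7" using P_large P0 by (intro divide_right_mono) auto
  also have "\<dots> = 1 / P ^ 6" using P0 by (simp add: eval_nat_numeral)
  finally show "measure BGM E0 \<le> 1 / P ^ 6" .
qed

definition good :: "(nat \<times> nat \<Rightarrow> real) set" where
  "good = space BGM - (E0 \<union> E1 \<union> E2 \<union> E3 \<union> E4)"

lemma good: "good \<in> sets BGM" "measure BGM good \<ge> 1 - 6 / P ^ 6"
proof -
  interpret B: prob_space BGM unfolding BGM_def by (rule prob_space_BG_matrix)
  note E = E0(1) E1(1) E2(1) E3(1) E4(1)
  have U: "E0 \<union> E1 \<union> E2 \<union> E3 \<union> E4 \<in> sets BGM" using E by auto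
  then show "good \<in> sets BGM" by (auto simp: good_def)
  have "measure BGM (E0 \<union> E1 \<union> E2 \<union> E3 \<union> E4)
      \<le> measure BGM E0 + measure BGM E1 + measure BGM E2 + measure BGM E3 + measure BGM E4"
    using E by (intro order_trans[OF measure_Un_le] add_mono) auto
  also have "\<dots> \<le> 1 / P ^ 6 + 1 / P ^ 6 + 1 / P ^ 6 + 1 / P ^ 6 + 2 / P ^ 6"
    by (intro add_mono E0 E1 E2 E3 E4)
  also have "\<dots> = 6 / P ^ 6" by simp
  finally show "measure BGM good \<ge> 1 - 6 / P ^ 6"
    unfolding good_def using B.prob_compl[OF U] by simp
qed

end

section \<open>The landscape on the good event\<close>

text \<open>From here on the matrix is fixed and everything is deterministic.\<close>

locale good_sample = regime +
  fixes X :: "nat \<times> nat \<Rightarrow> real"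
  assumes X: "X \<in> good"
begin

lemma X_space: "X \<in> space BGM" using X by (simp add: good_def)

lemma X_bound: "i \<le> m \<Longrightarrow> k < p \<Longrightarrow> \<bar>X (i, k)\<bar> \<le> P\<^sup>2"
proof -
  assume "i \<le> m" "k < p"
  then have "(i, k) \<in> {..<Suc m} \<times> {..<p}" by auto
  moreover have "X \<notin> E0" using X by (simp add: good_def)
  ultimately show ?thesis using X_space unfolding E0_def by (auto simp: not_less)
qed

lemma not_low_setD:
  assumes "X \<notin> low_set I F \<tau>" "\<iota> \<in> I"
  shows "P * \<tau> \<iota> / 2 \<le> (\<Sum>k<p. F \<iota> (col m X k))"
  using assms X_space unfolding low_set_def P_def by (auto simp: not_less)

lemma havg_col: "havg m p \<mu> X w u v = (\<Sum>k<p. HB m \<mu> w u v (col m X k)) / P"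
  unfolding havg_def HB_col P_def by simp

lemma gavg_col: "gavg m p \<mu> X w v = (\<Sum>k<p. GF m \<mu> w v (col m X k)) / P"
  unfolding gavg_def GF_col P_def by simp

lemma sample_hess:
  assumes "w \<in> grid m M" "v \<in> grid m M" "dotp m w w \<le> \<mu>\<^sup>2 / 32" "1 / 4 \<le> dotp m v v" "dotp m v v \<le> 1"
  shows "\<theta> / 128 / \<mu> \<le> havg m p \<mu> X w v v"
proof -
  have "X \<notin> E1" using X by (simp add: good_def)
  from not_low_setD[OF this[unfolded E1_def], of "(w, v)"] assms
  have "P * (\<theta> / 64) / 2 \<le> \<mu> * (\<Sum>k<p. HB m \<mu> w v v (col m X k))"
    by (simp add: I1_def sum_distrib_left)
  then have "\<theta> / 128 \<le> \<mu> * havg m p \<mu> X w v v"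
    unfolding havg_col using P0 by (simp add: field_simps)
  then show ?thesis using \<mu> by (simp add: pos_divide_le_eq mult_ac)
qed

lemma sample_grad:
  assumes "w \<in> grid m M" "\<mu>\<^sup>2 / 36 \<le> dotp m w w" "dotp m w w \<le> 1 / 2000"
  shows "\<theta> * vnorm m w / 256 \<le> gavg m p \<mu> X w w"
proof -
  have "X \<notin> E2" using X by (simp add: good_def)
  from not_low_setD[OF this[unfolded E2_def], of w] assms
  have "P * (\<theta> * vnorm m w / 128) / 2 \<le> (\<Sum>k<p. GF m \<mu> w w (col m X k))"
    by (simp add: I2_def)
  then show ?thesis unfolding gavg_col using P0 by (simp add: le_divide_eq mult.commute)
qed

lemma sample_curv:
  assumes "w \<in> grid m M" "1 / 2500 \<le> dotp m w w" "dotp m w w \<le> 1 - 1 / (4 * N)"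
  shows "havg m p \<mu> X w w w \<le> - (\<theta> / 200000)"
proof -
  have "X \<notin> E3" using X by (simp add: good_def)
  from not_low_setD[OF this[unfolded E3_def], of w] assms
  have "P * (\<theta> / 100000) / 2 \<le> - (\<Sum>k<p. HB m \<mu> w w w (col m X k))"
    by (simp add: I3_def sum_negf)
  moreover have "P * (\<theta> / 100000) / 2 = (\<theta> / 200000) * P" by simp
  ultimately have "(\<Sum>k<p. HB m \<mu> w w w (col m X k)) \<le> - ((\<theta> / 200000) * P)" by linarith
  then have "(\<Sum>k<p. HB m \<mu> w w w (col m X k)) \<le> - (\<theta> / 200000) * P" by (simp only: mult_minus_left)
  then show ?thesis unfolding havg_col using P0 by (simp only: pos_divide_le_eq)
qed

lemma sample_grad0:
  assumes "i < m"
  shows "\<bar>gavg m p \<mu> X (\<lambda>_. 0) (\<lambda>j. if j = i then 1 else 0)\<bar> \<le> t"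
proof -
  let ?e = "\<lambda>j. if j = i then 1 else 0 :: real"
  define S where "S = (\<Sum>k<p. tanh (col m X k m / \<mu>) * col m X k i)"
  have X4: "X \<notin> E4" using X by (simp add: good_def)
  have z: "dotp m (\<lambda>_. 0) y = 0" for y by (simp add: dotp_def)
  have GF0: "GF m \<mu> (\<lambda>_. 0) ?e x = tanh (x m / \<mu>) * x i" for x
    unfolding GF_def qarg_def z dotp_unit[OF assms] by (simp add: lastq_def z)
  have gS: "gavg m p \<mu> X (\<lambda>_. 0) ?e = S / P" unfolding gavg_col GF0 S_def ..
  have "c * S \<ge> - (t * P)" if c: "c \<in> {-1, 1}" for c
  proof -
    have "P * (t / 2) / 2 \<le> (\<Sum>k<p. t + c * (tanh (col m X k m / \<mu>) * col m X k i))"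
      using not_low_setD[OF X4[unfolded E4_def], of "(i, c)"] c assms by (simp add: I4_def)
    also have "\<dots> = t * P + c * S"
      by (simp add: sum.distrib S_def sum_distrib_left P_def mult.commute)
    finally have "P * (t / 2) / 2 \<le> t * P + c * S" .
    moreover have "0 \<le> P * (t / 2) / 2" using P0 t(1) by simp
    ultimately show ?thesis by linarith
  qed
  from this[of 1] this[of "-1"] have "\<bar>S\<bar> \<le> t * P" by simp
  then show ?thesis unfolding gS using P0 by (simp add: abs_le_iff divide_le_eq minus_divide_left)
qed

text \<open>The derivative is linear in the direction and each of its coordinates is at most
  \<open>t\<close> in absolute value; Cauchy-Schwarz turns this into the factor
  \<open>t * sqrt N\<close>.\<close>

lemma gavg0_lower: "gavg m p \<mu> X (\<lambda>_. 0) v \<ge> - (t * sqrt N) * vnorm m v"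
proof -
  have z: "dotp m (\<lambda>_. 0) y = 0" for y by (simp add: dotp_def)
  have lin: "gavg m p \<mu> X (\<lambda>_. 0) v = dotp m v (\<lambda>i. gavg m p \<mu> X (\<lambda>_. 0) (\<lambda>j. if j = i then 1 else 0))"
    using grad_sum_gobj[OF \<mu>, of m "\<lambda>_. 0" v p X] partial_gobj[OF \<mu>, of m "\<lambda>_. 0" _ p X]
    by (simp add: z grad_def dotp_def)
  have "vnorm m (\<lambda>i. gavg m p \<mu> X (\<lambda>_. 0) (\<lambda>j. if j = i then 1 else 0)) \<le> t * sqrt N"
  proof -
    have "(\<Sum>i<m. (gavg m p \<mu> X (\<lambda>_. 0) (\<lambda>j. if j = i then 1 else 0))\<^sup>2) \<le> (\<Sum>i<m. t\<^sup>2)"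
      using sample_grad0 t(1) by (intro sum_mono) (auto simp: abs_le_square_iff[symmetric])
    also have "\<dots> \<le> t\<^sup>2 * N" by (simp add: N_def mult.commute mult_right_mono)
    finally have "vnorm m (\<lambda>i. gavg m p \<mu> X (\<lambda>_. 0) (\<lambda>j. if j = i then 1 else 0)) \<le> sqrt (t\<^sup>2 * N)"
      unfolding vnorm_def by (rule real_sqrt_le_mono)
    then show ?thesis using t(1) by (simp add: real_sqrt_mult)
  qed
  then have "vnorm m v * vnorm m (\<lambda>i. gavg m p \<mu> X (\<lambda>_. 0) (\<lambda>j. if j = i then 1 else 0)) \<le> vnorm m v * (t * sqrt N)"
    by (intro mult_left_mono) auto
  then show ?thesis unfolding lin using dotp_Cauchy_Schwarz[of m v "\<lambda>i. gavg m p \<mu> X (\<lambda>_. 0) (\<lambda>j. if j = i then 1 else 0)"]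
    by (simp add: mult.commute)
qed

section \<open>From grid points to all points\<close>

abbreviation rnd where "rnd \<equiv> grid_round m M"

lemma Y2: "2 \<le> P\<^sup>2"
proof -
  have "2 * 1 \<le> P * P" using P_large by (intro mult_mono) auto
  then show ?thesis by (simp add: power2_eq_square)
qed

lemma near_small: "near (P\<^sup>2) (1 / real M) k a b \<Longrightarrow> k \<le> 43 \<Longrightarrow> \<bar>a - b\<bar> \<le> 1 / P ^ 4"
proof -
  assume n: "near (P\<^sup>2) (1 / real M) k a b" and k: "k \<le> 43"
  have "\<bar>a - b\<bar> \<le> (P\<^sup>2) ^ k * (1 / P ^ 90)" using n by (simp add: near_def real_M)
  also have "\<dots> \<le> (P\<^sup>2) ^ 43 * (1 / P ^ 90)" using Y2 k P0 by (intro mult_right_mono power_increasing) auto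
  also have "\<dots> = 1 / P ^ 4"
  proof -
    have e: "(P\<^sup>2) ^ 43 = P ^ 86" by (simp flip: power_mult)
    have f: "P ^ 90 = P ^ 86 * P ^ 4" by (simp flip: power_add)
    have g: "a * (1 / (a * b)) = 1 / b" if "a \<noteq> 0" for a b :: real using that by simp
    show ?thesis unfolding e f by (rule g) (use P0 in simp)
  qed
  finally show ?thesis .
qed

lemma perturbed:
  assumes "dotp m w w \<le> 1 - 1 / (4 * N)" "dotp m v v \<le> 1" "k < p"
  shows "perturbed_column (P\<^sup>2) (1 / real M) m \<mu> w (rnd w) v (rnd v) (col m X k)"
proof
  note lw = lastq_lower[OF assms(1)]
  have w'1: "dotp m (rnd w) (rnd w) \<le> 1 - 1 / (4 * N)"
    using dotp_grid_round_le[OF M0] assms(1) by (rule order_trans)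
  note lw' = lastq_lower[OF w'1]
  show "2 \<le> P\<^sup>2" by (rule Y2)
  have PP: "P \<le> P\<^sup>2" using P_large P0 power_increasing[of 1 2 P] by simp
  show "real m \<le> P\<^sup>2" using P_bounds(1) PP by (simp add: N_def)
  show "1 / \<mu> \<le> P\<^sup>2" using P_bounds(2) PP by linarith
  show "near (P\<^sup>2) (1 / real M) 0 (w i) (rnd w i)" if "i < m" for i
    using lw(5) by (intro grid_round_near[OF M0 _ that]) simp
  show "near (P\<^sup>2) (1 / real M) 0 (v i) (rnd v i)" if "i < m" for i
    by (rule grid_round_near[OF M0 assms(2) that])
  show "\<bar>col m X k i\<bar> \<le> P\<^sup>2" if "i \<le> m" for i
    using X_bound[OF that assms(3)] that by (simp add: col_def)
qed (use lastq_lower[OF assms(1)] lastq_lower[OF order_trans[OF dotp_grid_round_le[OF M0] assms(1)]] \<mu> in auto)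

lemma average_diff_le:
  fixes a b :: "nat \<Rightarrow> real"
  assumes "\<And>k. k < p \<Longrightarrow> \<bar>a k - b k\<bar> \<le> \<epsilon>"
  shows "\<bar>(\<Sum>k<p. a k) / P - (\<Sum>k<p. b k) / P\<bar> \<le> \<epsilon>"
proof -
  have "\<bar>\<Sum>k<p. a k - b k\<bar> \<le> (\<Sum>k<p. \<epsilon>)"
    using assms by (intro order_trans[OF sum_abs] sum_mono) auto
  then have "\<bar>(\<Sum>k<p. a k) - (\<Sum>k<p. b k)\<bar> \<le> \<epsilon> * P" by (simp add: sum_subtractf P_def mult.commute)
  then have "\<bar>((\<Sum>k<p. a k) - (\<Sum>k<p. b k)) / P\<bar> \<le> \<epsilon>" using P0 by (simp add: divide_le_eq)
  then show ?thesis by (simp add: diff_divide_distrib)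
qed

lemma havg_round:
  assumes "dotp m w w \<le> 1 - 1 / (4 * N)" "dotp m v v \<le> 1"
  shows "\<bar>havg m p \<mu> X w v v - havg m p \<mu> X (rnd w) (rnd v) (rnd v)\<bar> \<le> 1 / P ^ 4"
  unfolding havg_col
  by (intro average_diff_le near_small[OF perturbed_column.near_HB[OF perturbed[OF assms]]]) auto

lemma gavg_round:
  assumes "dotp m w w \<le> 1 - 1 / (4 * N)" "dotp m v v \<le> 1"
  shows "\<bar>gavg m p \<mu> X w v - gavg m p \<mu> X (rnd w) (rnd v)\<bar> \<le> 1 / P ^ 4"
  unfolding gavg_col
  by (intro average_diff_le near_small[OF perturbed_column.near_GF[OF perturbed[OF assms]]]) auto

lemma dotp_round:
  assumes "dotp m v v \<le> 1"
  shows "\<bar>dotp m v v - dotp m (rnd v) (rnd v)\<bar> \<le> 1 / P ^ 4"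
proof -
  interpret near_calculus "P\<^sup>2" "1 / real M" using Y2 by unfold_locales auto
  have "P \<le> P\<^sup>2" using P_large P0 power_increasing[of 1 2 P] by simp
  then have mY: "real m \<le> P\<^sup>2" using P_bounds(1) by (simp add: N_def)
  have n: "near (P\<^sup>2) (1 / real M) 0 (v i) (rnd v i)" if "i < m" for i
    by (rule grid_round_near[OF M0 assms that])
  have "near (P\<^sup>2) (1 / real M) 2 (dotp m v v) (dotp m (rnd v) (rnd v))"
    using near_dotp[OF mY near_mult[OF n n]] by (simp add: numeral_2_eq_2)
  then show ?thesis by (rule near_small) simp
qed

lemma rnd_grid: "dotp m v v \<le> 1 \<Longrightarrow> rnd v \<in> grid m M"
  by (intro grid_round_in_grid[OF M0]) (rule abs_component_le)

text \<open>The rounding error against the three margins. One factor \<open>1 / P^2\<close> is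
  bounded by \<theta>, \<theta> \<mu> or \<mu>^2, the other supplies the numerical constant.\<close>

lemma P4_small: "1 / P ^ 4 \<le> \<theta> / 400000" "1 / P ^ 4 \<le> \<theta> * \<mu> / 10000" "1 / P ^ 4 \<le> \<mu>\<^sup>2 / 288"
proof -
  have P1: "1 \<le> P" and P5: "10 ^ 6 \<le> P" using P_large by (auto intro: order_trans[rotated])
  have th: "1 / P \<le> \<theta>" "1 / P \<le> \<mu>"
    using P_bounds \<theta> \<mu> P0 by (simp_all add: divide_le_eq mult.commute)
  have s: "1 / P ^ 4 = 1 / P * (1 / P) * (1 / P * (1 / P))" by (simp add: eval_nat_numeral)
  have i: "1 / P \<le> 1 / 10 ^ 6" using P5 by (intro divide_left_mono) auto
  have i1: "1 / P \<le> 1" using P1 by simp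
  have pos: "0 < 1 / P" using P0 by simp
  have sm: "1 / P * (1 / P) \<le> 1 / 10 ^ 6 * 1" using i i1 pos by (intro mult_mono) auto
  have A: "1 / P * (1 / P) \<le> \<theta> * 1" using th(1) i1 pos \<theta> P1 by (intro mult_mono) auto
  have "1 / P ^ 4 \<le> (\<theta> * 1) * (1 / 10 ^ 6 * 1)"
    unfolding s by (rule mult_mono[OF A sm]) (use pos \<theta> in auto)
  then show "1 / P ^ 4 \<le> \<theta> / 400000" using \<theta> by simp
  have B: "1 / P * (1 / P) \<le> \<theta> * \<mu>" using th pos \<theta> by (intro mult_mono) auto
  have "1 / P ^ 4 \<le> (\<theta> * \<mu>) * (1 / 10 ^ 6 * 1)"
    unfolding s by (rule mult_mono[OF B sm]) (use pos \<theta> \<mu> in auto)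
  then show "1 / P ^ 4 \<le> \<theta> * \<mu> / 10000" using mult_pos_pos[OF \<theta>(1) \<mu>] by simp
  have C: "1 / P * (1 / P) \<le> \<mu> * \<mu>" using th pos \<mu> by (intro mult_mono) auto
  have "1 / P ^ 4 \<le> (\<mu> * \<mu>) * (1 / 10 ^ 6 * 1)"
    unfolding s by (rule mult_mono[OF C sm]) (use pos \<mu> in auto)
  then show "1 / P ^ 4 \<le> \<mu>\<^sup>2 / 288" using mult_pos_pos[OF \<mu> \<mu>] by (simp add: power2_eq_square)
qed

lemma quarter_N: "1 / (4 * N) \<le> 1 / 8" using N2 by (intro divide_left_mono) auto

text \<open>The grid bound covers directions of norm near 1; quadratic homogeneity in
  \<open>v\<close> extends it to all directions. Rounding consumes half of
  \<open>\<theta> / (128 * \<mu>)\<close>.\<close>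

lemma convex_region:
  assumes w: "dotp m w w \<le> \<mu>\<^sup>2 / 32"
  shows "\<theta> / (256 * \<mu>) * dotp m v v \<le> havg m p \<mu> X w v v"
proof -
  have mu2: "\<mu>\<^sup>2 \<le> 1" using \<mu> mu_small by (simp add: power_le_one)
  have w1: "dotp m w w \<le> 1 - 1 / (4 * N)" using w mu2 quarter_N by linarith
  have unit: "\<theta> / (256 * \<mu>) \<le> havg m p \<mu> X w u u" if u: "dotp m u u = 1" for u
  proof -
    have u1: "dotp m u u \<le> 1" using u by simp
    have "1 / 4 \<le> dotp m (rnd u) (rnd u)"
      using dotp_round[OF u1] P4_small(1) \<theta> u by linarith
    moreover have "dotp m (rnd u) (rnd u) \<le> 1" using dotp_grid_round_le[OF M0, of m u] u by simp
    moreover have "dotp m (rnd w) (rnd w) \<le> \<mu>\<^sup>2 / 32" using dotp_grid_round_le[OF M0] w by (rule order_trans)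
    moreover have "rnd w \<in> grid m M" using w1 N2 by (intro rnd_grid) (auto intro: order_trans)
    ultimately have "\<theta> / 128 / \<mu> \<le> havg m p \<mu> X (rnd w) (rnd u) (rnd u)"
      using rnd_grid[OF u1] by (intro sample_hess)
    moreover have "1 / P ^ 4 \<le> \<theta> / (256 * \<mu>)"
    proof -
      have "\<theta> / 400000 \<le> \<theta> / (256 * \<mu>)" using \<theta> \<mu> mu_small(3) by (intro divide_left_mono) auto
      then show ?thesis using P4_small(1) by linarith
    qed
    moreover have "\<theta> / 128 / \<mu> = \<theta> / (256 * \<mu>) + \<theta> / (256 * \<mu>)" by simp
    ultimately show ?thesis using havg_round[OF w1 u1] by linarith
  qed
  show ?thesis
  proof (cases "dotp m v v = 0")
    case True
    then have "(\<Sum>i<m. v i * v i) = 0" by (simp add: dotp_def)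
    then have "\<forall>i<m. v i = 0" by (subst (asm) sum_nonneg_eq_0_iff) auto
    then have "dotp m v y = 0" for y by (simp add: dotp_def)
    then have "havg m p \<mu> X w v v = 0" by (simp add: havg_def HB_def dotp_commute[of m w])
    then show ?thesis using True by simp
  next
    case False
    define c where "c = vnorm m v"
    have c2: "c\<^sup>2 = dotp m v v" by (simp add: c_def vnorm_sq)
    then have c0: "c \<noteq> 0" using False by auto
    define u where "u = (\<lambda>i. (1 / c) * v i)"
    have uu: "dotp m u u = 1"
      unfolding u_def dotp_scale_left dotp_scale_right c2[symmetric] using c0 by (simp add: power2_eq_square)
    have vu: "v = (\<lambda>i. c * u i)" using c0 by (simp add: u_def)
    have "HB m \<mu> w v v x = c\<^sup>2 * HB m \<mu> w u u x" for x
    proof -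
      have alg: "K * (c * a - xm * (c * b) / q) * (c * a - xm * (c * b) / q) - T * (c * (c * g) / q + c * b * (c * b) / q3)
        = c\<^sup>2 * (K * (a - xm * b / q) * (a - xm * b / q) - T * (g / q + b * b / q3))" for K a xm b q T g q3
        by (simp add: power2_eq_square algebra_simps diff_divide_distrib)
      show ?thesis unfolding vu HB_def dotp_scale_left dotp_scale_right by (rule alg)
    qed
    then have "havg m p \<mu> X w v v = c\<^sup>2 * havg m p \<mu> X w u u"
      by (simp add: havg_def sum_distrib_left[symmetric])
    then show ?thesis unfolding c2[symmetric] using mult_left_mono[OF unit[OF uu], of "c\<^sup>2"] by (simp add: mult.commute)
  qed
qed

text \<open>The claim is relative to the norm of \<open>w\<close>, which rounding at most halves
  here. The additive error is absorbed because the norm is at least \<open>\<mu> / 6\<close>: of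
  \<open>\<theta> / 512\<close> half remains.\<close>

lemma gradient_region:
  assumes w: "\<mu>\<^sup>2 / 32 \<le> dotp m w w" "dotp m w w \<le> 1 / 2000"
  shows "\<theta> / 1024 * vnorm m w \<le> gavg m p \<mu> X w w"
proof -
  have w1: "dotp m w w \<le> 1 - 1 / (4 * N)" "dotp m w w \<le> 1" using w quarter_N by linarith+
  have d: "dotp m w w - \<mu>\<^sup>2 / 288 \<le> dotp m (rnd w) (rnd w)"
    using dotp_round[OF w1(2)] P4_small(3) by linarith
  then have r1: "\<mu>\<^sup>2 / 36 \<le> dotp m (rnd w) (rnd w)" using w by linarith
  have r2: "dotp m (rnd w) (rnd w) \<le> 1 / 2000" using dotp_grid_round_le[OF M0] w(2) by (rule order_trans)
  have g: "\<theta> * vnorm m (rnd w) / 256 \<le> gavg m p \<mu> X (rnd w) (rnd w)"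
    by (rule sample_grad[OF rnd_grid[OF w1(2)] r1 r2])
  have "(vnorm m w / 2)\<^sup>2 \<le> dotp m (rnd w) (rnd w)"
  proof -
    have "(vnorm m w / 2)\<^sup>2 = dotp m w w / 4" by (simp add: power_divide vnorm_sq)
    then show ?thesis using d w(1) dotp_self_nonneg[of m w] by linarith
  qed
  then have half: "vnorm m w / 2 \<le> vnorm m (rnd w)" by (intro vnorm_ge) auto
  have "(\<mu> / 6)\<^sup>2 \<le> dotp m w w"
  proof -
    have "(\<mu> / 6)\<^sup>2 = \<mu>\<^sup>2 / 36" by (simp add: power_divide)
    then show ?thesis using w(1) zero_le_power2[of \<mu>] by linarith
  qed
  then have "\<mu> / 6 \<le> vnorm m w" using \<mu> by (intro vnorm_ge) auto
  then have "\<theta> * (\<mu> / 6) \<le> \<theta> * vnorm m w" using \<theta> by (intro mult_left_mono) auto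
  then have "\<theta> * \<mu> / 10000 \<le> \<theta> * vnorm m w / 1024"
    using mult_pos_pos[OF \<theta>(1) \<mu>] by linarith
  then have "1 / P ^ 4 \<le> \<theta> * vnorm m w / 1024" using P4_small(2) by linarith
  moreover have "\<theta> * (vnorm m w / 2) \<le> \<theta> * vnorm m (rnd w)" using half \<theta> by (intro mult_left_mono) auto
  ultimately have "\<theta> * vnorm m w / 1024 \<le> gavg m p \<mu> X w w"
    using g gavg_round[OF w1] by linarith
  then show ?thesis by simp
qed

lemma curvature_region:
  assumes w: "1 / 2000 \<le> dotp m w w" "dotp m w w \<le> 1 - 1 / (4 * N)"
  shows "havg m p \<mu> X w w w \<le> - (\<theta> / 400000)"
proof -
  have "0 \<le> 1 / (4 * N)" using N2 by simp
  then have w1: "dotp m w w \<le> 1" using w by linarith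
  have "1 / 2500 \<le> dotp m (rnd w) (rnd w)"
    using dotp_round[OF w1] P4_small(1) \<theta> w by linarith
  moreover have "dotp m (rnd w) (rnd w) \<le> 1 - 1 / (4 * N)" using dotp_grid_round_le[OF M0] w(2) by (rule order_trans)
  ultimately have "havg m p \<mu> X (rnd w) (rnd w) (rnd w) \<le> - (\<theta> / 200000)"
    by (rule sample_curv[OF rnd_grid[OF w1]])
  then show ?thesis using havg_round[OF w(2) w1] P4_small(1) by linarith
qed

lemma radii:
  defines "r1 \<equiv> \<mu> / (4 * sqrt 2)" and "r2 \<equiv> 1 / (20 * sqrt 5)" and "r3 \<equiv> sqrt ((4 * N - 1) / (4 * N))"
  shows "0 < r1" "r1 \<le> r2" "r2 < r3" "r3 \<le> 1" "r1\<^sup>2 = \<mu>\<^sup>2 / 32" "r2\<^sup>2 = 1 / 2000" "r3\<^sup>2 = 1 - 1 / (4 * N)" "0 < r2" "0 < r3"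
proof -
  show r1: "0 < r1" and r2: "0 < r2" using \<mu> by (auto simp: r1_def r2_def)
  show s1: "r1\<^sup>2 = \<mu>\<^sup>2 / 32" and s2: "r2\<^sup>2 = 1 / 2000" by (auto simp: r1_def r2_def power_divide power_mult_distrib)
  have eq: "(4 * N - 1) / (4 * N) = 1 - 1 / (4 * N)" using N2 by (simp add: diff_divide_distrib)
  have b: "1 / (4 * N) \<le> 1 / 8" "0 \<le> 1 / (4 * N)" using quarter_N N2 by auto
  show s3: "r3\<^sup>2 = 1 - 1 / (4 * N)" unfolding r3_def eq using b by simp
  show r3: "0 < r3" unfolding r3_def eq using b by simp
  show "r3 \<le> 1" unfolding r3_def eq using b by simp
  have "\<mu>\<^sup>2 \<le> (1 / 10 ^ 7)\<^sup>2" using mu_small(2) \<mu> by (intro power_mono) auto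
  also have "\<dots> \<le> 1 / 2000" by (simp add: power_divide)
  finally have "r1\<^sup>2 \<le> r2\<^sup>2" unfolding s1 s2 using \<mu> by simp
  then show "r1 \<le> r2" using r2 by (auto intro: power2_le_imp_le)
  have "r2\<^sup>2 < r3\<^sup>2" unfolding s2 s3 using b by linarith
  then show "r2 < r3" using r3 by (auto intro: power2_less_imp_less)
qed

lemma vnorm_le_iff: "0 \<le> a \<Longrightarrow> vnorm m w \<le> a \<longleftrightarrow> dotp m w w \<le> a\<^sup>2"
  unfolding vnorm_sq[symmetric] by (simp add: power2_le_iff_abs_le)

lemma le_vnorm_iff: "0 \<le> a \<Longrightarrow> a \<le> vnorm m w \<longleftrightarrow> a\<^sup>2 \<le> dotp m w w"
  unfolding vnorm_sq[symmetric] using abs_le_square_iff[of a "vnorm m w"] by simp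

text \<open>The constant 1/400000 is the smallest of those of the three regions: 1/256, 1/1024 and
  1/400000.\<close>

lemma landscape:
  shows "(\<forall>w \<in> vecs m. vnorm m w \<le> \<mu> / (4 * sqrt 2) \<longrightarrow>
               (\<forall>v. (\<Sum>i<m. \<Sum>j<m. v i * hess (gobj (Suc m) p \<mu> X) w i j * v j)
                      \<ge> 1 / 400000 * \<theta> / \<mu> * (\<Sum>i<m. (v i)\<^sup>2)))" (is ?A)
    and "(\<forall>w \<in> vecs m. \<mu> / (4 * sqrt 2) \<le> vnorm m w \<and> vnorm m w \<le> 1 / (20 * sqrt 5) \<longrightarrow>
               (\<Sum>i<m. w i * grad (gobj (Suc m) p \<mu> X) w i) / vnorm m w \<ge> 1 / 400000 * \<theta>)" (is ?B)
    and "(\<forall>w \<in> vecs m. 1 / (20 * sqrt 5) \<le> vnorm m w \<and>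
                 vnorm m w \<le> sqrt ((4 * real (Suc m) - 1) / (4 * real (Suc m))) \<longrightarrow>
               (\<Sum>i<m. \<Sum>j<m. w i * hess (gobj (Suc m) p \<mu> X) w i j * w j) / (vnorm m w)\<^sup>2
                 \<le> - (1 / 400000) * \<theta>)" (is ?C)
    and "(\<exists>!w. local_min_on m (gobj (Suc m) p \<mu> X) (Gamma (Suc m)) w)" (is ?D)
    and "(\<forall>w. local_min_on m (gobj (Suc m) p \<mu> X) (Gamma (Suc m)) w \<longrightarrow>
               vnorm m w \<le> min (65536 * \<mu> / \<theta> * sqrt (real (Suc m) * ln (real p) / real p)) (\<mu> / 16))" (is ?E)
proof -
  note r = radii
  have lt1: "dotp m w w < 1" if "vnorm m w \<le> sqrt ((4 * N - 1) / (4 * N))" for w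
  proof -
    have "dotp m w w \<le> 1 - 1 / (4 * N)" using that r(9) unfolding r(7)[symmetric] by (subst vnorm_le_iff[symmetric]) auto
    moreover have "0 < 1 / (4 * N)" using N2 by simp
    ultimately show ?thesis by linarith
  qed
  show ?A
  proof (intro ballI impI allI)
    fix w v assume w: "vnorm m w \<le> \<mu> / (4 * sqrt 2)"
    then have w2: "dotp m w w \<le> \<mu>\<^sup>2 / 32" using r(1) unfolding r(5)[symmetric] by (subst vnorm_le_iff[symmetric]) auto
    have "dotp m w w < 1" using lt1 w r by force
    then have "(\<Sum>i<m. \<Sum>j<m. v i * hess (gobj (Suc m) p \<mu> X) w i j * v j) = havg m p \<mu> X w v v"
      by (rule hess_sum_gobj[OF \<mu>])
    also have "\<dots> \<ge> \<theta> / (256 * \<mu>) * dotp m v v" by (rule convex_region[OF w2])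
    also have "1 / 400000 * \<theta> / \<mu> * dotp m v v \<le> \<theta> / (256 * \<mu>) * dotp m v v"
      using \<theta> \<mu> by (intro mult_right_mono) (auto simp: field_simps)
    finally show "1 / 400000 * \<theta> / \<mu> * (\<Sum>i<m. (v i)\<^sup>2) \<le> (\<Sum>i<m. \<Sum>j<m. v i * hess (gobj (Suc m) p \<mu> X) w i j * v j)"
      by (simp add: dotp_def power2_eq_square)
  qed
  have gr: "\<theta> / 1024 * vnorm m w \<le> gavg m p \<mu> X w w" "0 < vnorm m w"
    if "\<mu> / (4 * sqrt 2) \<le> vnorm m w" "vnorm m w \<le> 1 / (20 * sqrt 5)" for w
  proof -
    have "\<mu>\<^sup>2 / 32 \<le> dotp m w w" using that(1) r(1) unfolding r(5)[symmetric] by (subst le_vnorm_iff[symmetric]) auto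
    moreover have "dotp m w w \<le> 1 / 2000" using that(2) r(8) unfolding r(6)[symmetric] by (subst vnorm_le_iff[symmetric]) auto
    ultimately show "\<theta> / 1024 * vnorm m w \<le> gavg m p \<mu> X w w" by (rule gradient_region)
    show "0 < vnorm m w" using that(1) r(1) by linarith
  qed
  show ?B
  proof (intro ballI impI)
    fix w assume w: "\<mu> / (4 * sqrt 2) \<le> vnorm m w \<and> vnorm m w \<le> 1 / (20 * sqrt 5)"
    have "dotp m w w < 1" using lt1 w r by force
    then have eq: "(\<Sum>i<m. w i * grad (gobj (Suc m) p \<mu> X) w i) = gavg m p \<mu> X w w"
      by (rule grad_sum_gobj[OF \<mu>])
    have "1 / 400000 * \<theta> \<le> \<theta> / 1024" using \<theta> by simp
    also have "\<dots> \<le> gavg m p \<mu> X w w / vnorm m w" using gr[of w] w by (simp add: pos_le_divide_eq)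
    finally show "1 / 400000 * \<theta> \<le> (\<Sum>i<m. w i * grad (gobj (Suc m) p \<mu> X) w i) / vnorm m w" unfolding eq .
  qed
  have cu: "havg m p \<mu> X w w w \<le> - (\<theta> / 400000)"
    if "1 / (20 * sqrt 5) \<le> vnorm m w" "vnorm m w \<le> sqrt ((4 * N - 1) / (4 * N))" for w
  proof -
    have "1 / 2000 \<le> dotp m w w" using that(1) r(8) unfolding r(6)[symmetric] by (subst le_vnorm_iff[symmetric]) auto
    moreover have "dotp m w w \<le> 1 - 1 / (4 * N)" using that(2) r(9) unfolding r(7)[symmetric] by (subst vnorm_le_iff[symmetric]) auto
    ultimately show ?thesis by (rule curvature_region)
  qed
  show ?C
  proof (intro ballI impI)
    fix w assume "1 / (20 * sqrt 5) \<le> vnorm m w \<and> vnorm m w \<le> sqrt ((4 * real (Suc m) - 1) / (4 * real (Suc m)))"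
    then have w: "1 / (20 * sqrt 5) \<le> vnorm m w" "vnorm m w \<le> sqrt ((4 * N - 1) / (4 * N))" by (auto simp: N_def)
    note l = lt1[OF w(2)]
    have eq: "(\<Sum>i<m. \<Sum>j<m. w i * hess (gobj (Suc m) p \<mu> X) w i j * w j) = havg m p \<mu> X w w w"
      by (rule hess_sum_gobj[OF \<mu> l])
    have v0: "0 < dotp m w w" using w(1) r(8) le_vnorm_iff[of "1 / (20 * sqrt 5)" w] unfolding r(6) by simp
    have "havg m p \<mu> X w w w \<le> - (\<theta> / 400000)" by (rule cu[OF w])
    \<comment> \<open>The squared norm is below 1, so multiplying by it only raises the negative
      bound; this permits the division by the squared norm.\<close>
    also have "\<dots> \<le> - (1 / 400000) * \<theta> * dotp m w w"
      using mult_left_mono[of "dotp m w w" 1 "\<theta> / 400000"] l \<theta> by simp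
    finally show "(\<Sum>i<m. \<Sum>j<m. w i * hess (gobj (Suc m) p \<mu> X) w i j * w j) / (vnorm m w)\<^sup>2 \<le> - (1 / 400000) * \<theta>"
      unfolding eq vnorm_sq using v0 by (simp add: pos_divide_le_eq)
  qed
  have Gam: "Gamma (Suc m) = {w \<in> vecs m. vnorm m w < sqrt ((4 * N - 1) / (4 * N))}"
    by (simp add: Gamma_def N_def)
  have kp: "0 < \<theta> / (256 * \<mu>)" using \<theta> \<mu> by simp
  have ts: "0 \<le> t * sqrt N" using t(1) N2 by simp
  have h1: "havg m p \<mu> X w v v \<ge> \<theta> / (256 * \<mu>) * dotp m v v" if "vnorm m w \<le> \<mu> / (4 * sqrt 2)" for w v
  proof (rule convex_region)
    show "dotp m w w \<le> \<mu>\<^sup>2 / 32" using that r(1) unfolding r(5)[symmetric] by (subst vnorm_le_iff[symmetric]) auto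
  qed
  have h2: "gavg m p \<mu> X w w > 0" if "\<mu> / (4 * sqrt 2) \<le> vnorm m w" "vnorm m w \<le> 1 / (20 * sqrt 5)" for w
    using less_le_trans[OF mult_pos_pos[OF _ gr(2)[OF that]] gr(1)[OF that]] \<theta> by simp
  have h3: "havg m p \<mu> X w w w < 0" if "1 / (20 * sqrt 5) \<le> vnorm m w" "vnorm m w < sqrt ((4 * N - 1) / (4 * N))" for w
    using cu[OF that(1) less_imp_le[OF that(2)]] \<theta> by simp
  note U = unique_local_min[OF \<mu> r(1-4) kp h1 h2 h3 ts gavg0_lower]
  show ?D unfolding Gam by (rule U(1))
  show ?E
  proof (intro allI impI)
    fix w assume lm: "local_min_on m (gobj (Suc m) p \<mu> X) (Gamma (Suc m)) w"
    \<comment> \<open>The gradient bound \<open>t * sqrt N\<close> over the modulus of convexity;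
      65536 is 256 from \<open>t\<close> times 256 from the modulus.\<close>
    have le: "vnorm m w \<le> t * sqrt N / (\<theta> / (256 * \<mu>))"
      by (rule U(2), (assumption | rule lm[unfolded Gam])+)
    have "t * sqrt N = 256 * sqrt (N * ln P / P)"
      by (simp add: t_def real_sqrt_mult[symmetric] mult.commute)
    then have eq: "t * sqrt N / (\<theta> / (256 * \<mu>)) = 65536 * \<mu> / \<theta> * sqrt (N * ln P / P)" by simp
    have "65536 * \<mu> / \<theta> * sqrt (N * ln P / P) = \<mu> / (16 * \<theta>) * (65536 * 16 * sqrt (N * ln P / P))" by simp
    also have "\<dots> \<le> \<mu> / (16 * \<theta>) * \<theta>" using t(4) \<mu> \<theta> by (intro mult_left_mono) auto
    also have "\<dots> = \<mu> / 16" using \<theta> by simp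
    finally show "vnorm m w \<le> min (65536 * \<mu> / \<theta> * sqrt (real (Suc m) * ln (real p) / real p)) (\<mu> / 16)"
      using le unfolding eq by (simp add: N_def P_def)
  qed
qed

end

theorem mainTheorem1:
  "\<exists>c\<^sub>s C c\<^sub>a c\<^sub>b c\<^sub>c :: real. c\<^sub>s > 0 \<and> C > 0 \<and> c\<^sub>a > 0 \<and> c\<^sub>b > 0 \<and> c\<^sub>c > 0 \<and>
    (\<forall>(n::nat) (p::nat) (\<theta>::real) (\<mu>::real).
      n \<ge> 2 \<and> 0 < \<theta> \<and> \<theta> < 1/2 \<and> 0 < \<mu> \<and> \<mu> < c\<^sub>a * min (\<theta> / real n) (real n powr (-5/4)) \<and>
      real p \<ge> C / (\<mu>\<^sup>2 * \<theta>\<^sup>2) * real n ^ 3 * ln (real n / (\<mu> * \<theta>)) \<longrightarrow>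
      (\<exists>A \<in> sets (BG_matrix n p \<theta>).
         measure (BG_matrix n p \<theta>) A \<ge> 1 - c\<^sub>b / real p ^ 6 \<and>
         (\<forall>X \<in> A.
            (\<forall>w \<in> vecs (n - 1). vnorm (n - 1) w \<le> \<mu> / (4 * sqrt 2) \<longrightarrow>
               (\<forall>v. (\<Sum>i<n - 1. \<Sum>j<n - 1. v i * hess (gobj n p \<mu> X) w i j * v j)
                      \<ge> c\<^sub>s * \<theta> / \<mu> * (\<Sum>i<n - 1. (v i)\<^sup>2))) \<and>
            (\<forall>w \<in> vecs (n - 1). \<mu> / (4 * sqrt 2) \<le> vnorm (n - 1) w \<and> vnorm (n - 1) w \<le> 1 / (20 * sqrt 5) \<longrightarrow>
               (\<Sum>i<n - 1. w i * grad (gobj n p \<mu> X) w i) / vnorm (n - 1) w \<ge> c\<^sub>s * \<theta>) \<and>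
            (\<forall>w \<in> vecs (n - 1). 1 / (20 * sqrt 5) \<le> vnorm (n - 1) w \<and>
                 vnorm (n - 1) w \<le> sqrt ((4 * real n - 1) / (4 * real n)) \<longrightarrow>
               (\<Sum>i<n - 1. \<Sum>j<n - 1. w i * hess (gobj n p \<mu> X) w i j * w j) / (vnorm (n - 1) w)\<^sup>2
                 \<le> - c\<^sub>s * \<theta>) \<and>
            (\<exists>!w\<^sub>s. local_min_on (n - 1) (gobj n p \<mu> X) (Gamma n) w\<^sub>s) \<and>
            (\<forall>w\<^sub>s. local_min_on (n - 1) (gobj n p \<mu> X) (Gamma n) w\<^sub>s \<longrightarrow>
               vnorm (n - 1) w\<^sub>s \<le> min (c\<^sub>c * \<mu> / \<theta> * sqrt (real n * ln (real p) / real p)) (\<mu> / 16)))))"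
\<comment> \<open>The second witness is the factor \<open>64 * C^2\<close> of
  \<open>ln_growth\<close> at \<open>C = 10 ^ 18\<close>. The probability constant 6 adds four
  events of measure at most \<open>1 / p ^ 6\<close> and one of at most
  \<open>2 / p ^ 6\<close>.\<close>
proof (rule exI[of _ "1 / 400000"], rule exI[of _ "64 * (10 ^ 18)\<^sup>2"], rule exI[of _ "1 / 10 ^ 7"],
    rule exI[of _ 6], rule exI[of _ 65536], intro conjI allI impI)
  fix n p :: nat and \<theta> \<mu> :: real
  assume *: "n \<ge> 2 \<and> 0 < \<theta> \<and> \<theta> < 1/2 \<and> 0 < \<mu> \<and> \<mu> < 1 / 10 ^ 7 * min (\<theta> / real n) (real n powr (-5/4)) \<and>
      real p \<ge> 64 * (10 ^ 18)\<^sup>2 / (\<mu>\<^sup>2 * \<theta>\<^sup>2) * real n ^ 3 * ln (real n / (\<mu> * \<theta>))"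
  then obtain m where m: "n = Suc m" "m \<ge> 1" by (cases n) auto
  define N where "N = real n"
  have N2: "N \<ge> 2" using * by (simp add: N_def)
  have th: "0 < \<theta>" "\<theta> < 1 / 2" and mu: "0 < \<mu>" using * by auto
  have mu': "\<mu> < 1 / 10 ^ 7 * min (\<theta> / N) (N powr (-5/4))" using * by (simp add: N_def)
  have "1 / 10 ^ 7 * min (\<theta> / N) (N powr (-5/4)) \<le> 1 / 10 ^ 7 * (\<theta> / N)"
    "1 / 10 ^ 7 * min (\<theta> / N) (N powr (-5/4)) \<le> 1 / 10 ^ 7 * (N powr (-5/4))"
    by (intro mult_left_mono; simp)+
  with mu' have a: "\<mu> \<le> 1 / 10 ^ 7 * (\<theta> / N)" and b: "\<mu> \<le> 1 / 10 ^ 7 * (N powr (-5/4))" by linarith+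
  have muN: "\<mu> * N \<le> \<theta> / 10 ^ 7" using a N2 by (simp add: field_simps)
  have mu5: "\<mu>\<^sup>2 * sqrt N ^ 5 \<le> 1 / 10 ^ 14"
  proof -
    have "\<mu>\<^sup>2 \<le> (1 / 10 ^ 7 * (N powr (-5/4)))\<^sup>2" using b mu by (intro power_mono) auto
    then have "\<mu>\<^sup>2 * sqrt N ^ 5 \<le> (1 / 10 ^ 7 * (N powr (-5/4)))\<^sup>2 * sqrt N ^ 5" using N2 by (intro mult_right_mono) auto
    also have "\<dots> = 1 / 10 ^ 14 * ((N powr (-5/4))\<^sup>2 * sqrt N ^ 5)"
      by (simp add: power_mult_distrib power_divide)
    also have "(N powr (-5/4))\<^sup>2 * sqrt N ^ 5 = 1"
    proof -
      have "(N powr (-5/4))\<^sup>2 = N powr (-5/2)" using N2 by (simp add: power2_eq_square powr_add[symmetric])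
      moreover have "sqrt N ^ 5 = N powr (5/2)"
        using N2 by (simp add: powr_half_sqrt[symmetric] powr_realpow[symmetric] powr_powr)
      ultimately show ?thesis using N2 by (simp add: powr_add[symmetric])
    qed
    finally show ?thesis by simp
  qed
  have mt: "0 < \<mu> * \<theta>" "\<mu> * \<theta> \<le> 1 / 4"
  proof -
    show "0 < \<mu> * \<theta>" using mu th by simp
    have "\<mu> * 1 \<le> \<mu> * N" using mu N2 by (intro mult_left_mono) auto
    then have "\<mu> \<le> 1 / 2" using muN th by simp
    then have "\<mu> * \<theta> \<le> 1 / 2 * (1 / 2)" using mu th by (intro mult_mono) auto
    then show "\<mu> * \<theta> \<le> 1 / 4" by simp
  qed
  \<comment> \<open>\<open>K\<close> is the argument of the logarithm in the sample-size hypothesis.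
    \<open>ln_growth\<close> is used with \<open>K\<close> for its \<open>N\<close> and with
    \<open>G \<le> K ^ 3\<close> for its \<open>M\<close>.\<close>
  define K where "K = N / (\<mu> * \<theta>)"
  have K4: "K \<ge> 4"
  proof -
    have "4 * (\<mu> * \<theta>) \<le> 1" using mt by simp
    then show ?thesis unfolding K_def using mt N2 by (simp add: pos_le_divide_eq)
  qed
  have lnK: "ln K \<ge> 1"
    using exp_le K4 by (subst ln_ge_iff) auto
  define G where "G = N ^ 3 / (\<mu> * \<theta>)\<^sup>2"
  have G1: "1 \<le> G"
  proof -
    have "(\<mu> * \<theta>)\<^sup>2 \<le> 1" using mt by (simp add: power_le_one)
    moreover have "1 \<le> N ^ 3" using N2 by simp
    ultimately have "1 * (\<mu> * \<theta>)\<^sup>2 \<le> N ^ 3" by linarith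
    then show ?thesis
      unfolding G_def by (rule pos_le_divide_eq[OF zero_less_power[OF mt(1)], THEN iffD2])
  qed
  have GK: "G \<le> K ^ 3"
  proof -
    have "(\<mu> * \<theta>) ^ 3 \<le> (\<mu> * \<theta>)\<^sup>2" using mt by (intro power_decreasing) auto
    then show ?thesis unfolding G_def K_def power_divide using mt N2 by (intro divide_left_mono) auto
  qed
  have pG: "64 * (10 ^ 18)\<^sup>2 * G * ln K \<le> real p"
    using * by (simp add: G_def K_def N_def power_mult_distrib)
  have growth: "10 ^ 18 * G * ln (real p) \<le> real p"
    by (rule ln_growth[OF _ lnK _ G1 GK pG]) (use K4 in auto)
  have p18: "10 ^ 18 \<le> real p"
  proof -
    have "1 \<le> G * ln K" using G1 lnK mult_mono[of 1 G 1 "ln K"] by simp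
    then have "64 * (10 ^ 18)\<^sup>2 * 1 \<le> 64 * (10 ^ 18)\<^sup>2 * (G * ln K)" by (intro mult_left_mono) auto
    with pG have "64 * (10 ^ 18)\<^sup>2 \<le> real p" by (simp only: mult.assoc mult_1_right)
    then show ?thesis by (rule order_trans[rotated]) simp
  qed
  interpret R: regime m p \<theta> \<mu>
    using m th mu muN mu5 p18 growth by unfold_locales (simp_all add: N_def G_def)
  have meas: "R.good \<in> sets (BG_matrix n p \<theta>)" "measure (BG_matrix n p \<theta>) R.good \<ge> 1 - 6 / real p ^ 6"
    using R.good by (simp_all add: R.BGM_def R.P_def m)
  have land: "good_sample m p \<theta> \<mu> X" if "X \<in> R.good" for X
    using that by unfold_locales
  show "\<exists>A \<in> sets (BG_matrix n p \<theta>).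
         measure (BG_matrix n p \<theta>) A \<ge> 1 - 6 / real p ^ 6 \<and>
         (\<forall>X \<in> A.
            (\<forall>w \<in> vecs (n - 1). vnorm (n - 1) w \<le> \<mu> / (4 * sqrt 2) \<longrightarrow>
               (\<forall>v. (\<Sum>i<n - 1. \<Sum>j<n - 1. v i * hess (gobj n p \<mu> X) w i j * v j)
                      \<ge> 1 / 400000 * \<theta> / \<mu> * (\<Sum>i<n - 1. (v i)\<^sup>2))) \<and>
            (\<forall>w \<in> vecs (n - 1). \<mu> / (4 * sqrt 2) \<le> vnorm (n - 1) w \<and> vnorm (n - 1) w \<le> 1 / (20 * sqrt 5) \<longrightarrow>
               (\<Sum>i<n - 1. w i * grad (gobj n p \<mu> X) w i) / vnorm (n - 1) w \<ge> 1 / 400000 * \<theta>) \<and>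
            (\<forall>w \<in> vecs (n - 1). 1 / (20 * sqrt 5) \<le> vnorm (n - 1) w \<and>
                 vnorm (n - 1) w \<le> sqrt ((4 * real n - 1) / (4 * real n)) \<longrightarrow>
               (\<Sum>i<n - 1. \<Sum>j<n - 1. w i * hess (gobj n p \<mu> X) w i j * w j) / (vnorm (n - 1) w)\<^sup>2
                 \<le> - (1 / 400000) * \<theta>) \<and>
            (\<exists>!w\<^sub>s. local_min_on (n - 1) (gobj n p \<mu> X) (Gamma n) w\<^sub>s) \<and>
            (\<forall>w\<^sub>s. local_min_on (n - 1) (gobj n p \<mu> X) (Gamma n) w\<^sub>s \<longrightarrow>
               vnorm (n - 1) w\<^sub>s \<le> min (65536 * \<mu> / \<theta> * sqrt (real n * ln (real p) / real p)) (\<mu> / 16)))"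
    unfolding m(1) diff_Suc_1
    by (intro bexI[OF _ meas(1)[unfolded m(1)]] conjI[OF meas(2)[unfolded m(1)]] ballI conjI
        good_sample.landscape[OF land])
qed simp_all

end
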